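(* Let $n$ be an integer and let $f\colon P\to Q$ be an order-preserving map of posets, with $Q$ coherent. Suppose that for every $k\geq 1$ and every $m_1,\dots,m_k\in\mathcal M(Q)$ whose join $m_1\vee\cdots\vee m_k$ exists in $Q$, the poset $f^{-1}(Q_{\geq m_1\vee\cdots\vee m_k})$ is $(n-k+1)$-connected. Then $f$ is $(n+1)$-connected.
   Context: $\mathcal M(Q)$ is the set of minimal elements of $Q$, and $Q_{\geq q}=\{q'\in Q: q'\geq q\}$. A subset $S\subseteq Q$ is bounded above if there is $q\in Q$ with $s\leq q$ for all $s\in S$; its join, if it exists, is the minimum of the set of all such upper bounds $q$. A poset $Q$ is coherent if each $q\in Q$ lies above some element of $\mathcal M(Q)$, and every finite non-empty subset of $\mathcal M(Q)$ that is bounded above has a join in $Q$. Topological properties of a poset $P$ refer to its geometric realization $|P|$ (the realization of the nerve of $P$, equivalently of its order complex), and similarly for maps. A space $Z$ is $m$-connected ($m\geq 0$) if it is non-empty and $\pi_k(Z,z)=0$ for all $z\in Z$ and $0\leq k\leq m$; $(-1)$-connected means non-empty; every space is $m$-connected for $m\leq -2$. A map $f\colon Z\to W$ of non-empty spaces is $m$-connected ($m\geq 0$) if for each $z\in Z$ the map $\pi_k(Z,z)\to\pi_k(W,f(z))$ is an isomorphism for $0\leq k\leq m-1$ and a surjection for $k=m$. All maps are $m$-connected for $m\leq -1$, and $\emptyset\to\emptyset$ is $m$-connected for all $m$. *)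

theory Defs
  imports "HOL-Analysis.Analysis" "HOL-Algebra.Group"
begin

section \<open>Posets\<close>

text \<open>A poset is a carrier set \<open>Q\<close> (possibly empty) with a relation \<open>s\<close> such that
  \<open>partial_order_on Q s\<close>; here \<open>(x, y) \<in> s\<close> means \<open>x \<le> y\<close>.\<close>

definition minimal_elements :: "'b set \<Rightarrow> 'b rel \<Rightarrow> 'b set" where
  "minimal_elements Q s = {m \<in> Q. \<forall>q\<in>Q. (q, m) \<in> s \<longrightarrow> q = m}"

definition up_set :: "'b set \<Rightarrow> 'b rel \<Rightarrow> 'b \<Rightarrow> 'b set" where
  "up_set Q s q = {q' \<in> Q. (q, q') \<in> s}"

definition upper_bounds :: "'b set \<Rightarrow> 'b rel \<Rightarrow> 'b set \<Rightarrow> 'b set" where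
  "upper_bounds Q s S = {q \<in> Q. \<forall>x\<in>S. (x, q) \<in> s}"

definition bounded_above :: "'b set \<Rightarrow> 'b rel \<Rightarrow> 'b set \<Rightarrow> bool" where
  "bounded_above Q s S \<longleftrightarrow> upper_bounds Q s S \<noteq> {}"

definition is_join :: "'b set \<Rightarrow> 'b rel \<Rightarrow> 'b set \<Rightarrow> 'b \<Rightarrow> bool" where
  "is_join Q s S j \<longleftrightarrow>
     j \<in> upper_bounds Q s S \<and> (\<forall>q \<in> upper_bounds Q s S. (j, q) \<in> s)"

definition coherent_poset :: "'b set \<Rightarrow> 'b rel \<Rightarrow> bool" where
  "coherent_poset Q s \<longleftrightarrow>
     (\<forall>q\<in>Q. \<exists>m \<in> minimal_elements Q s. (m, q) \<in> s) \<and>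
     (\<forall>S. finite S \<and> S \<noteq> {} \<and> S \<subseteq> minimal_elements Q s \<and> bounded_above Q s S
        \<longrightarrow> (\<exists>j. is_join Q s S j))"

section \<open>Geometric realization of the order complex\<close>

text \<open>Only the restriction of \<open>r\<close> to \<open>A\<close> matters below, so \<open>realization A r\<close> is also the
  realization of a subset \<open>A\<close> of a larger poset with the induced order.\<close>

definition order_complex :: "'a set \<Rightarrow> 'a rel \<Rightarrow> 'a set set" where
  "order_complex A r = {\<sigma>. finite \<sigma> \<and> \<sigma> \<noteq> {} \<and> \<sigma> \<subseteq> A \<and> \<sigma> \<in> Chains r}"

text \<open>Points are given by their barycentric coordinates.\<close>

definition closed_simplex :: "'a set \<Rightarrow> ('a \<Rightarrow> real) set" where
  "closed_simplex \<sigma> = {x. (\<forall>p. 0 \<le> x p) \<and> (\<forall>p. p \<notin> \<sigma> \<longrightarrow> x p = 0) \<and> (\<Sum>p\<in>\<sigma>. x p) = 1}"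

text \<open>The weak topology: a set is open iff its intersection with each closed simplex is
  open in that simplex. For finite \<open>\<sigma>\<close>, the topology that \<open>closed_simplex \<sigma>\<close> inherits from the
  product topology on \<open>'a \<Rightarrow> real\<close> is the Euclidean one.\<close>

definition realization :: "'a set \<Rightarrow> 'a rel \<Rightarrow> ('a \<Rightarrow> real) topology" where
  "realization A r = topology (\<lambda>U.
     U \<subseteq> \<Union> (closed_simplex ` order_complex A r) \<and>
     (\<forall>\<sigma> \<in> order_complex A r.
        openin (top_of_set (closed_simplex \<sigma>)) (U \<inter> closed_simplex \<sigma>)))"

lemma openin_realization:
  "openin (realization A r) U \<longleftrightarrow>
     U \<subseteq> \<Union> (closed_simplex ` order_complex A r) \<and>
     (\<forall>\<sigma> \<in> order_complex A r.
        openin (top_of_set (closed_simplex \<sigma>)) (U \<inter> closed_simplex \<sigma>))"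
proof -
  let ?L = "\<lambda>U. U \<subseteq> \<Union> (closed_simplex ` order_complex A r) \<and>
     (\<forall>\<sigma> \<in> order_complex A r.
        openin (top_of_set (closed_simplex \<sigma>)) (U \<inter> closed_simplex \<sigma>))"
  have "istopology ?L"
    unfolding istopology_def
  proof (intro conjI allI impI)
    fix S T assume S: "?L S" and T: "?L T"
    show "S \<inter> T \<subseteq> \<Union> (closed_simplex ` order_complex A r)"
      using S by blast
    show "\<forall>\<sigma> \<in> order_complex A r.
        openin (top_of_set (closed_simplex \<sigma>)) (S \<inter> T \<inter> closed_simplex \<sigma>)"
    proof
      fix \<sigma> assume "\<sigma> \<in> order_complex A r"
      then have "openin (top_of_set (closed_simplex \<sigma>))
          ((S \<inter> closed_simplex \<sigma>) \<inter> (T \<inter> closed_simplex \<sigma>))"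
        using S T by (intro openin_Int[of _ "S \<inter> closed_simplex \<sigma>"]) blast+
      moreover have "(S \<inter> closed_simplex \<sigma>) \<inter> (T \<inter> closed_simplex \<sigma>) = S \<inter> T \<inter> closed_simplex \<sigma>"
        by blast
      ultimately show "openin (top_of_set (closed_simplex \<sigma>)) (S \<inter> T \<inter> closed_simplex \<sigma>)"
        by simp
    qed
  next
    fix \<K> assume K: "\<forall>S\<in>\<K>. ?L S"
    show "\<Union>\<K> \<subseteq> \<Union> (closed_simplex ` order_complex A r)"
      using K by blast
    show "\<forall>\<sigma> \<in> order_complex A r.
        openin (top_of_set (closed_simplex \<sigma>)) (\<Union>\<K> \<inter> closed_simplex \<sigma>)"
    proof
      fix \<sigma> assume "\<sigma> \<in> order_complex A r"
      then have "openin (top_of_set (closed_simplex \<sigma>)) (\<Union>S\<in>\<K>. S \<inter> closed_simplex \<sigma>)"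
        using K by (intro openin_Union) auto
      moreover have "(\<Union>S\<in>\<K>. S \<inter> closed_simplex \<sigma>) = \<Union>\<K> \<inter> closed_simplex \<sigma>"
        by blast
      ultimately show "openin (top_of_set (closed_simplex \<sigma>)) (\<Union>\<K> \<inter> closed_simplex \<sigma>)"
        by simp
    qed
  qed
  then show ?thesis
    unfolding realization_def by (simp add: topology_inverse')
qed

lemma topspace_realization:
  "topspace (realization A r) = \<Union> (closed_simplex ` order_complex A r)"
proof
  show "topspace (realization A r) \<subseteq> \<Union> (closed_simplex ` order_complex A r)"
    using openin_realization[of A r] openin_topspace by blast
  have "\<Union> (closed_simplex ` order_complex A r) \<inter> closed_simplex \<sigma> = closed_simplex \<sigma>"
    if "\<sigma> \<in> order_complex A r" for \<sigma>
    using that by blast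
  then have "openin (realization A r) (\<Union> (closed_simplex ` order_complex A r))"
    by (simp add: openin_realization)
  then show "\<Union> (closed_simplex ` order_complex A r) \<subseteq> topspace (realization A r)"
    by (rule openin_subset)
qed

text \<open>The affine extension of a vertex map; on a point of a realization the sum is finite.\<close>

definition realization_map :: "('a \<Rightarrow> 'b) \<Rightarrow> ('a \<Rightarrow> real) \<Rightarrow> 'b \<Rightarrow> real" where
  "realization_map f x = (\<lambda>q. \<Sum>p | x p \<noteq> 0 \<and> f p = q. x p)"

section \<open>Homotopy groups\<close>

text \<open>\<open>\<pi>\<^sub>k(Z, z)\<close> consists of the homotopy classes, relative to the boundary, of maps from the cube
  \<open>I\<^sup>k\<close> to \<open>Z\<close> that send the boundary to \<open>z\<close>. The cube \<open>I\<^sup>0\<close> is a point with empty boundary,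
  so for \<open>k = 0\<close> this is the set of path components.\<close>

definition cube :: "nat \<Rightarrow> (nat \<Rightarrow> real) topology" where
  "cube k = product_topology (\<lambda>_. top_of_set {0..1}) {..<k}"

definition cube_boundary :: "nat \<Rightarrow> (nat \<Rightarrow> real) set" where
  "cube_boundary k = {x \<in> topspace (cube k). \<exists>i<k. x i = 0 \<or> x i = 1}"

definition cube_maps :: "nat \<Rightarrow> 'z topology \<Rightarrow> 'z \<Rightarrow> ((nat \<Rightarrow> real) \<Rightarrow> 'z) set" where
  "cube_maps k Z z = {a. continuous_map (cube k) Z a \<and> (\<forall>x \<in> cube_boundary k. a x = z)}"

definition cube_homotopic ::
    "nat \<Rightarrow> 'z topology \<Rightarrow> 'z \<Rightarrow> ((nat \<Rightarrow> real) \<Rightarrow> 'z) \<Rightarrow> ((nat \<Rightarrow> real) \<Rightarrow> 'z) \<Rightarrow> bool" where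
  "cube_homotopic k Z z = homotopic_with (\<lambda>h. \<forall>x \<in> cube_boundary k. h x = z) (cube k) Z"

definition cube_class ::
    "nat \<Rightarrow> 'z topology \<Rightarrow> 'z \<Rightarrow> ((nat \<Rightarrow> real) \<Rightarrow> 'z) \<Rightarrow> ((nat \<Rightarrow> real) \<Rightarrow> 'z) set" where
  "cube_class k Z z a = {b. cube_homotopic k Z z a b}"

text \<open>Concatenation in the first coordinate, meaningful for \<open>k \<ge> 1\<close>.\<close>

definition cube_concat ::
    "((nat \<Rightarrow> real) \<Rightarrow> 'z) \<Rightarrow> ((nat \<Rightarrow> real) \<Rightarrow> 'z) \<Rightarrow> (nat \<Rightarrow> real) \<Rightarrow> 'z" where
  "cube_concat a b = (\<lambda>x. if x 0 \<le> 1/2 then a (x(0 := 2 * x 0)) else b (x(0 := 2 * x 0 - 1)))"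

text \<open>For \<open>k = 0\<close> only the carrier and the distinguished element are meaningful.\<close>

definition homotopy_group ::
    "nat \<Rightarrow> 'z topology \<Rightarrow> 'z \<Rightarrow> ((nat \<Rightarrow> real) \<Rightarrow> 'z) set monoid" where
  "homotopy_group k Z z =
     \<lparr>carrier = cube_class k Z z ` cube_maps k Z z,
      mult = (\<lambda>A B. \<Union>a\<in>A. \<Union>b\<in>B. cube_class k Z z (cube_concat a b)),
      one = cube_class k Z z (\<lambda>_. z)\<rparr>"

text \<open>The map \<open>\<pi>\<^sub>k(Z, z) \<rightarrow> \<pi>\<^sub>k(W, g z)\<close> induced by \<open>g\<close>, sending the class of \<open>a\<close> to that of \<open>g \<circ> a\<close>.\<close>

definition homotopy_group_map ::
    "nat \<Rightarrow> 'w topology \<Rightarrow> ('z \<Rightarrow> 'w) \<Rightarrow> 'z \<Rightarrow>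
     ((nat \<Rightarrow> real) \<Rightarrow> 'z) set \<Rightarrow> ((nat \<Rightarrow> real) \<Rightarrow> 'w) set" where
  "homotopy_group_map k W g z A = (\<Union>a\<in>A. cube_class k W (g z) (g \<circ> a))"

section \<open>Connectivity\<close>

definition connected_space_upto :: "int \<Rightarrow> 'z topology \<Rightarrow> bool" where
  "connected_space_upto m Z \<longleftrightarrow>
     (m \<ge> -1 \<longrightarrow> topspace Z \<noteq> {}) \<and>
     (\<forall>z \<in> topspace Z. \<forall>k. int k \<le> m \<longrightarrow>
        carrier (homotopy_group k Z z) = {one (homotopy_group k Z z)})"

text \<open>An isomorphism on \<open>\<pi>\<^sub>0\<close> is a bijection. A map from the empty space to a non-empty one
  is \<open>m\<close>-connected only for \<open>m \<le> -1\<close>.\<close>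

definition connected_map_upto ::
    "int \<Rightarrow> 'z topology \<Rightarrow> 'w topology \<Rightarrow> ('z \<Rightarrow> 'w) \<Rightarrow> bool" where
  "connected_map_upto m Z W g \<longleftrightarrow>
     continuous_map Z W g \<and>
     (m \<le> -1 \<or>
      (topspace Z = {} \<and> topspace W = {}) \<or>
      (topspace Z \<noteq> {} \<and> topspace W \<noteq> {} \<and>
       (\<forall>z \<in> topspace Z. \<forall>k.
          (int k \<le> m - 1 \<longrightarrow>
             (if k = 0
              then bij_betw (homotopy_group_map k W g z)
                     (carrier (homotopy_group k Z z)) (carrier (homotopy_group k W (g z)))
              else homotopy_group_map k W g z
                     \<in> iso (homotopy_group k Z z) (homotopy_group k W (g z)))) \<and>
          (int k = m \<longrightarrow>
             homotopy_group_map k W g z ` carrier (homotopy_group k Z z)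
               = carrier (homotopy_group k W (g z))))))"

end

theory Submission
  imports Defs
begin

text \<open>
  Call a map \<open>f : X \<rightarrow> Y\<close> \<open>N\<close>-lifting if for all \<open>k \<le> N\<close> it has the homotopy extension and lifting
  property for the pair (cube, boundary) in dimension \<open>k\<close>; this implies that \<open>f\<close> is \<open>N\<close>-connected.
  If \<open>Y\<close> is the union of two open sets \<open>U\<close>, \<open>V\<close> such that \<open>f\<close> is \<open>N\<close>-lifting over \<open>U\<close> and over
  \<open>V\<close>, and \<open>(N - 1)\<close>-lifting over \<open>U \<inter> V\<close>, then \<open>f\<close> is \<open>N\<close>-lifting: subdivide the cube so finely that
  each small cube maps to \<open>U\<close> or to \<open>V\<close>, and lift first over the union of the common faces of the two
  kinds of small cubes, which has smaller dimension, then over the rest. By induction, for a finite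
  open cover it suffices that \<open>f\<close> is \<open>(N - k + 1)\<close>-lifting over every \<open>k\<close>-fold intersection.

  This is applied to the open stars of \<open>Q\<^sub>\<ge>\<^sub>m\<close> in \<open>|Q|\<close>, for \<open>m\<close> minimal. Since a chain in \<open>Q\<close> has a
  greatest element, their intersections are empty or the star of \<open>Q\<^sub>\<ge>\<^sub>j\<close> with \<open>j\<close> a join. That star is
  contractible, and its preimage deformation retracts onto the realization of the fibre, which is
  highly connected. Only finitely many \<open>m\<close> matter for a given compact cube.
\<close>

text \<open>Every lifting problem over an open part of \<open>Y\<close> keeps the whole space
  \<open>X\<close>: since the lifted map satisfies \<open>g' (0, x) = f (a' x)\<close>, it lands
  over that part automatically, and no preimages have to be compared when pieces are glued. Lifts
  over \<open>U\<close> and over \<open>V\<close> chosen separately need not agree over the overlap;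
  this forces the detour through the common faces, and their dimension, smaller by one, is why one
  degree less suffices over \<open>U \<inter> V\<close>. Working with maps of cubes relative to
  arbitrary boundary data avoids base points and exact sequences.

  The numbers fit as follows. Filling the boundary of a \<open>k\<close>-cube concerns a sphere of
  dimension \<open>k - 1\<close>, so an \<open>m\<close>-connected fibre admits fillings up to
  dimension \<open>m + 1\<close>. For \<open>m = n - c + 1\<close>, with \<open>c\<close> minimal
  elements, this is \<open>n - c + 2 = (n + 1) - c + 1\<close>, exactly what the cover argument with
  \<open>N = n + 1\<close> requires. Lifting in dimension \<open>k\<close> gives surjectivity on
  \<open>\<pi>\<^sub>k\<close>, and lifting in dimension \<open>k + 1\<close> gives injectivity
  there.\<close>

section \<open>Cubes and filling\<close>

text \<open>As an introduction rule this splits goals into coordinates before the rules for maps into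
  \<open>nat \<Rightarrow> real\<close> below can apply.\<close>

declare continuous_on_coordinatewise_then_product [continuous_intros del]

text \<open>Sources are subsets of type-class spaces, where the \<open>continuous_on\<close> rules
  apply; targets are abstract topologies, because the weak topology of a realization is in general
  not inherited from the function space.\<close>

abbreviation cmap :: "'k::topological_space set \<Rightarrow> 'z topology \<Rightarrow> ('k \<Rightarrow> 'z) \<Rightarrow> bool" where
  "cmap S Z g \<equiv> continuous_map (top_of_set S) Z g"

lemma cmap_subset: "cmap S Z g \<Longrightarrow> T \<subseteq> S \<Longrightarrow> cmap T Z g"
  by (rule continuous_map_from_subtopology_mono)

lemma cmap_cong: "cmap S Z g \<Longrightarrow> (\<And>x. x \<in> S \<Longrightarrow> g x = h x) \<Longrightarrow> cmap S Z h"
  by (erule continuous_map_eq) simp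

lemma cmap_comp:
  assumes "cmap T Z g" "continuous_on S h" "\<And>x. x \<in> S \<Longrightarrow> h x \<in> T"
  shows "cmap S Z (\<lambda>x. g (h x))"
proof -
  have "continuous_map (top_of_set S) (top_of_set T) h"
    using assms by (auto simp: continuous_map_in_subtopology)
  from continuous_map_compose[OF this assms(1)] show ?thesis by (simp add: o_def)
qed

lemma cmap_Un:
  assumes "closed A" "closed B" "cmap A Z g" "cmap B Z g"
  shows "cmap (A \<union> B) Z g"
proof (rule pasting_lemma_closed[where I = "{A, B}" and T = id and f = "\<lambda>_. g"])
  show "closedin (top_of_set (A \<union> B)) (id i)" if "i \<in> {A, B}" for i
    using that assms by (auto intro: closed_subset)
  show "continuous_map (subtopology (top_of_set (A \<union> B)) (id i)) Z g" if "i \<in> {A, B}" for i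
    using that assms
    by (auto simp: subtopology_subtopology Int_absorb1 Un_Int_distrib2 Int_absorb2)
qed auto

lemma cmap_paste:
  assumes "closed A" "closed B" "cmap A Z g" "cmap B Z h"
    and "\<And>x. x \<in> A \<Longrightarrow> x \<in> B \<Longrightarrow> g x = h x"
  shows "cmap (A \<union> B) Z (\<lambda>x. if x \<in> A then g x else h x)"
  using assms by (intro cmap_Un) (auto intro: cmap_cong)

lemma cmap_If_le:
  fixes p :: "'k::topological_space \<Rightarrow> real"
  assumes "continuous_on S p" "continuous_on S q"
    and "cmap {x \<in> S. p x \<le> q x} Z g" "cmap {x \<in> S. q x \<le> p x} Z h"
    and "\<And>x. x \<in> S \<Longrightarrow> p x = q x \<Longrightarrow> g x = h x"
  shows "cmap S Z (\<lambda>x. if p x \<le> q x then g x else h x)"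
proof (rule continuous_map_cases_le)
  show "continuous_map (top_of_set S) euclideanreal p" "continuous_map (top_of_set S) euclideanreal q"
    using assms by auto
  have eq: "S \<inter> {x \<in> S. P x} = {x \<in> S. P x}" for P by auto
  show "continuous_map (subtopology (top_of_set S) {x \<in> topspace (top_of_set S). p x \<le> q x}) Z g"
    "continuous_map (subtopology (top_of_set S) {x \<in> topspace (top_of_set S). q x \<le> p x}) Z h"
    using assms by (simp_all add: subtopology_subtopology eq)
qed (use assms in auto)

text \<open>The cubes of \<open>Defs\<close> consist of functions that are \<open>undefined\<close> outside \<open>{..<k}\<close>; here they
  are replaced by copies extended by \<open>0\<close>, which are closed subsets of the topological space
  \<open>nat \<Rightarrow> real\<close>.\<close>

definition std_cube :: "nat \<Rightarrow> (nat \<Rightarrow> real) set" where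
  "std_cube k = {x. (\<forall>i<k. 0 \<le> x i \<and> x i \<le> 1) \<and> (\<forall>i\<ge>k. x i = 0)}"

definition std_boundary :: "nat \<Rightarrow> (nat \<Rightarrow> real) set" where
  "std_boundary k = {x \<in> std_cube k. \<exists>i<k. x i = 0 \<or> x i = 1}"

text \<open>Twice the sup distance to the centre of the cube.\<close>

primrec cube_norm :: "nat \<Rightarrow> (nat \<Rightarrow> real) \<Rightarrow> real" where
  "cube_norm 0 x = 0"
| "cube_norm (Suc k) x = max (cube_norm k x) \<bar>2 * x k - 1\<bar>"

lemma cube_norm_nonneg [simp]: "0 \<le> cube_norm k x"
  by (induction k) auto

lemma cube_norm_ge: "i < k \<Longrightarrow> \<bar>2 * x i - 1\<bar> \<le> cube_norm k x"
  by (induction k) (auto simp: less_Suc_eq)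

lemma cube_norm_le_iff: "0 \<le> c \<Longrightarrow> cube_norm k x \<le> c \<longleftrightarrow> (\<forall>i<k. \<bar>2 * x i - 1\<bar> \<le> c)"
  by (induction k) (auto simp: less_Suc_eq)

lemma cube_norm_attained: "cube_norm k x = 0 \<or> (\<exists>i<k. cube_norm k x = \<bar>2 * x i - 1\<bar>)"
  by (induction k) (auto simp: less_Suc_eq max_def)

lemma continuous_on_coord:
  fixes f :: "'a::topological_space \<Rightarrow> 'i \<Rightarrow> 'b::topological_space"
  shows "continuous_on S f \<Longrightarrow> continuous_on S (\<lambda>z. f z i)"
  by (rule continuous_on_product_then_coordinatewise)

lemma continuous_on_coord_id [continuous_intros]:
  "continuous_on S (\<lambda>x :: 'i \<Rightarrow> 'b::topological_space. x i)"
  by (rule continuous_on_coord) (rule continuous_on_id)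

lemma continuous_on_coord_snd [continuous_intros]:
  "continuous_on S (\<lambda>z :: 'a::topological_space \<times> ('i \<Rightarrow> 'b::topological_space). snd z i)"
  by (rule continuous_on_coord) (intro continuous_intros)

lemma continuous_on_cube_norm [continuous_intros]:
  "continuous_on S f \<Longrightarrow> continuous_on S (\<lambda>z. cube_norm k (f z))"
proof (induction k)
  case (Suc k)
  then show ?case
    using continuous_on_coord[OF Suc.prems, of k] by (auto intro!: continuous_intros)
qed auto

lemma std_cube_iff: "x \<in> std_cube k \<longleftrightarrow> cube_norm k x \<le> 1 \<and> (\<forall>i\<ge>k. x i = 0)"
  by (auto simp: std_cube_def cube_norm_le_iff abs_le_iff)

text \<open>A positive norm is attained at some coordinate, and \<open>|2 * x i - 1| = 1\<close>
  means that this coordinate is 0 or 1. For \<open>k = 0\<close> the norm is 0, in accordance with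
  the empty boundary.\<close>

lemma std_boundary_iff: "x \<in> std_boundary k \<longleftrightarrow> cube_norm k x = 1 \<and> (\<forall>i\<ge>k. x i = 0)"
proof
  assume x: "x \<in> std_boundary k"
  then have c: "x \<in> std_cube k" by (simp add: std_boundary_def)
  from x obtain i where i: "i < k" "x i = 0 \<or> x i = 1" by (auto simp: std_boundary_def)
  then have "1 \<le> cube_norm k x" using cube_norm_ge[of i k x] by auto
  with c show "cube_norm k x = 1 \<and> (\<forall>i\<ge>k. x i = 0)" by (simp add: std_cube_iff)
next
  assume x: "cube_norm k x = 1 \<and> (\<forall>i\<ge>k. x i = 0)"
  then obtain i where "i < k" "\<bar>2 * x i - 1\<bar> = 1" using cube_norm_attained[of k x] by auto
  then have "\<exists>i<k. x i = 0 \<or> x i = 1" by (intro exI[of _ i]) (auto simp: abs_if split: if_splits)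
  with x show "x \<in> std_boundary k" by (simp add: std_boundary_def std_cube_iff)
qed

lemma std_boundary_subset: "std_boundary k \<subseteq> std_cube k"
  by (auto simp: std_boundary_def)

lemma closed_std_cube [simp]: "closed (std_cube k)"
proof -
  have "std_cube k = {x. cube_norm k x \<le> 1} \<inter> (\<Inter>i\<in>{k..}. {x. x i = 0})"
    by (auto simp: std_cube_iff)
  also have "closed \<dots>"
    by (intro closed_Int closed_INT ballI closed_Collect_le closed_Collect_eq continuous_intros)
  finally show ?thesis .
qed

lemma closed_std_boundary [simp]: "closed (std_boundary k)"
proof -
  have "std_boundary k = {x. cube_norm k x = 1} \<inter> std_cube k"
    by (auto simp: std_boundary_iff std_cube_iff)
  also have "closed \<dots>"
    by (intro closed_Int closed_Collect_eq continuous_intros closed_std_cube)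
  finally show ?thesis .
qed

lemma std_cube_eq_PiE: "std_cube k = (\<Pi>\<^sub>E i\<in>UNIV. if i < k then {0..1} else {0})"
proof (rule Set.set_eqI)
  fix x
  show "x \<in> std_cube k \<longleftrightarrow> x \<in> (\<Pi>\<^sub>E i\<in>UNIV. if i < k then {0..1} else {0})"
    unfolding std_cube_def PiE_UNIV_domain Pi_iff by (simp add: all_conj_distrib) (meson not_less)
qed

lemma compact_std_cube [simp]: "compact (std_cube k)"
proof -
  have "compactin (product_topology (\<lambda>_::nat. euclideanreal) UNIV) (std_cube k)"
    unfolding std_cube_eq_PiE by (simp add: compactin_PiE)
  then show ?thesis by (simp add: euclidean_product_topology)
qed

lemma compact_std_boundary [simp]: "compact (std_boundary k)"
  by (metis closed_std_boundary compact_Int_closed compact_std_cube inf.absorb_iff2 std_boundary_subset)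

text \<open>Dilation about the centre. Coordinates from \<open>k\<close> on are set to 0, so
  membership of the result in the cube or its boundary is decided by \<open>cube_norm\<close>
  alone.\<close>

definition dil :: "nat \<Rightarrow> real \<Rightarrow> (nat \<Rightarrow> real) \<Rightarrow> nat \<Rightarrow> real" where
  "dil k c x = (\<lambda>i. if i < k then 1/2 + c * (x i - 1/2) else 0)"

lemma continuous_on_dil [continuous_intros]:
  assumes "continuous_on S c" "continuous_on S f"
  shows "continuous_on S (\<lambda>z. dil k (c z) (f z))"
proof (rule continuous_on_coordinatewise_then_product)
  fix i show "continuous_on S (\<lambda>z. dil k (c z) (f z) i)"
    unfolding dil_def using assms continuous_on_coord[OF assms(2), of i] by (cases "i < k") (auto intro!: continuous_intros)
qed

lemma cube_norm_dil [simp]: "cube_norm k (dil k c x) = \<bar>c\<bar> * cube_norm k x"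
proof -
  have "cube_norm j (dil k c x) = \<bar>c\<bar> * cube_norm j x" if "j \<le> k" for j
    using that
  proof (induction j)
    case (Suc j)
    have "\<bar>2 * dil k c x j - 1\<bar> = \<bar>c\<bar> * \<bar>2 * x j - 1\<bar>"
      using Suc.prems by (simp add: dil_def abs_mult[symmetric] algebra_simps)
    with Suc show ?case by (simp add: max_mult_distrib_left)
  qed simp
  then show ?thesis by simp
qed

lemma dil_one: "x \<in> std_cube k \<Longrightarrow> dil k 1 x = x"
  by (auto simp: dil_def std_cube_def)

lemma dil_in_cube: "\<bar>c\<bar> * cube_norm k x \<le> 1 \<Longrightarrow> dil k c x \<in> std_cube k"
  by (simp add: std_cube_iff) (simp add: dil_def)

lemma dil_in_boundary: "\<bar>c\<bar> * cube_norm k x = 1 \<Longrightarrow> dil k c x \<in> std_boundary k"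
  by (simp add: std_boundary_iff) (simp add: dil_def)

text \<open>Doubles the inner half of the cube onto the whole cube, and projects the outer collar
  radially to the boundary.\<close>

definition core :: "nat \<Rightarrow> (nat \<Rightarrow> real) \<Rightarrow> nat \<Rightarrow> real" where
  "core k x = dil k (1 / max (cube_norm k x) (1/2)) x"

lemma continuous_on_core [continuous_intros]:
  assumes "continuous_on S f"
  shows "continuous_on S (\<lambda>z. core k (f z))"
  unfolding core_def using assms by (intro continuous_intros) (auto simp: max_def)

lemma core_in_cube: "core k x \<in> std_cube k"
  unfolding core_def by (rule dil_in_cube) (auto simp: max_def field_simps)

lemma core_in_boundary: "1/2 \<le> cube_norm k x \<Longrightarrow> core k x \<in> std_boundary k"
  unfolding core_def by (rule dil_in_boundary) (auto simp: max_def field_simps)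

lemma core_boundary: "x \<in> std_boundary k \<Longrightarrow> core k x = x"
  using dil_one[of x k] std_boundary_subset[of k]
  by (auto simp: core_def std_boundary_iff std_cube_iff)

text \<open>A base-point-free form of the vanishing of the homotopy groups in degree
  \<open>k - 1\<close>. For \<open>k = 0\<close> the boundary is empty, and the condition says that
  \<open>Z\<close> is nonempty.\<close>

definition fills :: "'z topology \<Rightarrow> nat \<Rightarrow> bool" where
  "fills Z k \<longleftrightarrow> (\<forall>a. cmap (std_boundary k) Z a \<longrightarrow>
     (\<exists>F. cmap (std_cube k) Z F \<and> (\<forall>x\<in>std_boundary k. F x = a x)))"

text \<open>The inner half of the cube carries \<open>F\<close>, and the outer collar runs through
  the homotopy; \<open>core\<close> supplies the cube coordinate for both.\<close>

lemma fill_homotopic: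
  assumes H: "cmap ({0..1} \<times> std_boundary k) Z H"
    and F: "cmap (std_cube k) Z F" "\<And>x. x \<in> std_boundary k \<Longrightarrow> F x = H (1, x)"
  shows "\<exists>G. cmap (std_cube k) Z G \<and> (\<forall>x\<in>std_boundary k. G x = H (0::real, x))"
proof (intro exI conjI ballI)
  \<comment> \<open>The time \<open>2 - 2 * cube_norm k x\<close> falls from 1 at the inner edge of
    the collar to 0 on the boundary.\<close>
  let ?G = "\<lambda>x. if cube_norm k x \<le> 1/2 then F (core k x) else H (2 - 2 * cube_norm k x, core k x)"
  show "cmap (std_cube k) Z ?G"
  proof (rule cmap_If_le)
    show "cmap {x \<in> std_cube k. cube_norm k x \<le> 1 / 2} Z (\<lambda>x. F (core k x))"
      by (rule cmap_comp[OF F(1)]) (auto intro!: continuous_intros core_in_cube)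
    show "cmap {x \<in> std_cube k. 1 / 2 \<le> cube_norm k x} Z (\<lambda>x. H (2 - 2 * cube_norm k x, core k x))"
      by (rule cmap_comp[OF H]) (auto intro!: continuous_intros core_in_boundary simp: std_cube_iff)
    show "F (core k x) = H (2 - 2 * cube_norm k x, core k x)"
      if "x \<in> std_cube k" "cube_norm k x = 1 / 2" for x
    proof -
      have "2 - 2 * cube_norm k x = 1" using that by simp
      then show ?thesis using that F(2)[OF core_in_boundary[of k x]] by (simp only:)
    qed
  qed (auto intro!: continuous_intros)
  show "?G x = H (0, x)" if "x \<in> std_boundary k" for x
    using that by (auto simp: std_boundary_iff core_boundary)
qed

text \<open>Deforms \<open>a\<close> into \<open>W\<close>, fills there and reads the filling in
  \<open>Z\<close>. The deformation may depend on \<open>a\<close>: for realizations it is built for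
  one map from a compact set at a time, not on a whole star.\<close>

lemma fills_retract:
  assumes "fills W k"
    and "\<And>a. cmap (std_boundary k) Z a \<Longrightarrow>
      \<exists>b H. cmap (std_boundary k) W b \<and> cmap ({0..1::real} \<times> std_boundary k) Z H \<and>
        (\<forall>x\<in>std_boundary k. H (0, x) = a x \<and> H (1, x) = b x)"
    and "\<And>F. cmap (std_cube k) W F \<Longrightarrow> cmap (std_cube k) Z F"
  shows "fills Z k"
  unfolding fills_def
proof (intro allI impI)
  fix a assume "cmap (std_boundary k) Z a"
  from assms(2)[OF this] obtain b H where b: "cmap (std_boundary k) W b"
    and H: "cmap ({0..1::real} \<times> std_boundary k) Z H"
    and HH: "\<And>x. x\<in>std_boundary k \<Longrightarrow> H (0, x) = a x \<and> H (1, x) = b x" by blast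
  from assms(1) b obtain F where F: "cmap (std_cube k) W F" "\<And>x. x\<in>std_boundary k \<Longrightarrow> F x = b x"
    unfolding fills_def by blast
  from fill_homotopic[OF H assms(3)[OF F(1)]] F(2) HH
  show "\<exists>F. cmap (std_cube k) Z F \<and> (\<forall>x\<in>std_boundary k. F x = a x)" by (metis (no_types))
qed

lemma continuous_on_fun_upd [continuous_intros]:
  assumes "continuous_on S f" "continuous_on S c"
  shows "continuous_on S (\<lambda>z. (f z)(i := c z))"
proof (rule continuous_on_coordinatewise_then_product)
  fix j show "continuous_on S (\<lambda>z. ((f z)(i := c z)) j)"
    using assms(2) continuous_on_coord[OF assms(1), of j] by (cases "j = i") auto
qed

section \<open>Comparison with the cubes that define the homotopy groups\<close>

definition res :: "nat \<Rightarrow> (nat \<Rightarrow> real) \<Rightarrow> nat \<Rightarrow> real" where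
  "res k x = restrict x {..<k}"

definition ext :: "nat \<Rightarrow> (nat \<Rightarrow> real) \<Rightarrow> nat \<Rightarrow> real" where
  "ext k x = (\<lambda>i. if i < k then x i else 0)"

lemma topspace_cube: "topspace (cube k) = (\<Pi>\<^sub>E i\<in>{..<k}. {0..1})"
  by (simp add: cube_def)

lemma ext_res [simp]: "x \<in> std_cube k \<Longrightarrow> ext k (res k x) = x"
  by (auto simp: ext_def res_def std_cube_def)

lemma res_ext [simp]: "x \<in> topspace (cube k) \<Longrightarrow> res k (ext k x) = x"
  by (auto simp: ext_def res_def topspace_cube PiE_iff extensional_def restrict_def)

lemma res_cube: "x \<in> std_cube k \<Longrightarrow> res k x \<in> topspace (cube k)"
  by (auto simp: res_def std_cube_def topspace_cube)

lemma ext_cube: "x \<in> topspace (cube k) \<Longrightarrow> ext k x \<in> std_cube k"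
  by (auto simp: ext_def std_cube_def topspace_cube PiE_iff)

lemma res_boundary: "x \<in> std_boundary k \<Longrightarrow> res k x \<in> cube_boundary k"
  by (auto simp: std_boundary_def cube_boundary_def res_cube) (auto simp: res_def)

lemma ext_boundary: "x \<in> cube_boundary k \<Longrightarrow> ext k x \<in> std_boundary k"
  by (auto simp: std_boundary_def cube_boundary_def ext_cube) (auto simp: ext_def)

lemma continuous_map_res: "continuous_map (top_of_set (std_cube k)) (cube k) (res k)"
proof -
  have "continuous_map (top_of_set (std_cube k)) (top_of_set {0..1}) (\<lambda>x. x i)" if "i < k" for i
    using that by (auto simp: continuous_map_in_subtopology std_cube_def intro!: continuous_intros)
  then show ?thesis
    unfolding cube_def res_def
    by (subst continuous_map_componentwise) auto
qed

lemma continuous_map_ext: "continuous_map (cube k) (top_of_set (std_cube k)) (ext k)"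
proof -
  have "continuous_map (cube k) euclideanreal (\<lambda>x. ext k x i)" for i
  proof (cases "i < k")
    case True
    then have "continuous_map (cube k) (top_of_set {0..1::real}) (\<lambda>x. x i)"
      unfolding cube_def by (intro continuous_map_product_projection) auto
    then show ?thesis using True by (simp add: ext_def continuous_map_in_subtopology)
  qed (simp add: ext_def)
  then have "continuous_map (cube k) (product_topology (\<lambda>_. euclideanreal) UNIV) (ext k)"
    by (intro continuous_map_coordinatewise_then_product) auto
  then show ?thesis
    by (auto simp: continuous_map_in_subtopology euclidean_product_topology ext_cube)
qed

lemma continuous_map_cube_iff:
  "continuous_map (cube k) Z a \<longleftrightarrow> cmap (std_cube k) Z (\<lambda>x. a (res k x))"
proof
  show "continuous_map (cube k) Z a \<Longrightarrow> cmap (std_cube k) Z (\<lambda>x. a (res k x))"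
    using continuous_map_compose[OF continuous_map_res] by (auto simp: o_def)
  assume "cmap (std_cube k) Z (\<lambda>x. a (res k x))"
  from continuous_map_compose[OF continuous_map_ext this]
  show "continuous_map (cube k) Z a"
    by (rule continuous_map_eq) (auto simp: o_def)
qed

lemma cube_boundary_ball_iff:
  "(\<forall>x\<in>cube_boundary k. P x) \<longleftrightarrow> (\<forall>x\<in>std_boundary k. P (res k x))"
proof -
  have "\<exists>y\<in>std_boundary k. x = res k y" if "x \<in> cube_boundary k" for x
    using that ext_boundary[OF that] by (intro bexI[of _ "ext k x"]) (auto simp: cube_boundary_def)
  then show ?thesis using res_boundary by blast
qed

lemma cube_maps_iff:
  "a \<in> cube_maps k Z z \<longleftrightarrow>
     cmap (std_cube k) Z (\<lambda>x. a (res k x)) \<and> (\<forall>x\<in>std_boundary k. a (res k x) = z)"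
  by (simp add: cube_maps_def continuous_map_cube_iff cube_boundary_ball_iff)

lemma cube_homotopic_iff:
  "cube_homotopic k Z z a b \<longleftrightarrow>
     (\<exists>H. cmap ({0..1} \<times> std_cube k) Z H \<and>
        (\<forall>x\<in>std_cube k. H (0::real, x) = a (res k x) \<and> H (1, x) = b (res k x)) \<and>
        (\<forall>t\<in>{0..1}. \<forall>x\<in>std_boundary k. H (t, x) = z))" (is "?L \<longleftrightarrow> ?R")
proof -
  let ?I = "top_of_set {0..1::real}"
  have L: "?L \<longleftrightarrow> (\<exists>h. continuous_map (prod_topology ?I (cube k)) Z h \<and>
        (\<forall>x \<in> topspace (cube k). h (0, x) = a x) \<and> (\<forall>x \<in> topspace (cube k). h (1, x) = b x) \<and>
        (\<forall>t\<in>{0..1}. \<forall>x\<in>cube_boundary k. h (t, x) = z))"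
    unfolding cube_homotopic_def
    by (rule homotopic_with) (auto simp: cube_boundary_def)
  show ?thesis
  proof
    assume ?L
    then obtain h where h: "continuous_map (prod_topology ?I (cube k)) Z h"
      "\<And>x. x \<in> topspace (cube k) \<Longrightarrow> h (0, x) = a x" "\<And>x. x \<in> topspace (cube k) \<Longrightarrow> h (1, x) = b x"
      "\<And>t x. t\<in>{0..1} \<Longrightarrow> x\<in>cube_boundary k \<Longrightarrow> h (t, x) = z" unfolding L by blast
    have "continuous_map (prod_topology ?I (top_of_set (std_cube k))) (prod_topology ?I (cube k))
        (\<lambda>(t, x). (t, res k x))"
      unfolding continuous_map_prod_top using continuous_map_res by (auto simp: id_def[symmetric])
    from continuous_map_compose[OF this h(1)]
    have "cmap ({0..1} \<times> std_cube k) Z (\<lambda>(t, x). h (t, res k x))"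
      by (simp add: o_def case_prod_unfold)
    then show ?R
      using h res_cube res_boundary by (intro exI[of _ "\<lambda>(t, x). h (t, res k x)"]) auto
  next
    assume ?R
    then obtain H where H: "cmap ({0..1} \<times> std_cube k) Z H"
      "\<And>x. x\<in>std_cube k \<Longrightarrow> H (0::real, x) = a (res k x) \<and> H (1, x) = b (res k x)"
      "\<And>t x. t\<in>{0..1} \<Longrightarrow> x\<in>std_boundary k \<Longrightarrow> H (t, x) = z" by blast
    have "continuous_map (prod_topology ?I (cube k)) (prod_topology ?I (top_of_set (std_cube k)))
        (\<lambda>(t, x). (t, ext k x))"
      unfolding continuous_map_prod_top using continuous_map_ext by (auto simp: id_def[symmetric])
    from continuous_map_compose[OF this] H(1)
    have "continuous_map (prod_topology ?I (cube k)) Z (\<lambda>(t, x). H (t, ext k x))"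
      by (simp add: o_def case_prod_unfold)
    then show ?L
      unfolding L using H ext_cube ext_boundary
      by (intro exI[of _ "\<lambda>(t, x). H (t, ext k x)"]) auto
  qed
qed

lemma cube_homotopic_refl: "a \<in> cube_maps k Z z \<Longrightarrow> cube_homotopic k Z z a a"
  by (simp add: cube_homotopic_def cube_maps_def)

lemma cube_homotopic_sym: "cube_homotopic k Z z a b \<Longrightarrow> cube_homotopic k Z z b a"
  by (simp add: cube_homotopic_def homotopic_with_sym)

lemma cube_homotopic_trans:
  "cube_homotopic k Z z a b \<Longrightarrow> cube_homotopic k Z z b c \<Longrightarrow> cube_homotopic k Z z a c"
  unfolding cube_homotopic_def by (rule homotopic_with_trans)

lemma cube_homotopic_maps:
  "cube_homotopic k Z z a b \<Longrightarrow> a \<in> cube_maps k Z z \<and> b \<in> cube_maps k Z z"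
  unfolding cube_homotopic_def cube_maps_def
  using homotopic_with_imp_continuous_maps homotopic_with_imp_property by blast

lemma cube_class_eq_iff:
  assumes "a \<in> cube_maps k Z z"
  shows "cube_class k Z z a = cube_class k Z z b \<longleftrightarrow> cube_homotopic k Z z a b"
  using assms cube_homotopic_refl cube_homotopic_sym cube_homotopic_trans
  unfolding cube_class_def by (smt (verit) Collect_cong mem_Collect_eq)

lemma fills_0:
  assumes "topspace Z \<noteq> {}"
  shows "fills Z 0"
proof -
  from assms obtain z where "z \<in> topspace Z" by blast
  then have "cmap (std_cube 0) Z (\<lambda>_. z)" by simp
  then show ?thesis unfolding fills_def by (intro allI impI exI[of _ "\<lambda>_. z"]) (simp add: std_boundary_def)
qed

text \<open>A map on the boundary of the cube is deformed by a self-homotopy \<open>g\<close> of the boundary that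
  contracts everything but the top face \<open>x e = 1\<close> to the centre \<open>p\<close> of the bottom face. The homotopy
  moves \<open>x\<close> along the segment towards \<open>p\<close>, slowed down by \<open>\<phi>\<close>, and projects radially back to the boundary.
  The result is an element of \<open>\<pi>\<^sub>e\<close> on the top face.\<close>

lemma fills_Suc:
  assumes triv: "\<And>z. z \<in> topspace Z \<Longrightarrow> carrier (homotopy_group e Z z) = {one (homotopy_group e Z z)}"
  shows "fills Z (Suc e)"
  unfolding fills_def
proof (intro allI impI)
  fix a assume a: "cmap (std_boundary (Suc e)) Z a"
  let ?B = "std_boundary (Suc e)"
  \<comment> \<open>The boundary points with \<open>\<phi> x = 1\<close> are those of the bottom
    face and the sides; these reach \<open>p\<close> at time 1. At the centre of the top face
    \<open>\<phi> x = 0\<close>, so this point never moves.\<close>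
  define \<phi> where "\<phi> = (\<lambda>x. max (cube_norm e x) (1 - x e))"
  define G where "G = (\<lambda>(t::real, x) i. if i < e then x i + t * \<phi> x * (1/2 - x i)
      else if i = e then x e * (1 - t * \<phi> x) else 0)"
  define g where "g = (\<lambda>p. dil (Suc e) (1 / cube_norm (Suc e) (G p)) (G p))"
  define p where "p = (\<lambda>i. if i < e then 1/2 else (0::real))"
  have contphi: "continuous_on S (\<lambda>z::real \<times> (nat \<Rightarrow> real). \<phi> (snd z))" for S
    unfolding \<phi>_def by (intro continuous_intros)
  have contG: "continuous_on S G" for S
  proof (rule continuous_on_coordinatewise_then_product)
    fix i show "continuous_on S (\<lambda>z. G z i)"
      unfolding G_def case_prod_unfold
      by (cases "i < e"; cases "i = e") (auto intro!: continuous_intros contphi)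
  qed
  \<comment> \<open>The segment towards \<open>p\<close> could meet the centre of the cube only if
    it started at the centre of the top face, and that point is held fixed. So the radial projection
    is defined throughout.\<close>
  have pos: "cube_norm (Suc e) (G (t, x)) > 0" if x: "x \<in> ?B" for t x
  proof (rule ccontr)
    assume "\<not> ?thesis"
    then have "cube_norm (Suc e) (G (t, x)) \<le> 0" by simp
    then have z: "\<And>i. i \<le> e \<Longrightarrow> 2 * G (t, x) i = 1"
      by (subst (asm) cube_norm_le_iff) (auto simp: less_Suc_eq_le)
    from z[of e] have e: "2 * (x e * (1 - t * \<phi> x)) = 1" by (simp add: G_def)
    then have nz: "1 - t * \<phi> x \<noteq> 0" by auto
    have "x i = 1/2" if "i < e" for i
    proof -
      from z[of i] that have "(1 - t * \<phi> x) * (2 * x i - 1) = 0" by (simp add: G_def algebra_simps)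
      with nz show ?thesis by simp
    qed
    moreover from x obtain i where "i < Suc e" "x i = 0 \<or> x i = 1" by (auto simp: std_boundary_def)
    ultimately have "x e = 0 \<or> x e = 1" by (force simp: less_Suc_eq)
    with e have x1: "x e = 1" by auto
    have "cube_norm e x \<le> 0"
      using \<open>\<And>i. i < e \<Longrightarrow> x i = 1/2\<close> by (subst cube_norm_le_iff) (simp_all add: field_simps)
    then have "cube_norm e x = 0" using cube_norm_nonneg[of e x] by linarith
    with x1 have "\<phi> x = 0" by (simp add: \<phi>_def)
    with e x1 show False by simp
  qed
  have gB: "g (t, x) \<in> ?B" if "x \<in> ?B" for t x
    unfolding g_def using pos[OF that, of t] by (intro dil_in_boundary) simp
  have nz: "cube_norm (Suc e) (G q) \<noteq> 0" if "q \<in> {0..1} \<times> ?B" for q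
    using that pos less_irrefl by (metis mem_Sigma_iff prod.collapse)
  have contg: "continuous_on ({0..1} \<times> ?B) g"
    unfolding g_def using nz by (intro continuous_intros contG) blast
  have g0: "g (0, x) = x" if "x \<in> ?B" for x
  proof -
    have "G (0, x) = x" using that by (auto simp: G_def std_boundary_iff fun_eq_iff)
    with that show ?thesis
      using dil_one[of x "Suc e"] by (auto simp: g_def std_boundary_iff std_cube_iff)
  qed
  have pB: "p \<in> ?B" by (auto simp: p_def std_boundary_def std_cube_def intro!: exI[of _ e])
  have g1: "g (1, x) = p" if x: "x \<in> ?B" and *: "x e = 0 \<or> cube_norm e x = 1" for x
  proof -
    have "\<phi> x = 1"
      using x * unfolding \<phi>_def by (auto simp: std_boundary_iff std_cube_def max_def abs_le_iff)
    then have "G (1, x) = p" by (auto simp: G_def p_def fun_eq_iff)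
    moreover have "cube_norm (Suc e) p = 1" using pB by (simp add: std_boundary_iff)
    ultimately show ?thesis
      using dil_one[of p "Suc e"] pB std_boundary_subset unfolding g_def by auto
  qed
  have top: "x(e := 1) \<in> ?B" if "x \<in> std_cube e" for x
    using that by (auto simp: std_boundary_def std_cube_def less_Suc_eq intro!: exI[of _ e])
  have cnu: "cube_norm e (x(e := c)) = cube_norm e x" for x c
  proof -
    have "cube_norm j (x(e := c)) = cube_norm j x" if "j \<le> e" for j
      using that by (induction j) auto
    then show ?thesis by simp
  qed
  define z where "z = a p"
  have zZ: "z \<in> topspace Z"
    using a pB continuous_map_image_subset_topspace[OF a] unfolding z_def by auto
  \<comment> \<open>The rim of the top face is sent to \<open>p\<close> at time 1, so the top face
    represents an element of \<open>\<pi>\<^sub>e\<close> with base point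
    \<open>a p\<close>.\<close>
  define \<alpha> where "\<alpha> = (\<lambda>y. a (g (1, (ext e y)(e := 1))))"
  have \<alpha>res: "\<alpha> (res e x) = a (g (1, x(e := 1)))" if "x \<in> std_cube e" for x
    using that by (simp add: \<alpha>_def)
  have "\<alpha> \<in> cube_maps e Z z"
    unfolding cube_maps_iff
  proof (intro conjI ballI)
    have "cmap (std_cube e) Z (\<lambda>x. a (g (1, x(e := 1))))"
      by (rule cmap_comp[OF a])
        (auto intro!: gB top continuous_intros continuous_on_compose2[OF contg])
    then show "cmap (std_cube e) Z (\<lambda>x. \<alpha> (res e x))"
      by (rule cmap_cong) (simp add: \<alpha>res)
    show "\<alpha> (res e x) = z" if "x \<in> std_boundary e" for x
      using that std_boundary_subset[of e] top[of x]
      by (subst \<alpha>res) (auto simp: z_def g1 cnu std_boundary_iff)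
  qed
  then have "cube_class e Z z \<alpha> \<in> carrier (homotopy_group e Z z)"
    by (auto simp: homotopy_group_def)
  then have "cube_class e Z z \<alpha> = cube_class e Z z (\<lambda>_. z)"
    using triv[OF zZ] by (simp add: homotopy_group_def)
  then have "cube_homotopic e Z z \<alpha> (\<lambda>_. z)"
    using cube_class_eq_iff[OF \<open>\<alpha> \<in> cube_maps e Z z\<close>] by simp
  then obtain H where H: "cmap ({0..1} \<times> std_cube e) Z H"
    and H01: "\<And>x. x\<in>std_cube e \<Longrightarrow> H (0::real, x) = \<alpha> (res e x) \<and> H (1, x) = z"
    and Hb: "\<And>t x. t\<in>{0..1} \<Longrightarrow> x\<in>std_boundary e \<Longrightarrow> H (t, x) = z"
    unfolding cube_homotopic_iff by blast
  have drop: "x(e := 0) \<in> std_cube e" if "x \<in> std_cube (Suc e)" for x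
    using that by (auto simp: std_cube_def)
  have "cmap ({0..1} \<times> ?B) Z (\<lambda>q. a (g q))"
    by (rule cmap_comp[OF a contg]) (auto intro: gB)
  \<comment> \<open>The null homotopy fills \<open>a (g (1, x))\<close>, with the height read
    backwards as time: the top face is time 0, where \<open>H\<close> is \<open>\<alpha>\<close>,
    and on the bottom and the sides both maps are constantly \<open>z\<close>.\<close>
  moreover have "cmap (std_cube (Suc e)) Z (\<lambda>x. H (1 - x e, x(e := 0)))"
    by (rule cmap_comp[OF H]) (auto intro!: continuous_intros drop simp: std_cube_def)
  moreover have "H (1 - x e, x(e := 0)) = a (g (1, x))" if x: "x \<in> ?B" for x
  proof (cases "x e = 0 \<or> cube_norm e x = 1")
    case True
    have xc: "x \<in> std_cube (Suc e)" using x by (simp add: std_boundary_def)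
    have "H (1 - x e, x(e := 0)) = z"
    proof (cases "x e = 0")
      case True
      then show ?thesis using H01[OF drop[OF xc]] by simp
    next
      case False
      with True have "x(e := 0) \<in> std_boundary e"
        using drop[OF xc] by (simp add: std_boundary_iff std_cube_iff cnu)
      then show ?thesis using xc by (intro Hb) (auto simp: std_cube_def)
    qed
    then show ?thesis using g1[OF x True] by (simp add: z_def)
  next
    case False
    have xc: "x \<in> std_cube (Suc e)" using x by (simp add: std_boundary_def)
    from x False have "\<bar>2 * x e - 1\<bar> = 1" by (auto simp: std_boundary_iff max_def split: if_splits)
    with False have "x e = 1" by (auto simp: abs_if split: if_splits)
    then show ?thesis
      using H01[OF drop[OF xc]] \<alpha>res[OF drop[OF xc]] by (simp add: fun_upd_idem)
  qed
  ultimately have "\<exists>G. cmap (std_cube (Suc e)) Z G \<and> (\<forall>x\<in>?B. G x = a (g (0, x)))"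
    by (rule fill_homotopic)
  then show "\<exists>F. cmap (std_cube (Suc e)) Z F \<and> (\<forall>x\<in>?B. F x = a x)"
    using g0 by (metis (no_types, lifting))
qed

text \<open>The boundary of a \<open>k\<close>-cube is a sphere of dimension \<open>k - 1\<close>,
  whence the bound \<open>m + 1\<close>. In dimension 0 only nonemptiness is at stake.\<close>

lemma fills_connected_space_upto:
  assumes "connected_space_upto m Z" "int k \<le> m + 1"
  shows "fills Z k"
proof (cases k)
  case 0
  with assms show ?thesis by (auto simp: connected_space_upto_def intro: fills_0)
next
  case (Suc e)
  with assms have "int e \<le> m" by simp
  with assms(1) show ?thesis
    unfolding Suc connected_space_upto_def by (intro fills_Suc) blast
qed

section \<open>The homotopy extension and lifting property\<close>

text \<open>The homotopy on \<open>L\<close> is arbitrary rather than constant, so that the property is closed under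
  composition of pairs without using the homotopy extension property of \<open>(K, L)\<close>.\<close>

definition lifts :: "'x topology \<Rightarrow> 'y topology \<Rightarrow> ('x \<Rightarrow> 'y) \<Rightarrow>
    'k::topological_space set \<Rightarrow> 'k set \<Rightarrow> bool" where
  "lifts X Y f K L \<longleftrightarrow> (\<forall>a g. cmap L X a \<and> cmap ({1} \<times> K \<union> {0..1::real} \<times> L) Y g \<and>
     (\<forall>x\<in>L. g (0, x) = f (a x)) \<longrightarrow>
     (\<exists>a' g'. cmap K X a' \<and> cmap ({0..1} \<times> K) Y g' \<and> (\<forall>x\<in>L. a' x = a x) \<and>
        (\<forall>p\<in>{1} \<times> K \<union> {0..1} \<times> L. g' p = g p) \<and> (\<forall>x\<in>K. g' (0, x) = f (a' x))))"

lemma liftsI: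
  assumes "\<And>a g. cmap L X a \<Longrightarrow> cmap ({1} \<times> K \<union> {0..1::real} \<times> L) Y g \<Longrightarrow>
      \<forall>x\<in>L. g (0, x) = f (a x) \<Longrightarrow>
     \<exists>a' g'. cmap K X a' \<and> cmap ({0..1} \<times> K) Y g' \<and> (\<forall>x\<in>L. a' x = a x) \<and>
        (\<forall>p\<in>{1} \<times> K \<union> {0..1} \<times> L. g' p = g p) \<and> (\<forall>x\<in>K. g' (0, x) = f (a' x))"
  shows "lifts X Y f K L"
  using assms unfolding lifts_def by simp

lemma liftsE:
  assumes "lifts X Y f K L" "cmap L X a" "cmap ({1} \<times> K \<union> {0..1::real} \<times> L) Y g"
    "\<forall>x\<in>L. g (0, x) = f (a x)"
  obtains a' g' where "cmap K X a'" "cmap ({0..1} \<times> K) Y g'" "\<And>x. x \<in> L \<Longrightarrow> a' x = a x"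
    "\<And>x. x \<in> K \<Longrightarrow> g' (1, x) = g (1, x)"
    "\<And>t x. t \<in> {0..1} \<Longrightarrow> x \<in> L \<Longrightarrow> g' (t, x) = g (t, x)"
    "\<And>x. x \<in> K \<Longrightarrow> g' (0, x) = f (a' x)"
  using assms(1)[unfolded lifts_def, rule_format, of a g] assms(2-) by (auto simp: Ball_def)

lemma lifts_refl: "lifts X Y f L L"
proof (rule liftsI, intro exI conjI)
  fix a and g :: "real \<times> _ \<Rightarrow> _" assume *: "cmap L X a" "cmap ({1} \<times> L \<union> {0..1} \<times> L) Y g" "\<forall>x\<in>L. g (0, x) = f (a x)"
  show "cmap L X a" by fact
  show "cmap ({0..1} \<times> L) Y g" using *(2) by (rule cmap_subset) auto
qed auto

lemma lifts_trans:
  assumes KL: "lifts X Y f K L" and LM: "lifts X Y f L M"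
    and "M \<subseteq> L" "L \<subseteq> K" "closed K" "closed L"
  shows "lifts X Y f K M"
proof (rule liftsI)
  fix a and g :: "real \<times> _ \<Rightarrow> _" assume a: "cmap M X a" and g: "cmap ({1} \<times> K \<union> {0..1} \<times> M) Y g"
    and ag: "\<forall>x\<in>M. g (0, x) = f (a x)"
  have gL: "cmap ({1} \<times> L \<union> {0..1} \<times> M) Y g" using g by (rule cmap_subset) (use assms in auto)
  obtain a1 g1 where a1: "cmap L X a1" "cmap ({0..1} \<times> L) Y g1"
    "\<And>x. x \<in> M \<Longrightarrow> a1 x = a x" "\<And>x. x \<in> L \<Longrightarrow> g1 (1, x) = g (1, x)"
    "\<And>t x. t \<in> {0..1} \<Longrightarrow> x \<in> M \<Longrightarrow> g1 (t, x) = g (t, x)"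
    "\<And>x. x \<in> L \<Longrightarrow> g1 (0, x) = f (a1 x)" by (rule liftsE[OF LM a gL ag]) (rule that)
  \<comment> \<open>The homotopy found over \<open>L\<close> becomes the prescribed side of the
    second problem, together with the given top over \<open>K\<close>.\<close>
  define g2 where "g2 = (\<lambda>p. if p \<in> {1} \<times> K then g p else g1 p)"
  have g2: "cmap ({1} \<times> K \<union> {0..1} \<times> L) Y g2"
    unfolding g2_def
  proof (rule cmap_paste)
    show "cmap ({1} \<times> K) Y g" using g by (rule cmap_subset) auto
  qed (use a1 assms in \<open>auto intro: closed_Times\<close>)
  have g2a: "\<forall>x\<in>L. g2 (0, x) = f (a1 x)" using a1 by (simp add: g2_def)
  obtain a' g' where a': "cmap K X a'" "cmap ({0..1} \<times> K) Y g'"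
    "\<And>x. x \<in> L \<Longrightarrow> a' x = a1 x" "\<And>x. x \<in> K \<Longrightarrow> g' (1, x) = g2 (1, x)"
    "\<And>t x. t \<in> {0..1} \<Longrightarrow> x \<in> L \<Longrightarrow> g' (t, x) = g2 (t, x)"
    "\<And>x. x \<in> K \<Longrightarrow> g' (0, x) = f (a' x)" by (rule liftsE[OF KL a1(1) g2 g2a]) (rule that)
  have "g' (t, x) = g (t, x)" if "t \<in> {0..1}" "x \<in> M" for t x
    using that a' a1 \<open>M \<subseteq> L\<close> by (auto simp: g2_def subset_iff)
  moreover have "g' (1, x) = g (1, x)" if "x \<in> K" for x
    using that a' by (auto simp: g2_def)
  ultimately show "\<exists>a' g'. cmap K X a' \<and> cmap ({0..1} \<times> K) Y g' \<and> (\<forall>x\<in>M. a' x = a x) \<and>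
        (\<forall>p\<in>{1} \<times> K \<union> {0..1} \<times> M. g' p = g p) \<and> (\<forall>x\<in>K. g' (0, x) = f (a' x))"
    using a' a1 \<open>M \<subseteq> L\<close> by (intro exI[of _ a'] exI[of _ g']) (auto simp: subset_iff)
qed

lemma lifts_attach:
  assumes "lifts X Y f e E" "closed L" "closed e" "L \<inter> e = E"
  shows "lifts X Y f (L \<union> e) L"
proof (rule liftsI)
  fix a and g :: "real \<times> _ \<Rightarrow> _" assume a: "cmap L X a" and g: "cmap ({1} \<times> (L \<union> e) \<union> {0..1} \<times> L) Y g"
    and ag: "\<forall>x\<in>L. g (0, x) = f (a x)"
  have "cmap E X a" using a by (rule cmap_subset) (use assms in auto)
  moreover have "cmap ({1} \<times> e \<union> {0..1} \<times> E) Y g" using g by (rule cmap_subset) (use assms in auto)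
  moreover have "\<forall>x\<in>E. g (0, x) = f (a x)" using ag assms by auto
  ultimately obtain a1 g1 where a1: "cmap e X a1" "cmap ({0..1} \<times> e) Y g1"
    "\<And>x. x \<in> E \<Longrightarrow> a1 x = a x" "\<And>x. x \<in> e \<Longrightarrow> g1 (1, x) = g (1, x)"
    "\<And>t x. t \<in> {0..1} \<Longrightarrow> x \<in> E \<Longrightarrow> g1 (t, x) = g (t, x)"
    "\<And>x. x \<in> e \<Longrightarrow> g1 (0, x) = f (a1 x)" by (rule liftsE[OF assms(1)]) (rule that)
  let ?a = "\<lambda>x. if x \<in> L then a x else a1 x"
  let ?g = "\<lambda>p. if p \<in> {0..1} \<times> L then g p else g1 p"
  have "cmap (L \<union> e) X ?a"
    using a a1 assms by (intro cmap_paste) auto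
  moreover have "cmap ({0..1} \<times> L) Y g" using g by (rule cmap_subset) auto
  then have "cmap ({0..1} \<times> L \<union> {0..1} \<times> e) Y ?g"
    using a1 assms by (intro cmap_paste) (auto intro: closed_Times)
  then have "cmap ({0..1} \<times> (L \<union> e)) Y ?g" by (simp add: Sigma_Un_distrib2)
  ultimately show "\<exists>a' g'. cmap (L \<union> e) X a' \<and> cmap ({0..1} \<times> (L \<union> e)) Y g' \<and> (\<forall>x\<in>L. a' x = a x) \<and>
        (\<forall>p\<in>{1} \<times> (L \<union> e) \<union> {0..1} \<times> L. g' p = g p) \<and> (\<forall>x\<in>L \<union> e. g' (0, x) = f (a' x))"
    using a1 ag by (intro exI[of _ ?a] exI[of _ ?g]) auto
qed

lemma lifts_homeo:
  fixes K L :: "'k::topological_space set" and K' L' :: "'l::topological_space set"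
  assumes H: "lifts X Y f K L"
    and \<phi>: "continuous_on K' \<phi>" "\<And>x. x \<in> K' \<Longrightarrow> \<phi> x \<in> K"
    and \<psi>: "continuous_on K \<psi>" "\<And>y. y \<in> K \<Longrightarrow> \<psi> y \<in> K'"
    and inv: "\<And>x. x \<in> K' \<Longrightarrow> \<psi> (\<phi> x) = x" "\<And>y. y \<in> K \<Longrightarrow> \<phi> (\<psi> y) = y"
    and L: "L \<subseteq> K" "L' \<subseteq> K'" "\<And>x. x \<in> K' \<Longrightarrow> \<phi> x \<in> L \<longleftrightarrow> x \<in> L'"
  shows "lifts X Y f K' L'"
proof (rule liftsI)
  fix a and g :: "real \<times> _ \<Rightarrow> _" assume a: "cmap L' X a" and g: "cmap ({1} \<times> K' \<union> {0..1} \<times> L') Y g"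
    and ag: "\<forall>x\<in>L'. g (0, x) = f (a x)"
  have \<psi>L: "\<psi> y \<in> L'" if "y \<in> L" for y using that L inv \<psi> by (metis subsetD)
  have c\<psi>: "continuous_on S (\<lambda>x. \<psi> (snd x))" if "S \<subseteq> UNIV \<times> K" for S :: "(real \<times> 'k) set"
    using that by (intro continuous_on_compose2[OF \<psi>(1)] continuous_intros) auto
  have c\<phi>: "continuous_on S (\<lambda>x. \<phi> (snd x))" if "S \<subseteq> UNIV \<times> K'" for S :: "(real \<times> 'l) set"
    using that by (intro continuous_on_compose2[OF \<phi>(1)] continuous_intros) auto
  have "cmap L X (\<lambda>y. a (\<psi> y))"
    by (rule cmap_comp[OF a]) (use \<psi> \<psi>L L in \<open>auto intro: continuous_on_subset\<close>)
  moreover define g0 where "g0 = (\<lambda>p. g (fst p, \<psi> (snd p)))"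
  have "cmap ({1} \<times> K \<union> {0..1} \<times> L) Y g0"
    unfolding g0_def
    by (rule cmap_comp[OF g]) (use \<psi> \<psi>L L in \<open>auto intro!: c\<psi> continuous_on_Pair continuous_on_fst continuous_on_id\<close>)
  moreover have "\<forall>x\<in>L. g0 (0, x) = f (a (\<psi> x))" using ag \<psi>L by (simp add: g0_def)
  ultimately obtain a1 g1 where a1: "cmap K X a1" "cmap ({0..1} \<times> K) Y g1"
    "\<And>x. x \<in> L \<Longrightarrow> a1 x = a (\<psi> x)" "\<And>x. x \<in> K \<Longrightarrow> g1 (1, x) = g0 (1, x)"
    "\<And>t x. t \<in> {0..1} \<Longrightarrow> x \<in> L \<Longrightarrow> g1 (t, x) = g0 (t, x)"
    "\<And>x. x \<in> K \<Longrightarrow> g1 (0, x) = f (a1 x)"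
    by (rule liftsE[OF H]) (rule that)
  have "cmap K' X (\<lambda>x. a1 (\<phi> x))"
    by (rule cmap_comp[OF a1(1)]) (use \<phi> in auto)
  moreover have "cmap ({0..1} \<times> K') Y (\<lambda>p. g1 (fst p, \<phi> (snd p)))"
    by (rule cmap_comp[OF a1(2)]) (use \<phi> in \<open>auto intro!: c\<phi> continuous_on_Pair continuous_on_fst continuous_on_id\<close>)
  moreover have "a1 (\<phi> x) = a x" if "x \<in> L'" for x
    using that L a1 inv by (metis subsetD)
  moreover have "g1 (t, \<phi> x) = g (t, x)" if "x \<in> L'" "t \<in> {0..1}" for t x
  proof -
    from that L have "\<phi> x \<in> L" "\<psi> (\<phi> x) = x" using inv by auto
    then show ?thesis using a1(5) that by (simp add: g0_def)
  qed
  ultimately show "\<exists>a' g'. cmap K' X a' \<and> cmap ({0..1} \<times> K') Y g' \<and> (\<forall>x\<in>L'. a' x = a x) \<and>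
        (\<forall>p\<in>{1} \<times> K' \<union> {0..1} \<times> L'. g' p = g p) \<and> (\<forall>x\<in>K'. g' (0, x) = f (a' x))"
    using a1 \<phi> inv unfolding g0_def
    by (intro exI[of _ "\<lambda>x. a1 (\<phi> x)"] exI[of _ "\<lambda>p. g1 (fst p, \<phi> (snd p))"]) auto
qed

lemma cube_norm_cong: "(\<And>i. i < k \<Longrightarrow> x i = y i) \<Longrightarrow> cube_norm k x = cube_norm k y"
  by (induction k) auto

text \<open>First \<open>a\<close> is filled inside the part of \<open>X\<close> over
  \<open>Y\<close>. Then \<open>f \<circ> a'\<close> on the bottom and the given \<open>g\<close> on
  top and sides form a map on the boundary of a \<open>(k + 1)\<close>-cube in \<open>Y\<close>,
  whose filling is the homotopy.\<close>

lemma lifts_fills: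
  assumes X: "fills (subtopology X {x. f x \<in> topspace Y}) k"
    and Y: "fills Y (Suc k)"
    and f: "continuous_map (subtopology X {x. f x \<in> topspace Y}) Y f"
  shows "lifts X Y f (std_cube k) (std_boundary k)"
proof (rule liftsI)
  let ?B = "std_boundary k" and ?C = "std_cube k" and ?B' = "std_boundary (Suc k)"
  let ?X = "subtopology X {x. f x \<in> topspace Y}"
  fix a and g :: "real \<times> _ \<Rightarrow> _" assume a: "cmap ?B X a" and g: "cmap ({1} \<times> ?C \<union> {0..1} \<times> ?B) Y g"
    and ag: "\<forall>x\<in>?B. g (0, x) = f (a x)"
  have "f (a x) \<in> topspace Y" if "x \<in> ?B" for x
    using continuous_map_image_subset_topspace[OF g] that bspec[OF ag that] by (force simp: image_subset_iff)
  then have "cmap ?B ?X a"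
    using a by (auto simp: continuous_map_in_subtopology)
  then obtain a' where a': "cmap ?C ?X a'" "\<And>x. x \<in> ?B \<Longrightarrow> a' x = a x"
    using X unfolding fills_def by blast
  \<comment> \<open>The last coordinate \<open>y k\<close> is the time. Where the bottom meets the
    sides, the two definitions agree by the compatibility of \<open>g\<close> with
    \<open>a\<close>.\<close>
  define c where "c = (\<lambda>y. if y k = 0 then f (a' (y(k := 0))) else g (y k, y(k := 0)))"
  have drop: "y(k := 0) \<in> ?C" if "y \<in> std_cube (Suc k)" for y
    using that by (auto simp: std_cube_def)
  have cn: "cube_norm k (y(k := s)) = cube_norm k y" for y s
    by (rule cube_norm_cong) simp
  let ?S0 = "{y \<in> ?B'. y k = 0}"
  let ?S1 = "{y \<in> ?B'. y k = 1} \<union> {y \<in> ?B'. cube_norm k y = 1}"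
  have S1: "(y k, y(k := 0)) \<in> {1} \<times> ?C \<union> {0..1} \<times> ?B" if "y \<in> ?S1" for y
    using that drop[of y] std_boundary_subset[of "Suc k"]
    by (auto simp: std_boundary_iff[of _ k] cn std_cube_def)
  have "cmap (?S0 \<union> ?S1) Y c"
  proof (rule cmap_Un)
    have "closed ({y. y k = 0} \<inter> ?B')" "closed ({y. y k = 1} \<inter> ?B')" "closed ({y. cube_norm k y = 1} \<inter> ?B')"
      by (intro closed_Int closed_Collect_eq continuous_intros closed_std_boundary)+
    then show "closed ?S0" "closed ?S1" by (auto simp: Int_def conj_commute intro!: closed_Un)
    have "cmap ?C Y (\<lambda>x. f (a' x))"
      using continuous_map_compose[OF a'(1) f] by (simp add: o_def)
    then have "cmap ?S0 Y (\<lambda>y. f (a' (y(k := 0))))"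
      by (rule cmap_comp) (use drop std_boundary_subset in \<open>auto intro!: continuous_intros\<close>)
    then show "cmap ?S0 Y c" by (rule cmap_cong) (simp add: c_def)
    have "cmap ?S1 Y (\<lambda>y. g (y k, y(k := 0)))"
      by (rule cmap_comp[OF g]) (use S1 in \<open>auto intro!: continuous_intros\<close>)
    then show "cmap ?S1 Y c"
    proof (rule cmap_cong)
      fix y assume y: "y \<in> ?S1"
      show "g (y k, y(k := 0)) = c y"
      proof (cases "y k = 0")
        case True
        with S1[OF y] have "y(k := 0) \<in> ?B" by auto
        with True show ?thesis using ag a' by (simp add: c_def)
      qed (simp add: c_def)
    qed
  qed
  moreover have "?B' \<subseteq> ?S0 \<union> ?S1"
  proof
    fix y assume y: "y \<in> ?B'"
    then have "cube_norm k y = 1 \<or> \<bar>2 * y k - 1\<bar> = 1" by (auto simp: std_boundary_iff max_def split: if_splits)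
    with y show "y \<in> ?S0 \<union> ?S1" by (auto simp: abs_if split: if_splits)
  qed
  ultimately have "cmap ?B' Y c" by (rule cmap_subset)
  then obtain F where F: "cmap (std_cube (Suc k)) Y F" "\<And>y. y \<in> ?B' \<Longrightarrow> F y = c y"
    using Y unfolding fills_def by blast
  define g' where "g' = (\<lambda>(t, x). F (x(k := t)))"
  have up: "x(k := t) \<in> std_cube (Suc k)" if "x \<in> ?C" "t \<in> {0..1}" for x t
    using that by (auto simp: std_cube_def less_Suc_eq)
  have "cmap ({0..1} \<times> ?C) Y g'"
    unfolding g'_def case_prod_unfold
    by (rule cmap_comp[OF F(1)]) (auto intro!: continuous_intros up[simplified])
  moreover have "cmap ?C X a'" using a' by (simp add: continuous_map_in_subtopology)
  moreover have xk: "x k = 0" if "x \<in> ?C" for x using that by (simp add: std_cube_def)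
  have g'1: "g' (1, x) = g (1, x)" if "x \<in> ?C" for x
  proof -
    have "x(k := 1) \<in> ?B'" using up[OF that, of 1] by (auto simp: std_boundary_def)
    then show ?thesis using F xk[OF that] by (simp add: g'_def c_def fun_upd_idem)
  qed
  have g'0: "g' (0, x) = f (a' x)" if "x \<in> ?C" for x
  proof -
    have "x(k := 0) \<in> ?B'" using up[OF that, of 0] by (auto simp: std_boundary_def)
    then show ?thesis using F xk[OF that] by (simp add: g'_def c_def fun_upd_idem)
  qed
  have g'B: "g' (t, x) = g (t, x)" if x: "x \<in> ?B" and t: "t \<in> {0..1}" for t x
  proof -
    have xC: "x \<in> ?C" using x std_boundary_subset by blast
    have "x(k := t) \<in> ?B'" using up[OF xC t] x
      by (auto simp: std_boundary_iff std_cube_iff cn)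
    then have "g' (t, x) = c (x(k := t))" using F by (simp add: g'_def)
    also have "\<dots> = g (t, x)"
      using xk[OF xC] bspec[OF ag x] a'(2)[OF x] by (auto simp: c_def fun_upd_idem)
    finally show ?thesis .
  qed
  ultimately show "\<exists>a' g'. cmap ?C X a' \<and> cmap ({0..1} \<times> ?C) Y g' \<and> (\<forall>x\<in>?B. a' x = a x) \<and>
        (\<forall>p\<in>{1} \<times> ?C \<union> {0..1} \<times> ?B. g' p = g p) \<and> (\<forall>x\<in>?C. g' (0, x) = f (a' x))"
    using g'1 g'0 g'B a'(2) by (intro exI[of _ a'] exI[of _ g']) auto
qed

text \<open>The usual relative form, with a homotopy that is constant on \<open>L\<close>. It is the
  form that speaks about homotopy groups, and the one that the subdivision argument
  delivers.\<close>

definition strictly_lifts :: "'x topology \<Rightarrow> 'y topology \<Rightarrow> ('x \<Rightarrow> 'y) \<Rightarrow>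
    'k::topological_space set \<Rightarrow> 'k set \<Rightarrow> bool" where
  "strictly_lifts X Y f K L \<longleftrightarrow> (\<forall>a b. cmap L X a \<and> cmap K Y b \<and> (\<forall>x\<in>L. b x = f (a x)) \<longrightarrow>
     (\<exists>a' h. cmap K X a' \<and> cmap ({0..1::real} \<times> K) Y h \<and> (\<forall>x\<in>L. a' x = a x) \<and>
        (\<forall>x\<in>K. h (0, x) = f (a' x) \<and> h (1, x) = b x) \<and> (\<forall>t\<in>{0..1}. \<forall>x\<in>L. h (t, x) = b x)))"

lemma strictly_liftsE:
  assumes "strictly_lifts X Y f K L" "cmap L X a" "cmap K Y b" "\<forall>x\<in>L. b x = f (a x)"
  obtains a' h where "cmap K X a'" "cmap ({0..1::real} \<times> K) Y h" "\<And>x. x \<in> L \<Longrightarrow> a' x = a x"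
    "\<And>x. x \<in> K \<Longrightarrow> h (0, x) = f (a' x)" "\<And>x. x \<in> K \<Longrightarrow> h (1, x) = b x"
    "\<And>t x. t \<in> {0..1} \<Longrightarrow> x \<in> L \<Longrightarrow> h (t, x) = b x"
  using assms(1)[unfolded strictly_lifts_def, rule_format, of a b] assms(2-) by (auto simp: Ball_def)

lemma lifts_imp_strictly_lifts:
  assumes "lifts X Y f K L" "L \<subseteq> K"
  shows "strictly_lifts X Y f K L"
  unfolding strictly_lifts_def
proof (intro allI impI)
  fix a b assume *: "cmap L X a \<and> cmap K Y b \<and> (\<forall>x\<in>L. b x = f (a x))"
  then have "cmap ({1} \<times> K \<union> {0..1::real} \<times> L) Y (\<lambda>p. b (snd p))"
    by (rule cmap_comp[where T = K and g = b, OF conjunct1[OF conjunct2]])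
      (use assms in \<open>auto intro!: continuous_intros\<close>)
  with * obtain a' g' where a': "cmap K X a'" "cmap ({0..1::real} \<times> K) Y g'"
    "\<And>x. x \<in> L \<Longrightarrow> a' x = a x" "\<And>x. x \<in> K \<Longrightarrow> g' (1, x) = b x"
    "\<And>t x. t \<in> {0..1} \<Longrightarrow> x \<in> L \<Longrightarrow> g' (t, x) = b x"
    "\<And>x. x \<in> K \<Longrightarrow> g' (0, x) = f (a' x)"
    by (auto elim!: liftsE[OF assms(1), of a "\<lambda>p. b (snd p)"])
  then show "\<exists>a' h. cmap K X a' \<and> cmap ({0..1::real} \<times> K) Y h \<and> (\<forall>x\<in>L. a' x = a x) \<and>
        (\<forall>x\<in>K. h (0, x) = f (a' x) \<and> h (1, x) = b x) \<and> (\<forall>t\<in>{0..1}. \<forall>x\<in>L. h (t, x) = b x)"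
    by blast
qed

text \<open>The side homotopy is extended to \<open>g1\<close> on the whole cylinder, the strict
  problem is solved for the bottom of \<open>g1\<close>, and the two homotopies are stacked. It
  remains to reparametrize so that the sides show \<open>g\<close> without a constant
  stretch.\<close>

lemma strictly_lifts_imp_lifts:
  assumes "strictly_lifts X Y f (std_cube k) (std_boundary k)"
  shows "lifts X Y f (std_cube k) (std_boundary k)"
proof (rule liftsI)
  let ?B = "std_boundary k" and ?C = "std_cube k" and ?M = "cube_norm k"
  fix a and g :: "real \<times> _ \<Rightarrow> _" assume a: "cmap ?B X a" and g: "cmap ({1} \<times> ?C \<union> {0..1} \<times> ?B) Y g"
    and ag: "\<forall>x\<in>?B. g (0, x) = f (a x)"
  \<comment> \<open>\<open>\<rho>\<close> is the retraction of the cylinder onto its top and sides given by projection from the point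
    \<open>(-1, centre)\<close>.\<close>
  define l where "l = (\<lambda>p. 1 / max ((1 + fst p) / 2) (?M (snd p)))"
  define \<rho> where "\<rho> = (\<lambda>p. ((1 + fst p) * l p - 1, dil k (l p) (snd p)))"
  have cont\<rho>: "continuous_on ({0..1} \<times> ?C) \<rho>"
    unfolding \<rho>_def l_def by (intro continuous_intros) (auto simp: max_def split: if_splits)
  have \<rho>: "\<rho> (t, x) \<in> {1} \<times> ?C \<union> {0..1} \<times> ?B" if "t \<in> {0..1}" "x \<in> ?C" for t x
  proof (cases "(1 + t) / 2 \<le> ?M x")
    case True
    then have l: "l (t, x) = 1 / ?M x" by (simp add: l_def max_def)
    have M: "?M x > 0" "?M x \<le> 1" using True that by (auto simp: std_cube_iff)
    then have "dil k (l (t, x)) x \<in> ?B" by (intro dil_in_boundary) (simp add: l)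
    moreover have "(1 + t) * l (t, x) - 1 \<in> {0..1}" using M True that by (auto simp: l field_simps)
    ultimately show ?thesis by (simp add: \<rho>_def)
  next
    case False
    then have l: "l (t, x) = 2 / (1 + t)" by (simp add: l_def max_def)
    have "dil k (l (t, x)) x \<in> ?C" using False that by (intro dil_in_cube) (auto simp: l field_simps)
    moreover have "(1 + t) * l (t, x) - 1 = 1" using that by (simp add: l field_simps)
    ultimately show ?thesis by (simp add: \<rho>_def)
  qed
  have \<rho>1: "\<rho> (1, x) = (1, x)" if "x \<in> ?C" for x
  proof -
    have "max 1 (?M x) = 1" using that by (auto simp: std_cube_iff)
    then show ?thesis using dil_one[OF that] by (simp add: \<rho>_def l_def)
  qed
  have \<rho>B: "\<rho> (t, x) = (t, x)" if "t \<in> {0..1}" "x \<in> ?B" for t x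
    using that dil_one[of x k] by (auto simp: \<rho>_def l_def std_boundary_iff std_cube_iff max_def)
  define g1 where "g1 = (\<lambda>p. g (\<rho> p))"
  have g1: "cmap ({0..1} \<times> ?C) Y g1"
    unfolding g1_def by (rule cmap_comp[OF g cont\<rho>]) (metis \<rho> mem_Sigma_iff prod.collapse)
  have b1: "cmap ?C Y (\<lambda>x. g1 (0, x))"
    by (rule cmap_comp[OF g1]) (auto intro!: continuous_intros)
  have b1B: "\<forall>x\<in>?B. g1 (0, x) = f (a x)"
    using \<rho>B[of 0] ag by (simp add: g1_def)
  obtain a1 h where a1: "cmap ?C X a1" "cmap ({0..1::real} \<times> ?C) Y h"
    "\<And>x. x \<in> ?B \<Longrightarrow> a1 x = a x"
    "\<And>x. x \<in> ?C \<Longrightarrow> h (0, x) = f (a1 x)" "\<And>x. x \<in> ?C \<Longrightarrow> h (1, x) = g1 (0, x)"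
    "\<And>t x. t \<in> {0..1} \<Longrightarrow> x \<in> ?B \<Longrightarrow> h (t, x) = g1 (0, x)" by (rule strictly_liftsE[OF assms a b1 b1B]) (rule that)
  define G where "G = (\<lambda>p. if fst p \<le> 1 then h p else g1 (fst p - 1, snd p))"
  have G: "cmap ({0..2} \<times> ?C) Y G"
    unfolding G_def
  proof (rule cmap_If_le)
    show "cmap {x \<in> {0..2} \<times> ?C. fst x \<le> 1} Y h" using a1(2) by (rule cmap_subset) auto
    show "cmap {x \<in> {0..2} \<times> ?C. 1 \<le> fst x} Y (\<lambda>p. g1 (fst p - 1, snd p))"
      by (rule cmap_comp[OF g1]) (auto intro!: continuous_intros)
  qed (use a1 in \<open>auto intro!: continuous_intros\<close>)
  \<comment> \<open>On \<open>[0, 2]\<close> the map \<open>G\<close> is the concatenation of \<open>h\<close> and \<open>g1\<close>. Over the boundary its first half is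
    constant, and \<open>\<Phi>\<close> discards that half by pushing the bottom of the cylinder up along the sides.\<close>
  define \<Phi> where "\<Phi> = (\<lambda>p. ((1 - fst p) * max 0 (2 * ?M (snd p) - 1) + fst p * 2,
     \<lambda>i. (1 - fst p) * core k (snd p) i + fst p * snd p i))"
  have cont\<Phi>: "continuous_on ({0..1} \<times> ?C) \<Phi>"
    unfolding \<Phi>_def
    by (intro continuous_intros continuous_on_coordinatewise_then_product continuous_on_coord[OF continuous_on_core])
  have \<Phi>: "\<Phi> (t, x) \<in> {0..2} \<times> ?C" if t: "t \<in> {0..1}" and x: "x \<in> ?C" for t x
  proof -
    define m where "m = max 0 (2 * ?M x - 1)"
    have m: "m \<le> 1" "0 \<le> m" using x by (auto simp: std_cube_iff m_def)
    have "(1 - t) * m \<le> (1 - t) * 1" by (rule mult_left_mono) (use m t in auto)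
    moreover have "0 \<le> (1 - t) * m" using m t by simp
    ultimately have "(1 - t) * m + t * 2 \<in> {0..2}" using t by simp
    moreover have "(\<lambda>i. (1 - t) * core k x i + t * x i) \<in> ?C"
    proof -
      have "core k x \<in> ?C" by (rule core_in_cube)
      with x t have "0 \<le> (1 - t) * core k x i + t * x i \<and> (1 - t) * core k x i + t * x i \<le> 1" if "i < k" for i
        using that convex_bound_le[of "core k x i" 1 "x i" "1 - t" t] by (auto simp: std_cube_def)
      with x \<open>core k x \<in> ?C\<close> show ?thesis by (auto simp: std_cube_def)
    qed
    ultimately show ?thesis by (simp add: \<Phi>_def m_def)
  qed
  let ?a = "\<lambda>x. a1 (core k x)" and ?g = "\<lambda>p. G (\<Phi> p)"
  have "cmap ?C X ?a" by (rule cmap_comp[OF a1(1)]) (auto intro!: continuous_intros core_in_cube)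
  moreover have "cmap ({0..1} \<times> ?C) Y ?g" by (rule cmap_comp[OF G cont\<Phi>]) (metis \<Phi> mem_Sigma_iff prod.collapse)
  moreover have "?a x = a x" if "x \<in> ?B" for x using a1 that by (simp add: core_boundary)
  moreover have "?g (1, x) = g (1, x)" if "x \<in> ?C" for x
    using \<rho>1[OF that] by (simp add: \<Phi>_def G_def g1_def)
  moreover have "?g (t, x) = g (t, x)" if "t \<in> {0..1}" "x \<in> ?B" for t x
  proof -
    have "\<Phi> (t, x) = (1 + t, x)"
      using that by (auto simp: \<Phi>_def core_boundary std_boundary_iff algebra_simps)
    moreover have "G (1 + t, x) = g1 (t, x)"
      using that std_boundary_subset[of k] a1(6)[of 1 x] by (auto simp: G_def)
    ultimately show ?thesis using \<rho>B[OF that] by (simp add: g1_def)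
  qed
  \<comment> \<open>Over the inner half the bottom stays at height 0. Over the collar it rises while
    \<open>core k x\<close> lies on the boundary, where \<open>h\<close> is constant in time, so the
    value is still \<open>f (a1 (core k x))\<close>.\<close>
  moreover have "?g (0, x) = f (?a x)" if "x \<in> ?C" for x
  proof (cases "?M x \<le> 1/2")
    case True
    then have "\<Phi> (0, x) = (0, core k x)" by (simp add: \<Phi>_def max_def)
    then show ?thesis using a1(4)[OF core_in_cube] by (simp add: G_def)
  next
    case False
    then have \<Phi>: "\<Phi> (0, x) = (2 * ?M x - 1, core k x)" by (simp add: \<Phi>_def max_def)
    have cB: "core k x \<in> ?B" using False by (intro core_in_boundary) simp
    have "2 * ?M x - 1 \<in> {0..1}" using False that by (auto simp: std_cube_iff)
    with cB have "G (\<Phi> (0, x)) = g1 (0, core k x)" using a1(6) by (simp add: \<Phi> G_def)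
    then show ?thesis using bspec[OF b1B cB] a1(3)[OF cB] by simp
  qed
  ultimately show "\<exists>a' g'. cmap ?C X a' \<and> cmap ({0..1} \<times> ?C) Y g' \<and> (\<forall>x\<in>?B. a' x = a x) \<and>
        (\<forall>p\<in>{1} \<times> ?C \<union> {0..1} \<times> ?B. g' p = g p) \<and> (\<forall>x\<in>?C. g' (0, x) = f (a' x))"
    by (intro exI[of _ ?a] exI[of _ ?g]) auto
qed

definition lifts_upto :: "'x topology \<Rightarrow> 'y topology \<Rightarrow> ('x \<Rightarrow> 'y) \<Rightarrow> int \<Rightarrow> bool" where
  "lifts_upto X Y f N \<longleftrightarrow> (\<forall>k. int k \<le> N \<longrightarrow> lifts X Y f (std_cube k) (std_boundary k))"

section \<open>Cubical complexes\<close>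

definition side :: "int \<Rightarrow> bool \<Rightarrow> real set" where
  "side l b = (if b then {of_int l..of_int l + 1} else {of_int l})"

text \<open>For cells of the unit grid, \<open>S\<close> is the set of directions in which the cell is extended, so
  \<open>card S\<close> is its dimension.\<close>

definition cell :: "(nat \<Rightarrow> int) \<Rightarrow> nat set \<Rightarrow> (nat \<Rightarrow> real) set" where
  "cell lo S = {x. \<forall>i. x i \<in> side (lo i) (i \<in> S)}"

definition cell_bd :: "(nat \<Rightarrow> int) \<Rightarrow> nat set \<Rightarrow> (nat \<Rightarrow> real) set" where
  "cell_bd lo S = {x \<in> cell lo S. \<exists>i\<in>S. x i = of_int (lo i) \<or> x i = of_int (lo i) + 1}"

text \<open>Only the point set is kept, so unions and intersections need no chosen cell structure.
  Faces need not be listed, since the cells are closed.\<close>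

definition cellular :: "(nat \<Rightarrow> real) set \<Rightarrow> bool" where
  "cellular L \<longleftrightarrow> (\<exists>\<A>. finite \<A> \<and> (\<forall>c\<in>\<A>. \<exists>lo S. finite S \<and> c = cell lo S) \<and> L = \<Union>\<A>)"

lemma closed_cell [simp]: "closed (cell lo S)"
proof -
  have "closed {x :: nat \<Rightarrow> real. x i \<in> side (lo i) (i \<in> S)}" for i
    by (cases "i \<in> S")
      (auto simp: side_def intro!: closed_Collect_conj closed_Collect_le closed_Collect_eq continuous_intros)
  moreover have "cell lo S = (\<Inter>i. {x. x i \<in> side (lo i) (i \<in> S)})"
    by (auto simp: cell_def)
  ultimately show ?thesis by (metis (no_types, lifting) closed_INT)
qed

lemma cellular_closed: "cellular L \<Longrightarrow> closed L"
  unfolding cellular_def by (metis closed_Union closed_cell)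

lemma cellular_cell: "finite S \<Longrightarrow> cellular (cell lo S)"
  unfolding cellular_def by (intro exI[of _ "{cell lo S}"]) auto

lemma cellular_empty: "cellular {}"
  unfolding cellular_def by (intro exI[of _ "{}"]) auto

lemma cellular_Un:
  assumes "cellular K" "cellular L"
  shows "cellular (K \<union> L)"
proof -
  obtain \<A> \<B> where "finite \<A>" "\<forall>c\<in>\<A>. \<exists>lo S. finite S \<and> c = cell lo S" "K = \<Union>\<A>"
    "finite \<B>" "\<forall>c\<in>\<B>. \<exists>lo S. finite S \<and> c = cell lo S" "L = \<Union>\<B>"
    using assms unfolding cellular_def by blast
  then show ?thesis unfolding cellular_def by (intro exI[of _ "\<A> \<union> \<B>"]) auto
qed

lemma cellular_Union: "finite \<A> \<Longrightarrow> (\<And>A. A \<in> \<A> \<Longrightarrow> cellular A) \<Longrightarrow> cellular (\<Union>\<A>)"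
  by (induction \<A> rule: finite_induct) (auto intro: cellular_empty cellular_Un)

text \<open>Grid points or intervals that meet have equal lower ends, or the larger lower end is the
  upper end of the other interval; in the latter case they share only that point.\<close>

lemma side_Int:
  assumes "y \<in> side l b" "y \<in> side l' b'"
  shows "side l b \<inter> side l' b' = side (max l l') (b \<and> b' \<and> l = l')"
proof -
  have "l \<le> l' + 1" "l' \<le> l + 1" "\<not> b \<Longrightarrow> l' \<le> l" "\<not> b' \<Longrightarrow> l \<le> l'"
    using assms by (auto simp: side_def split: if_splits)
  then consider "l = l'" | "l' = l + 1" "b" | "l = l' + 1" "b'" by fastforce
  then show ?thesis by cases (auto simp: side_def)
qed

lemma cell_Int:
  assumes "y \<in> cell lo S" "y \<in> cell lo' S'"
  shows "cell lo S \<inter> cell lo' S' = cell (\<lambda>i. max (lo i) (lo' i)) {i \<in> S \<inter> S'. lo i = lo' i}"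
proof -
  have "side (lo i) (i \<in> S) \<inter> side (lo' i) (i \<in> S') =
      side (max (lo i) (lo' i)) (i \<in> {i \<in> S \<inter> S'. lo i = lo' i})" for i
    using side_Int[of "y i" "lo i" "i \<in> S" "lo' i" "i \<in> S'"] assms by (auto simp: cell_def)
  then show ?thesis unfolding cell_def by blast
qed

lemma cellular_Int:
  assumes "cellular K" "cellular L"
  shows "cellular (K \<inter> L)"
proof -
  obtain \<A> \<B> where *: "finite \<A>" "\<forall>c\<in>\<A>. \<exists>lo S. finite S \<and> c = cell lo S" "K = \<Union>\<A>"
    "finite \<B>" "\<forall>c\<in>\<B>. \<exists>lo S. finite S \<and> c = cell lo S" "L = \<Union>\<B>"
    using assms unfolding cellular_def by blast
  have "K \<inter> L = \<Union>((\<lambda>(c, c'). c \<inter> c') ` (\<A> \<times> \<B>))" using * by auto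
  moreover have "cellular (c \<inter> c')" if "c \<in> \<A>" "c' \<in> \<B>" for c c'
  proof -
    from * that obtain lo S lo' S' where c: "finite S" "c = cell lo S" "finite S'" "c' = cell lo' S'" by metis
    show ?thesis
    proof (cases "c \<inter> c' = {}")
      case False
      then obtain y where "y \<in> cell lo S" "y \<in> cell lo' S'" using c by auto
      from cell_Int[OF this] c show ?thesis by (auto intro: cellular_cell)
    qed (simp add: cellular_empty)
  qed
  ultimately show ?thesis using * by (auto intro!: cellular_Union)
qed

lemma side_subset:
  assumes "y \<in> side l b" "y \<in> side l' b'" "b \<Longrightarrow> y \<noteq> of_int l \<and> y \<noteq> of_int l + 1"
  shows "side l b \<subseteq> side l' b'"
proof (cases b)
  case True
  with assms have s: "of_int l < y" "y < of_int l + 1" by (auto simp: side_def)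
  with assms(2) have "b'" by (auto simp: side_def split: if_splits)
  with s assms(2) have "l' = l" by (auto simp: side_def)
  with True \<open>b'\<close> show ?thesis by simp
next
  case False
  with assms show ?thesis by (auto simp: side_def)
qed

text \<open>A point of the first cell off its boundary lies strictly between consecutive integers in
  each extended direction, so a second cell containing it contains the whole first cell, coordinate
  by coordinate.\<close>

lemma cell_subset_or:
  "cell lo S \<subseteq> cell lo' S' \<or> cell lo S \<inter> cell lo' S' \<subseteq> cell_bd lo S"
proof (rule disjCI)
  assume n: "\<not> cell lo S \<inter> cell lo' S' \<subseteq> cell_bd lo S"
  then obtain y where y: "y \<in> cell lo S" "y \<in> cell lo' S'" "y \<notin> cell_bd lo S" by blast
  have "side (lo i) (i \<in> S) \<subseteq> side (lo' i) (i \<in> S')" for i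
    by (rule side_subset[of "y i"]) (use y in \<open>auto simp: cell_def cell_bd_def\<close>)
  then show "cell lo S \<subseteq> cell lo' S'" by (auto simp: cell_def)
qed

lemma cell_bd_eq:
  "cell_bd lo S = (\<Union>i\<in>S. cell lo (S - {i}) \<union> cell (lo(i := lo i + 1)) (S - {i}))"
  (is "_ = ?R")
proof (intro equalityI subsetI)
  fix x assume "x \<in> cell_bd lo S"
  then obtain i where i: "i \<in> S" "x i = of_int (lo i) \<or> x i = of_int (lo i) + 1" "x \<in> cell lo S"
    by (auto simp: cell_bd_def)
  have "x j \<in> side (lo j) (j \<in> S)" for j using i by (simp add: cell_def)
  then have *: "x j \<in> side (lo j) (j \<in> S - {i})" if "j \<noteq> i" for j using that by simp
  have "x j \<in> side (lo j) (j \<in> S - {i})" if "x i = of_int (lo i)" for j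
    using that * by (cases "j = i") (simp_all add: side_def)
  moreover have "x j \<in> side ((lo(i := lo i + 1)) j) (j \<in> S - {i})" if "x i = of_int (lo i) + 1" for j
    using that * by (cases "j = i") (simp_all add: side_def)
  ultimately have "x \<in> cell lo (S - {i}) \<union> cell (lo(i := lo i + 1)) (S - {i})"
    using i(2) unfolding cell_def by blast
  then show "x \<in> ?R" using \<open>i \<in> S\<close> by blast
next
  fix x assume "x \<in> ?R"
  then obtain i where i: "i \<in> S" "x \<in> cell lo (S - {i}) \<or> x \<in> cell (lo(i := lo i + 1)) (S - {i})" by auto
  then have b: "x i = of_int (lo i) \<or> x i = of_int (lo i) + 1"
    by (auto simp: cell_def side_def dest!: spec[of _ i])
  have "x j \<in> side (lo j) (j \<in> S)" for j
    using i b by (cases "j = i") (auto simp: cell_def side_def dest!: spec[of _ j])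
  then show "x \<in> cell_bd lo S" using i(1) b by (auto simp: cell_bd_def cell_def)
qed

text \<open>Enumerating the directions in \<open>S\<close> and translating by \<open>lo\<close>
  identifies the cell with the standard cube of dimension \<open>card S\<close>.\<close>

lemma lifts_cell:
  assumes "finite S" and H: "lifts X Y f (std_cube (card S)) (std_boundary (card S))"
  shows "lifts X Y f (cell lo S) (cell_bd lo S)"
proof -
  let ?k = "card S"
  obtain \<sigma> where \<sigma>: "bij_betw \<sigma> {..<?k} S"
    using ex_bij_betw_nat_finite[OF assms(1)] by (auto simp: atLeast0LessThan)
  define \<tau> where "\<tau> = the_inv_into {..<?k} \<sigma>"
  have \<sigma>S: "\<sigma> j \<in> S" if "j < ?k" for j using \<sigma> that by (auto simp: bij_betw_def)
  have \<tau>\<sigma>: "\<tau> (\<sigma> j) = j" if "j < ?k" for j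
    unfolding \<tau>_def using \<sigma> that by (auto simp: bij_betw_def the_inv_into_f_f)
  have \<sigma>\<tau>: "\<tau> i < ?k \<and> \<sigma> (\<tau> i) = i" if "i \<in> S" for i
  proof -
    from that \<sigma> obtain j where "j < ?k" "i = \<sigma> j" unfolding bij_betw_def by auto
    then show ?thesis using \<tau>\<sigma> by simp
  qed
  define \<phi> where "\<phi> = (\<lambda>x::nat \<Rightarrow> real. \<lambda>j. if j < ?k then x (\<sigma> j) - lo (\<sigma> j) else 0)"
  define \<psi> where "\<psi> = (\<lambda>y::nat \<Rightarrow> real. \<lambda>i. lo i + (if i \<in> S then y (\<tau> i) else 0))"
  have c\<phi>: "continuous_on A \<phi>" for A
  proof (rule continuous_on_coordinatewise_then_product)
    fix j show "continuous_on A (\<lambda>x. \<phi> x j)"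
      unfolding \<phi>_def by (cases "j < ?k") (auto intro!: continuous_intros)
  qed
  have c\<psi>: "continuous_on A \<psi>" for A
  proof (rule continuous_on_coordinatewise_then_product)
    fix j show "continuous_on A (\<lambda>x. \<psi> x j)"
      unfolding \<psi>_def by (cases "j \<in> S") (auto intro!: continuous_intros)
  qed
  have cd: "x i \<in> side (lo i) (i \<in> S)" if "x \<in> cell lo S" for x :: "nat \<Rightarrow> real" and i
    using that by (auto simp: cell_def)
  have cS: "of_int (lo i) \<le> x i \<and> x i \<le> of_int (lo i) + 1" if "x \<in> cell lo S" "i \<in> S" for x :: "nat \<Rightarrow> real" and i
    using cd[OF that(1), of i] that(2) by (simp add: side_def)
  have \<phi>cube: "\<phi> x \<in> std_cube ?k" if "x \<in> cell lo S" for x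
    using cS[OF that \<sigma>S] unfolding std_cube_def \<phi>_def by (auto simp: diff_le_eq add.commute)
  have \<phi>bd: "\<phi> x \<in> std_boundary ?k \<longleftrightarrow> x \<in> cell_bd lo S" if x: "x \<in> cell lo S" for x
  proof -
    have "(\<exists>j<?k. \<phi> x j = 0 \<or> \<phi> x j = 1) \<longleftrightarrow> (\<exists>i\<in>S. x i = of_int (lo i) \<or> x i = of_int (lo i) + 1)" (is "?l \<longleftrightarrow> ?r")
    proof
      assume ?l
      then obtain j where j: "j < ?k" "\<phi> x j = 0 \<or> \<phi> x j = 1" by blast
      then show ?r using \<sigma>S[OF j(1)] by (intro bexI[of _ "\<sigma> j"]) (auto simp: \<phi>_def)
    next
      assume ?r
      then obtain i where "i \<in> S" "x i = of_int (lo i) \<or> x i = of_int (lo i) + 1" by auto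
      then show ?l using \<sigma>\<tau>[of i] by (intro exI[of _ "\<tau> i"]) (auto simp: \<phi>_def)
    qed
    then show ?thesis using x \<phi>cube by (simp add: std_boundary_def cell_bd_def)
  qed
  show ?thesis
  proof (rule lifts_homeo[OF H c\<phi> \<phi>cube c\<psi>])
    show "\<psi> y \<in> cell lo S" if "y \<in> std_cube ?k" for y
      using that \<sigma>\<tau> by (auto simp: cell_def side_def \<psi>_def std_cube_def)
    show "\<psi> (\<phi> x) = x" if "x \<in> cell lo S" for x
    proof
      fix i show "\<psi> (\<phi> x) i = x i" using cd[OF that, of i] \<sigma>\<tau>[of i] by (auto simp: \<phi>_def \<psi>_def side_def split: if_splits)
    qed
    show "\<phi> (\<psi> y) = y" if "y \<in> std_cube ?k" for y
      using that \<sigma>S \<tau>\<sigma> by (auto simp: \<phi>_def \<psi>_def std_cube_def fun_eq_iff)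
    show "\<phi> x \<in> std_boundary ?k \<longleftrightarrow> x \<in> cell_bd lo S" if "x \<in> cell lo S" for x by (rule \<phi>bd[OF that])
  qed (auto simp: std_boundary_def cell_bd_def)
qed

text \<open>The sets are attached one at a time. The hypothesis speaks of every cellular
  \<open>L\<close> because the base grows with each step.\<close>

lemma lifts_attach_Union:
  assumes "finite \<G>" "\<And>e. e \<in> \<G> \<Longrightarrow> cellular e"
    and "\<And>e L. e \<in> \<G> \<Longrightarrow> cellular L \<Longrightarrow> lifts X Y f (L \<union> e) L"
    and "cellular L"
  shows "lifts X Y f (L \<union> \<Union>\<G>) L"
  using assms
proof (induction \<G> rule: finite_induct)
  case empty
  then show ?case by (simp add: lifts_refl)
next
  case (insert e \<G>)
  have c: "cellular (L \<union> \<Union>\<G>)"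
    using insert by (intro cellular_Un cellular_Union) auto
  have "lifts X Y f ((L \<union> \<Union>\<G>) \<union> e) L"
  proof (rule lifts_trans)
    show "lifts X Y f ((L \<union> \<Union>\<G>) \<union> e) (L \<union> \<Union>\<G>)" using insert.prems c by auto
    show "lifts X Y f (L \<union> \<Union>\<G>) L" using insert by auto
    show "closed (L \<union> \<Union>\<G>)" by (rule cellular_closed[OF c])
    show "closed ((L \<union> \<Union>\<G>) \<union> e)"
      using insert.prems by (intro cellular_closed cellular_Un[OF c]) auto
  qed auto
  then show ?case by (simp add: Un_assoc Un_commute[of e])
qed

text \<open>\<open>L\<close> may contain only part of the boundary of the cell. Attaching the faces
  first, by induction on the dimension, makes the intersection exactly the boundary, and then
  lifting for the standard cube applies.\<close>

lemma lifts_attach_cell: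
  assumes "lifts_upto X Y f N" "finite S" "int (card S) \<le> N" "cellular L"
  shows "lifts X Y f (L \<union> cell lo S) L"
  using assms(2-)
proof (induction "card S" arbitrary: lo S L rule: less_induct)
  case less
  obtain \<A> where \<A>: "finite \<A>" "\<forall>c\<in>\<A>. \<exists>lo S. finite S \<and> c = cell lo S" "L = \<Union>\<A>"
    using less.prems unfolding cellular_def by blast
  show ?case
  proof (cases "\<exists>c\<in>\<A>. cell lo S \<subseteq> c")
    case True
    then have "L \<union> cell lo S = L" using \<A> by auto
    then show ?thesis by (simp add: lifts_refl)
  next
    case False
    then have sub: "L \<inter> cell lo S \<subseteq> cell_bd lo S"
      using \<A> cell_subset_or[of lo S] by (fastforce simp: Int_commute)
    define \<G> where "\<G> = (\<lambda>i. cell lo (S - {i})) ` S \<union> (\<lambda>i. cell (lo(i := lo i + 1)) (S - {i})) ` S"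
    have bd: "cell_bd lo S = \<Union>\<G>" unfolding cell_bd_eq by (auto simp: \<G>_def)
    have fG: "finite \<G>" using less.prems by (simp add: \<G>_def)
    have G: "\<exists>lo' i. i \<in> S \<and> e = cell lo' (S - {i})" if "e \<in> \<G>" for e
      using that by (auto simp: \<G>_def)
    have cG: "cellular e" if "e \<in> \<G>" for e using G[OF that] less.prems by (auto intro: cellular_cell)
    have "lifts X Y f (M \<union> e) M" if "e \<in> \<G>" "cellular M" for e M
    proof -
      obtain lo' i where i: "i \<in> S" "e = cell lo' (S - {i})" using G[OF \<open>e \<in> \<G>\<close>] by blast
      have "card (S - {i}) < card S" by (rule card_Diff1_less[OF less.prems(1) i(1)])
      then show ?thesis
        unfolding i(2) using less.hyps less.prems that by simp
    qed
    then have 1: "lifts X Y f (L \<union> cell_bd lo S) L"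
      unfolding bd using less.prems fG cG by (intro lifts_attach_Union) auto
    have cl: "closed (L \<union> cell_bd lo S)"
      unfolding bd using less.prems fG cG
      by (intro cellular_closed cellular_Un cellular_Union) auto
    have "lifts X Y f (cell lo S) (cell_bd lo S)"
      using less.prems assms(1) by (intro lifts_cell) (auto simp: lifts_upto_def)
    then have 2: "lifts X Y f ((L \<union> cell_bd lo S) \<union> cell lo S) (L \<union> cell_bd lo S)"
    proof (rule lifts_attach)
      show "(L \<union> cell_bd lo S) \<inter> cell lo S = cell_bd lo S" using sub by (auto simp: cell_bd_def)
    qed (use cl in auto)
    have "lifts X Y f ((L \<union> cell_bd lo S) \<union> cell lo S) L"
      using cl by (intro lifts_trans[OF 2 1]) auto
    moreover have "(L \<union> cell_bd lo S) \<union> cell lo S = L \<union> cell lo S" by (auto simp: cell_bd_def)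
    ultimately show ?thesis by simp
  qed
qed

lemma lifts_attach_cells:
  assumes "lifts_upto X Y f N" "finite \<G>" "cellular L"
    and "\<And>e. e \<in> \<G> \<Longrightarrow> \<exists>lo S. finite S \<and> int (card S) \<le> N \<and> e = cell lo S"
  shows "lifts X Y f (L \<union> \<Union>\<G>) L"
  using assms lifts_attach_cell[OF assms(1)] by (intro lifts_attach_Union) (metis cellular_cell)+

section \<open>Fine subdivisions of the cube\<close>

lemma dist_fun_le:
  fixes x y :: "nat \<Rightarrow> real"
  assumes "\<And>i. \<bar>x i - y i\<bar> \<le> e" "0 \<le> e"
  shows "dist x y \<le> 2 * e"
proof -
  \<comment> \<open>The weights \<open>(1/2)^n\<close> of the metric on functions have sum
    2.\<close>
  have s: "(\<lambda>n. (1/2::real)^n * e) sums (2 * e)"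
    using sums_mult2[OF geometric_sums[of "1/2::real"], of e] by simp
  have t: "(1/2)^n * min (dist (x (from_nat n)) (y (from_nat n))) 1 \<le> (1/2::real)^n * e" for n
    using assms(1)[of "from_nat n"] by (intro mult_left_mono) (auto simp: dist_real_def)
  have "summable (\<lambda>n. (1/2)^n * min (dist (x (from_nat n)) (y (from_nat n))) (1::real))"
    by (rule summable_comparison_test'[OF sums_summable[OF s], of 0]) (use t in \<open>auto simp: abs_mult\<close>)
  then have "dist x y \<le> (\<Sum>n. (1/2)^n * e)"
    unfolding dist_fun_def using s by (intro suminf_le t) (auto simp: sums_summable)
  then show ?thesis using s by (simp add: sums_iff)
qed

text \<open>Rests on a Lebesgue number \<open>e\<close> of the cover; the bound \<open>e / 2\<close>
  on the mesh absorbs the factor 2 between coordinate differences and the metric.\<close>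

lemma fine_grid:
  fixes T1 T2 :: "(nat \<Rightarrow> real) set"
  assumes "open T1" "open T2" "std_cube k \<subseteq> T1 \<union> T2"
  obtains m :: nat where "m > 0"
    "\<And>G. G \<subseteq> std_cube k \<Longrightarrow> (\<And>x y i. x \<in> G \<Longrightarrow> y \<in> G \<Longrightarrow> i < k \<Longrightarrow> \<bar>x i - y i\<bar> \<le> 1 / m) \<Longrightarrow>
      G \<subseteq> T1 \<or> G \<subseteq> T2"
proof -
  obtain e where e: "e > 0" "\<And>x. x \<in> std_cube k \<Longrightarrow> \<exists>G\<in>{T1, T2}. ball x e \<subseteq> G"
    by (rule Heine_Borel_lemma[OF compact_std_cube, of k "{T1, T2}"]) (use assms in auto)
  obtain m :: nat where m: "m > 0" "1 / m < e / 2"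
    using e(1) by (metis half_gt_zero nat_approx_posE zero_less_Suc)
  show ?thesis
  proof (rule that[OF m(1)])
    fix G assume G: "G \<subseteq> std_cube k" "\<And>x y i. x \<in> G \<Longrightarrow> y \<in> G \<Longrightarrow> i < k \<Longrightarrow> \<bar>x i - y i\<bar> \<le> 1 / m"
    show "G \<subseteq> T1 \<or> G \<subseteq> T2"
    proof (cases "G = {}")
      case False
      then obtain x where x: "x \<in> G" by blast
      have "y \<in> ball x e" if y: "y \<in> G" for y
      proof -
        have "\<bar>x i - y i\<bar> \<le> 1 / m" for i
        proof (cases "i < k")
          case False
          have "x \<in> std_cube k" "y \<in> std_cube k" using G(1) x y by auto
          with False show ?thesis by (simp add: std_cube_def)
        qed (use G x y in auto)
        then have "dist x y \<le> 2 * (1 / m)" by (rule dist_fun_le) simp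
        with m show ?thesis by simp
      qed
      then show ?thesis using e(2)[of x] x G(1) by blast
    qed simp
  qed
qed

lemma cmap_subtopology_mono:
  assumes "cmap S (subtopology Y U) g" "U \<subseteq> W"
  shows "cmap S (subtopology Y W) g"
  using assms by (auto simp: continuous_map_in_subtopology)

text \<open>The unit cube enlarged by the factor \<open>m\<close>, so that the small cubes of a
  subdivision become cells with integral corners.\<close>

definition grid_box :: "nat \<Rightarrow> nat \<Rightarrow> (nat \<Rightarrow> real) set" where
  "grid_box k m = {x. (\<forall>i<k. 0 \<le> x i \<and> x i \<le> m) \<and> (\<forall>i\<ge>k. x i = 0)}"

definition grid_bd :: "nat \<Rightarrow> nat \<Rightarrow> (nat \<Rightarrow> real) set" where
  "grid_bd k m = {x \<in> grid_box k m. \<exists>i<k. x i = 0 \<or> x i = m}"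

definition corners :: "nat \<Rightarrow> nat \<Rightarrow> (nat \<Rightarrow> int) set" where
  "corners k m = {lo. \<forall>i. (i \<in> {..<k} \<longrightarrow> lo i \<in> {0..int m}) \<and> (i \<notin> {..<k} \<longrightarrow> lo i = 0)}"

lemma finite_corners: "finite (corners k m)"
  unfolding corners_def by (rule finite_set_of_finite_funs) auto

definition boxes :: "nat \<Rightarrow> nat \<Rightarrow> (nat \<Rightarrow> real) set set" where
  "boxes k m = (\<lambda>lo. cell lo {..<k}) ` {lo \<in> corners k m. \<forall>i<k. lo i < int m}"

lemma finite_boxes: "finite (boxes k m)"
  unfolding boxes_def using finite_corners by simp

lemma Union_boxes:
  assumes "m > 0"
  shows "\<Union>(boxes k m) = grid_box k m"
proof (intro equalityI subsetI)
  fix x assume "x \<in> \<Union>(boxes k m)"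
  then obtain lo where lo: "lo \<in> corners k m" "\<And>i. i < k \<Longrightarrow> lo i < int m" "x \<in> cell lo {..<k}"
    by (auto simp: boxes_def)
  have "0 \<le> x i \<and> x i \<le> m" if "i < k" for i
  proof -
    have "x i \<in> side (lo i) True" using lo(3) that by (auto simp: cell_def dest!: spec[of _ i])
    moreover have "0 \<le> lo i" "lo i + 1 \<le> int m" using lo(1) lo(2)[OF that] that by (auto simp: corners_def)
    ultimately show ?thesis by (auto simp: side_def)
  qed
  moreover have "x i = 0" if "i \<ge> k" for i
  proof -
    have "x i \<in> side (lo i) False" using lo(3) that by (auto simp: cell_def dest!: spec[of _ i])
    then show ?thesis using lo(1) that by (auto simp: corners_def side_def)
  qed
  ultimately show "x \<in> grid_box k m" by (simp add: grid_box_def)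
next
  fix x assume x: "x \<in> grid_box k m"
  define lo where "lo = (\<lambda>i. if x i = m \<and> i < k then int m - 1 else \<lfloor>x i\<rfloor>)"
  have "x i \<in> side (lo i) (i \<in> {..<k}) \<and> (i < k \<longrightarrow> 0 \<le> lo i \<and> lo i < int m) \<and> (i \<ge> k \<longrightarrow> lo i = 0)" for i
  proof (cases "i < k")
    case True
    then have "0 \<le> x i" "x i \<le> m" using x by (auto simp: grid_box_def)
    then have "x i = m \<or> \<lfloor>x i\<rfloor> < int m" by linarith
    moreover have "of_int \<lfloor>x i\<rfloor> \<le> x i" "x i \<le> of_int \<lfloor>x i\<rfloor> + 1" by linarith+
    ultimately show ?thesis using True \<open>0 \<le> x i\<close> assms by (auto simp: lo_def side_def)
  next
    case False
    then show ?thesis using x by (auto simp: grid_box_def lo_def side_def)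
  qed
  then have "x \<in> cell lo {..<k}" "lo \<in> corners k m" "\<forall>i<k. lo i < int m"
    by (auto simp: cell_def corners_def) (metis less_imp_le)
  then show "x \<in> \<Union>(boxes k m)" by (auto simp: boxes_def)
qed

lemma cellular_boxes: "c \<in> boxes k m \<Longrightarrow> cellular c"
  by (auto simp: boxes_def intro: cellular_cell)

text \<open>The lower corners of distinct boxes differ in some direction below \<open>k\<close>, and
  the intersection is not extended in that direction. This loss of a dimension pays for the weaker
  condition over \<open>U \<inter> V\<close>.\<close>

lemma boxes_Int:
  assumes "c \<in> boxes k m" "c' \<in> boxes k m" "c \<noteq> c'" "c \<inter> c' \<noteq> {}"
  shows "\<exists>lo S. finite S \<and> int (card S) \<le> int k - 1 \<and> c \<inter> c' = cell lo S"
proof -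
  obtain lo lo' where lo: "lo \<in> corners k m" "lo' \<in> corners k m" "c = cell lo {..<k}" "c' = cell lo' {..<k}"
    using assms by (auto simp: boxes_def)
  with assms have "lo \<noteq> lo'" by auto
  with lo obtain i where i: "i < k" "lo i \<noteq> lo' i" by (auto simp: corners_def fun_eq_iff) (metis linorder_not_le)
  obtain y where "y \<in> cell lo {..<k}" "y \<in> cell lo' {..<k}" using assms lo by auto
  note eq = cell_Int[OF this]
  have "{j \<in> {..<k} \<inter> {..<k}. lo j = lo' j} \<subset> {..<k}" using i by auto
  then have "card {j \<in> {..<k} \<inter> {..<k}. lo j = lo' j} < k" using psubset_card_mono[of "{..<k}"] by simp
  then show ?thesis using eq lo
    by (intro exI[of _ "\<lambda>i. max (lo i) (lo' i)"] exI[of _ "{j \<in> {..<k} \<inter> {..<k}. lo j = lo' j}"]) auto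
qed

text \<open>A point whose coordinate \<open>i\<close> is 0 or \<open>m\<close> lies in the cell
  obtained from a surrounding box by freezing that coordinate, and this cell stays in the
  boundary.\<close>

lemma cellular_grid_bd:
  assumes "m > 0"
  shows "cellular (grid_bd k m)"
proof -
  define \<A> where "\<A> = {cell lo S |lo S. lo \<in> corners k m \<and> S \<subseteq> {..<k} \<and> cell lo S \<subseteq> grid_bd k m}"
  have "\<A> \<subseteq> (\<lambda>(lo, S). cell lo S) ` (corners k m \<times> Pow {..<k})" by (auto simp: \<A>_def)
  then have "finite \<A>" using finite_corners by (auto intro: finite_subset)
  moreover have "cellular c" if "c \<in> \<A>" for c
    using that by (auto simp: \<A>_def intro: cellular_cell finite_subset)
  moreover have "\<Union>\<A> = grid_bd k m"
  proof (intro equalityI subsetI)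
    fix x assume "x \<in> grid_bd k m"
    then obtain i where x: "x \<in> grid_box k m" "i < k" "x i = 0 \<or> x i = m" by (auto simp: grid_bd_def)
    from x(1) obtain lo where lo: "lo \<in> corners k m" "\<forall>j<k. lo j < int m" "x \<in> cell lo {..<k}"
      unfolding Union_boxes[OF assms, symmetric] boxes_def by auto
    define e where "e = (if x i = 0 then 0 else int m)"
    have xi: "x i = of_int e" using x by (auto simp: e_def)
    have sub: "cell (lo(i := e)) ({..<k} - {i}) \<subseteq> grid_bd k m"
    proof
      fix y assume y: "y \<in> cell (lo(i := e)) ({..<k} - {i})"
      have yi: "y i = of_int e" using y by (auto simp: cell_def side_def dest!: spec[of _ i])
      have "0 \<le> y j \<and> y j \<le> m" if "j < k" for j
      proof (cases "j = i")
        case False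
        then have "y j \<in> side (lo j) True" using y that by (auto simp: cell_def dest!: spec[of _ j])
        moreover have "0 \<le> lo j" "lo j + 1 \<le> int m" using lo that by (auto simp: corners_def)
        ultimately show ?thesis by (auto simp: side_def)
      qed (use yi in \<open>auto simp: e_def\<close>)
      moreover have "y j = 0" if "j \<ge> k" for j
        using y that lo(1) x(2) by (auto simp: cell_def side_def corners_def dest!: spec[of _ j])
      ultimately show "y \<in> grid_bd k m"
        using yi x(2) by (auto simp: grid_bd_def grid_box_def e_def intro!: exI[of _ i] split: if_splits)
    qed
    have "x j \<in> side ((lo(i := e)) j) (j \<in> {..<k} - {i})" for j
      using lo(3) xi by (cases "j = i") (auto simp: cell_def side_def dest!: spec[of _ j])
    then have "x \<in> cell (lo(i := e)) ({..<k} - {i})" by (simp add: cell_def)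
    moreover have "lo(i := e) \<in> corners k m" using lo x(2) by (auto simp: corners_def e_def)
    ultimately show "x \<in> \<Union>\<A>" using sub unfolding \<A>_def by blast
  qed (auto simp: \<A>_def)
  ultimately show ?thesis using cellular_Union by metis
qed

section \<open>Gluing over open covers\<close>

text \<open>The strict form suits subdivision: as the homotopy on the boundary is constant, a small
  cube whose image under \<open>b0\<close> lies in \<open>U\<close> poses a problem entirely over
  \<open>U\<close>. A prescribed moving homotopy on the boundary could leave
  \<open>U\<close>.\<close>

lemma strictly_lifts_Un:
  assumes U: "openin Y U" and V: "openin Y V"
    and lU: "lifts_upto X (subtopology Y U) f N"
    and lV: "lifts_upto X (subtopology Y V) f N"
    and lUV: "lifts_upto X (subtopology Y (U \<inter> V)) f (N - 1)"
    and k: "int k \<le> N"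
  shows "strictly_lifts X (subtopology Y (U \<union> V)) f (std_cube k) (std_boundary k)"
  unfolding strictly_lifts_def
proof (intro allI impI)
  fix a0 b0 assume ab0: "cmap (std_boundary k) X a0 \<and> cmap (std_cube k) (subtopology Y (U \<union> V)) b0 \<and>
    (\<forall>x\<in>std_boundary k. b0 x = f (a0 x))"
  then have b0: "cmap (std_cube k) Y b0" "b0 ` std_cube k \<subseteq> U \<union> V"
    by (auto simp: continuous_map_in_subtopology)
  \<comment> \<open>The preimages are only relatively open in the cube, while the Lebesgue argument
    is stated for open subsets of the ambient space.\<close>
  have "\<exists>T. open T \<and> {x \<in> std_cube k. b0 x \<in> W} = std_cube k \<inter> T" if "openin Y W" for W
    using openin_continuous_map_preimage[OF b0(1) that] by (auto simp: openin_open)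
  from this[OF U] this[OF V] obtain TU TV
    where T: "open TU" "{x \<in> std_cube k. b0 x \<in> U} = std_cube k \<inter> TU"
    "open TV" "{x \<in> std_cube k. b0 x \<in> V} = std_cube k \<inter> TV" by (elim exE conjE)
  have "std_cube k \<subseteq> TU \<union> TV" using T b0(2) by blast
  then obtain m :: nat where m: "m > 0"
    and fine: "\<And>G. G \<subseteq> std_cube k \<Longrightarrow> (\<And>x y i. x \<in> G \<Longrightarrow> y \<in> G \<Longrightarrow> i < k \<Longrightarrow> \<bar>x i - y i\<bar> \<le> 1 / m) \<Longrightarrow>
      G \<subseteq> TU \<or> G \<subseteq> TV"
    using fine_grid[OF T(1) T(3)] by blast
  let ?K = "grid_box k m" and ?L = "grid_bd k m"
  define \<sigma> where "\<sigma> = (\<lambda>x :: nat \<Rightarrow> real. \<lambda>i. x i / m)"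
  have c\<sigma>: "continuous_on S \<sigma>" for S
    unfolding \<sigma>_def by (intro continuous_on_coordinatewise_then_product continuous_intros) (use m in auto)
  have \<sigma>: "\<sigma> x \<in> std_cube k" if "x \<in> ?K" for x
    using that m by (auto simp: \<sigma>_def std_cube_def grid_box_def)
  have \<sigma>L: "\<sigma> x \<in> std_boundary k \<longleftrightarrow> x \<in> ?L" if "x \<in> ?K" for x
    using that \<sigma>[OF that] m by (auto simp: std_boundary_def grid_bd_def) (auto simp: \<sigma>_def)
  have small: "b0 ` \<sigma> ` c \<subseteq> U \<or> b0 ` \<sigma> ` c \<subseteq> V" if c: "c \<in> boxes k m" for c
  proof -
    have cK: "c \<subseteq> ?K" using Union_boxes[OF m] c by blast
    obtain lo where lo: "c = cell lo {..<k}" using c by (auto simp: boxes_def)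
    have "\<sigma> ` c \<subseteq> TU \<or> \<sigma> ` c \<subseteq> TV"
    proof (rule fine)
      show "\<sigma> ` c \<subseteq> std_cube k" using cK \<sigma> by auto
      fix x y i assume "x \<in> \<sigma> ` c" "y \<in> \<sigma> ` c" and i: "i < k"
      then obtain x' y' where xy: "x' \<in> c" "y' \<in> c" "x = \<sigma> x'" "y = \<sigma> y'" by blast
      have "x' i \<in> side (lo i) True" "y' i \<in> side (lo i) True"
        using xy i by (auto simp: lo cell_def dest!: spec[of _ i])
      then have "\<bar>x' i - y' i\<bar> \<le> 1" by (auto simp: side_def)
      moreover have "\<bar>x i - y i\<bar> = \<bar>x' i - y' i\<bar> / m"
        using m by (simp add: xy \<sigma>_def flip: diff_divide_distrib)
      ultimately show "\<bar>x i - y i\<bar> \<le> 1 / m" using m by (simp add: divide_right_mono)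
    qed
    then show ?thesis using T cK \<sigma> by blast
  qed
  define a b where "a = (\<lambda>x. a0 (\<sigma> x))" and "b = (\<lambda>x. b0 (\<sigma> x))"
  have LK: "?L \<subseteq> ?K" by (auto simp: grid_bd_def)
  have a: "cmap ?L X a"
    unfolding a_def by (rule cmap_comp[of "std_boundary k", OF _ c\<sigma>]) (use ab0 LK \<sigma>L in auto)
  have b: "cmap ?K Y b"
    unfolding b_def by (rule cmap_comp[OF b0(1) c\<sigma>]) (use \<sigma> in auto)
  have ab: "b x = f (a x)" if "x \<in> ?L" for x
    unfolding a_def b_def using that LK \<sigma>L ab0 by auto
  \<comment> \<open>Boxes that map into both sets are assigned to \<open>\<A>\<close>; every box of
    \<open>\<B>\<close> then maps into \<open>V\<close>.\<close>
  define \<A> where "\<A> = {c \<in> boxes k m. b ` c \<subseteq> U}"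
  define \<B> where "\<B> = boxes k m - \<A>"
  have bV: "b ` c \<subseteq> V" if "c \<in> \<B>" for c
    using small[of c] that by (auto simp: \<B>_def \<A>_def b_def image_image)
  define A B D where "A = \<Union>\<A>" and "B = \<Union>\<B>" and "D = A \<inter> B"
  have fin: "finite \<A>" "finite \<B>" using finite_boxes by (auto simp: \<A>_def \<B>_def)
  have cell: "cellular A" "cellular B"
    unfolding A_def B_def using fin cellular_boxes by (auto simp: \<A>_def \<B>_def intro!: cellular_Union)
  then have cellD: "cellular D" unfolding D_def by (rule cellular_Int)
  have cellL: "cellular ?L" by (rule cellular_grid_bd[OF m])
  have K: "?K = A \<union> B" unfolding Union_boxes[OF m, symmetric] A_def B_def \<B>_def \<A>_def by blast
  have bA: "b ` A \<subseteq> U" and bB: "b ` B \<subseteq> V" using bV by (auto simp: A_def B_def \<A>_def)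
  note closed = cellular_closed[OF cell(1)] cellular_closed[OF cell(2)] cellular_closed[OF cellD] cellular_closed[OF cellL]
  let ?I = "{0..1::real}"
  \<comment> \<open>\<open>D\<close> is the union of the intersections of boxes of different kinds.
    Each has dimension at most \<open>k - 1\<close>, so lifting up to \<open>N - 1\<close> suffices
    over \<open>U \<inter> V\<close>.\<close>
  have "lifts X (subtopology Y (U \<inter> V)) f ((D \<inter> ?L) \<union> \<Union>((\<lambda>(c, c'). c \<inter> c') ` {(c, c') \<in> \<A> \<times> \<B>. c \<inter> c' \<noteq> {}})) (D \<inter> ?L)"
  proof (rule lifts_attach_cells[OF lUV])
    show "finite ((\<lambda>(c, c'). c \<inter> c') ` {(c, c') \<in> \<A> \<times> \<B>. c \<inter> c' \<noteq> {}})"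
      by (rule finite_imageI, rule finite_subset[of _ "\<A> \<times> \<B>"]) (use fin in auto)
    show "cellular (D \<inter> ?L)" using cellD cellL by (rule cellular_Int)
    fix e assume "e \<in> (\<lambda>(c, c'). c \<inter> c') ` {(c, c') \<in> \<A> \<times> \<B>. c \<inter> c' \<noteq> {}}"
    then obtain c c' where c: "c \<in> \<A>" "c' \<in> \<B>" "c \<inter> c' \<noteq> {}" "e = c \<inter> c'" by auto
    then have "c \<in> boxes k m" "c' \<in> boxes k m" "c \<noteq> c'" by (auto simp: \<A>_def \<B>_def)
    from boxes_Int[OF this c(3)] obtain lo S where "finite S" "int (card S) \<le> int k - 1" "e = cell lo S"
      using c(4) by auto
    then show "\<exists>lo S. finite S \<and> int (card S) \<le> N - 1 \<and> e = cell lo S"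
      using k by (intro exI[of _ lo] exI[of _ S]) auto
  qed
  moreover have "(D \<inter> ?L) \<union> \<Union>((\<lambda>(c, c'). c \<inter> c') ` {(c, c') \<in> \<A> \<times> \<B>. c \<inter> c' \<noteq> {}}) = D"
    by (auto simp: D_def A_def B_def)
  ultimately have lD: "lifts X (subtopology Y (U \<inter> V)) f D (D \<inter> ?L)" by simp
  have DA: "D \<subseteq> A" "D \<subseteq> B" by (auto simp: D_def)
  define g0 where "g0 = (\<lambda>p :: real \<times> (nat \<Rightarrow> real). b (snd p))"
  have "cmap (D \<inter> ?L) X a" using a by (rule cmap_subset) auto
  moreover have "cmap ({1} \<times> D \<union> ?I \<times> (D \<inter> ?L)) (subtopology Y (U \<inter> V)) g0"
  proof -
    have "cmap ({1} \<times> D \<union> ?I \<times> (D \<inter> ?L)) Y g0"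
      unfolding g0_def by (rule cmap_comp[OF b]) (use K DA in \<open>auto intro!: continuous_intros\<close>)
    moreover have "b x \<in> U \<inter> V" if "x \<in> D" for x using bA bB DA that by blast
    ultimately show ?thesis by (auto simp: continuous_map_in_subtopology g0_def)
  qed
  moreover have "\<forall>x\<in>D \<inter> ?L. g0 (0, x) = f (a x)" using ab by (auto simp: g0_def)
  ultimately obtain a1 g1 where "cmap D X a1" "cmap (?I \<times> D) (subtopology Y (U \<inter> V)) g1"
    "\<And>x. x \<in> D \<inter> ?L \<Longrightarrow> a1 x = a x" "\<And>x. x \<in> D \<Longrightarrow> g1 (1, x) = g0 (1, x)"
    "\<And>t x. t \<in> ?I \<Longrightarrow> x \<in> D \<inter> ?L \<Longrightarrow> g1 (t, x) = g0 (t, x)"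
    "\<And>x. x \<in> D \<Longrightarrow> g1 (0, x) = f (a1 x)"
    by (rule liftsE[OF lD]) (rule that)
  note 1 = this[unfolded g0_def snd_conv]
  \<comment> \<open>One argument serves both halves. The prescribed homotopy is \<open>g1\<close> on
    \<open>D\<close> and constant on the outer boundary; since \<open>g1\<close> moves, the
    nonstrict form of lifting is used. Both results restrict to the same data on \<open>D\<close>,
    so they can be pasted.\<close>
  have half: "\<exists>a2 g2. cmap M X a2 \<and> cmap (?I \<times> M) (subtopology Y W) g2 \<and>
      (\<forall>x\<in>D. a2 x = a1 x) \<and> (\<forall>x\<in>M \<inter> ?L. a2 x = a x) \<and>
      (\<forall>t\<in>?I. \<forall>x\<in>D. g2 (t, x) = g1 (t, x)) \<and> (\<forall>t\<in>?I. \<forall>x\<in>M \<inter> ?L. g2 (t, x) = b x) \<and>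
      (\<forall>x\<in>M. g2 (0, x) = f (a2 x) \<and> g2 (1, x) = b x)"
    if M: "M = \<Union>\<M>" "finite \<M>" "\<M> \<subseteq> boxes k m" "D \<subseteq> M" "M \<subseteq> ?K" "b ` M \<subseteq> W" "U \<inter> V \<subseteq> W"
      and lW: "lifts_upto X (subtopology Y W) f N" and clM: "cellular M" for M \<M> W
  proof -
    define LM where "LM = D \<union> (M \<inter> ?L)"
    have cLM: "cellular LM" unfolding LM_def by (intro cellular_Un cellular_Int cellD cellL clM)
    have "lifts X (subtopology Y W) f (LM \<union> \<Union>\<M>) LM"
    proof (rule lifts_attach_cells[OF lW M(2) cLM])
      fix e assume "e \<in> \<M>"
      then obtain lo where "e = cell lo {..<k}" using M(3) by (auto simp: boxes_def)
      then show "\<exists>lo S. finite S \<and> int (card S) \<le> N \<and> e = cell lo S" using k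
        by (intro exI[of _ lo] exI[of _ "{..<k}"]) auto
    qed
    moreover have "LM \<union> \<Union>\<M> = M" using M by (auto simp: LM_def)
    ultimately have lM: "lifts X (subtopology Y W) f M LM" by simp
    define aM where "aM = (\<lambda>x. if x \<in> D then a1 x else a x)"
    define gM where "gM = (\<lambda>p. if p \<in> ?I \<times> D then g1 p else b (snd p))"
    have aM: "cmap LM X aM"
      unfolding aM_def LM_def
    proof (rule cmap_paste)
      show "closed (M \<inter> ?L)" by (intro cellular_closed cellular_Int clM cellL)
      show "cmap (M \<inter> ?L) X a" using a by (rule cmap_subset) auto
    qed (use 1 closed in auto)
    have "cmap (?I \<times> D \<union> ({1} \<times> M \<union> ?I \<times> (M \<inter> ?L))) (subtopology Y W) gM"
      unfolding gM_def
    proof (rule cmap_paste)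
      have "closed (M \<inter> ?L)" by (intro cellular_closed cellular_Int clM cellL)
      then show "closed ({1} \<times> M \<union> ?I \<times> (M \<inter> ?L))"
        using clM by (intro closed_Un closed_Times) (auto intro: cellular_closed)
      show "cmap (?I \<times> D) (subtopology Y W) g1" using 1(2) M by (auto intro: cmap_subtopology_mono)
      have "cmap ({1} \<times> M \<union> ?I \<times> (M \<inter> ?L)) Y (\<lambda>p. b (snd p))"
        by (rule cmap_comp[OF b]) (use M in \<open>auto intro!: continuous_intros\<close>)
      moreover have "b x \<in> W" if "x \<in> M" for x using M(6) that by blast
      ultimately show "cmap ({1} \<times> M \<union> ?I \<times> (M \<inter> ?L)) (subtopology Y W) (\<lambda>p. b (snd p))"
        by (auto simp: continuous_map_in_subtopology)
    qed (use 1 closed in \<open>auto intro: closed_Times\<close>)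
    then have gM: "cmap ({1} \<times> M \<union> ?I \<times> LM) (subtopology Y W) gM"
      by (rule cmap_subset) (auto simp: LM_def)
    have gMa: "\<forall>x\<in>LM. gM (0, x) = f (aM x)" using 1 ab by (auto simp: LM_def gM_def aM_def)
    obtain a2 g2 where 2: "cmap M X a2" "cmap (?I \<times> M) (subtopology Y W) g2"
      "\<And>x. x \<in> LM \<Longrightarrow> a2 x = aM x" "\<And>x. x \<in> M \<Longrightarrow> g2 (1, x) = gM (1, x)"
      "\<And>t x. t \<in> {0..1} \<Longrightarrow> x \<in> LM \<Longrightarrow> g2 (t, x) = gM (t, x)"
      "\<And>x. x \<in> M \<Longrightarrow> g2 (0, x) = f (a2 x)" by (rule liftsE[OF lM aM gM gMa]) (rule that)
    have "a2 x = a1 x" if "x \<in> D" for x using 2(3)[of x] that by (simp add: LM_def aM_def)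
    moreover have "a2 x = a x" if "x \<in> M \<inter> ?L" for x
      using 2(3)[of x] 1(3)[of x] that by (auto simp: LM_def aM_def)
    moreover have "g2 (t, x) = g1 (t, x)" if "t \<in> ?I" "x \<in> D" for t x
      using 2(5)[of t x] that by (simp add: LM_def gM_def)
    moreover have "g2 (t, x) = b x" if "t \<in> ?I" "x \<in> M \<inter> ?L" for t x
      using 2(5)[of t x] 1(5)[of t x] that by (auto simp: LM_def gM_def)
    moreover have "g2 (1, x) = b x" if "x \<in> M" for x
      using 2(4)[of x] 1(4)[of x] that by (auto simp: gM_def)
    ultimately show ?thesis using 2(1,2,6)
      by (intro exI[of _ a2] exI[of _ g2] conjI ballI) simp_all
  qed
  obtain aA gA where A: "cmap A X aA" "cmap (?I \<times> A) (subtopology Y U) gA"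
    "\<And>x. x \<in> D \<Longrightarrow> aA x = a1 x" "\<And>x. x \<in> A \<inter> ?L \<Longrightarrow> aA x = a x"
    "\<And>t x. t \<in> ?I \<Longrightarrow> x \<in> D \<Longrightarrow> gA (t, x) = g1 (t, x)" "\<And>t x. t \<in> ?I \<Longrightarrow> x \<in> A \<inter> ?L \<Longrightarrow> gA (t, x) = b x"
    "\<And>x. x \<in> A \<Longrightarrow> gA (0, x) = f (aA x) \<and> gA (1, x) = b x"
    using half[OF A_def fin(1) _ DA(1) _ bA _ lU cell(1)] K by (auto simp: \<A>_def)
  obtain aB gB where B: "cmap B X aB" "cmap (?I \<times> B) (subtopology Y V) gB"
    "\<And>x. x \<in> D \<Longrightarrow> aB x = a1 x" "\<And>x. x \<in> B \<inter> ?L \<Longrightarrow> aB x = a x"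
    "\<And>t x. t \<in> ?I \<Longrightarrow> x \<in> D \<Longrightarrow> gB (t, x) = g1 (t, x)" "\<And>t x. t \<in> ?I \<Longrightarrow> x \<in> B \<inter> ?L \<Longrightarrow> gB (t, x) = b x"
    "\<And>x. x \<in> B \<Longrightarrow> gB (0, x) = f (aB x) \<and> gB (1, x) = b x"
    using half[OF B_def fin(2) _ DA(2) _ bB _ lV cell(2)] K by (auto simp: \<B>_def)
  define a3 where "a3 = (\<lambda>x. if x \<in> A then aA x else aB x)"
  define g3 where "g3 = (\<lambda>p. if p \<in> ?I \<times> A then gA p else gB p)"
  have a3: "cmap ?K X a3"
    unfolding a3_def K by (rule cmap_paste) (use A B closed in \<open>auto simp: D_def\<close>)
  have "cmap (?I \<times> A \<union> ?I \<times> B) (subtopology Y (U \<union> V)) g3"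
    unfolding g3_def
  proof (rule cmap_paste)
    show "cmap (?I \<times> A) (subtopology Y (U \<union> V)) gA" "cmap (?I \<times> B) (subtopology Y (U \<union> V)) gB"
      using A(2) B(2) by (auto intro: cmap_subtopology_mono)
  qed (use A B closed in \<open>auto simp: D_def intro: closed_Times\<close>)
  then have g3: "cmap (?I \<times> ?K) (subtopology Y (U \<union> V)) g3" unfolding K by (simp add: Sigma_Un_distrib2)
  have a3L: "a3 x = a x" if "x \<in> ?L" for x
    using that LK A(4)[of x] B(4)[of x] K by (auto simp: a3_def)
  have g3L: "g3 (t, x) = b x" if "x \<in> ?L" "t \<in> ?I" for t x
    using that LK A(6)[of t x] B(6)[of t x] K by (auto simp: g3_def)
  have g3e: "g3 (0, x) = f (a3 x) \<and> g3 (1, x) = b x" if "x \<in> ?K" for x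
    using that A(7)[of x] B(7)[of x] K by (auto simp: a3_def g3_def)
  define \<psi> where "\<psi> = (\<lambda>y :: nat \<Rightarrow> real. \<lambda>i. y i * m)"
  have c\<psi>: "continuous_on S \<psi>" for S
    unfolding \<psi>_def by (intro continuous_on_coordinatewise_then_product continuous_intros)
  have \<sigma>\<psi>: "\<sigma> (\<psi> y) = y" for y using m by (simp add: \<sigma>_def \<psi>_def)
  have \<psi>: "\<psi> y \<in> ?K" if "y \<in> std_cube k" for y
    using that m by (auto simp: \<psi>_def std_cube_def grid_box_def mult_left_le_one_le)
  have \<psi>L: "\<psi> y \<in> ?L" if "y \<in> std_boundary k" for y
    using \<sigma>L[OF \<psi>, of y] \<sigma>\<psi>[of y] that std_boundary_subset by auto
  show "\<exists>a' h. cmap (std_cube k) X a' \<and> cmap ({0..1::real} \<times> std_cube k) (subtopology Y (U \<union> V)) h \<and>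
      (\<forall>x\<in>std_boundary k. a' x = a0 x) \<and> (\<forall>x\<in>std_cube k. h (0, x) = f (a' x) \<and> h (1, x) = b0 x) \<and>
      (\<forall>t\<in>{0..1}. \<forall>x\<in>std_boundary k. h (t, x) = b0 x)"
  proof (intro exI conjI ballI)
    show "cmap (std_cube k) X (\<lambda>y. a3 (\<psi> y))"
      by (rule cmap_comp[OF a3 c\<psi> \<psi>])
    show "cmap (?I \<times> std_cube k) (subtopology Y (U \<union> V)) (\<lambda>p. g3 (fst p, \<psi> (snd p)))"
      by (rule cmap_comp[OF g3])
        (use \<psi> in \<open>auto intro!: continuous_on_Pair continuous_on_fst continuous_on_id
          continuous_on_compose2[OF c\<psi>[of UNIV] continuous_on_snd[OF continuous_on_id]]\<close>)
    show "a3 (\<psi> y) = a0 y" if "y \<in> std_boundary k" for y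
      using a3L[OF \<psi>L[OF that]] by (simp add: a_def \<sigma>\<psi>)
    show "g3 (fst (0, y), \<psi> (snd (0, y))) = f (a3 (\<psi> y))" "g3 (fst (1, y), \<psi> (snd (1, y))) = b0 y"
      if "y \<in> std_cube k" for y
      using g3e[OF \<psi>[OF that]] by (simp_all add: b_def \<sigma>\<psi>)
    show "g3 (fst (t, y), \<psi> (snd (t, y))) = b0 y" if "t \<in> ?I" "y \<in> std_boundary k" for t y
      using g3L[OF \<psi>L[OF that(2)] that(1)] by (simp add: b_def \<sigma>\<psi>)
  qed
qed

lemma lifts_upto_Un:
  assumes "openin Y U" "openin Y V"
    and "lifts_upto X (subtopology Y U) f N" "lifts_upto X (subtopology Y V) f N"
    and "lifts_upto X (subtopology Y (U \<inter> V)) f (N - 1)"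
  shows "lifts_upto X (subtopology Y (U \<union> V)) f N"
  using assms unfolding lifts_upto_def[of _ _ _ N]
  by (intro allI impI strictly_lifts_imp_lifts strictly_lifts_Un) (auto simp: lifts_upto_def)

lemma std_cube_nonempty: "(\<lambda>_. 0) \<in> std_cube k"
  by (simp add: std_cube_def)

text \<open>The top \<open>{1} \<times> std_cube k\<close> is nonempty even for
  \<open>k = 0\<close>, so there is no lifting problem to solve.\<close>

lemma lifts_upto_empty: "topspace Y = {} \<Longrightarrow> lifts_upto X Y f N"
  unfolding lifts_upto_def
proof (intro allI impI liftsI)
  fix k a and g :: "real \<times> _ \<Rightarrow> _"
  assume empty: "topspace Y = {}" and g: "cmap ({1} \<times> std_cube k \<union> {0..1} \<times> std_boundary k) Y g"
  have "(1, \<lambda>_. 0) \<in> {1} \<times> std_cube k \<union> {0..1::real} \<times> std_boundary k"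
    using std_cube_nonempty by simp
  then have "g (1, \<lambda>_. 0) \<in> topspace Y"
    using continuous_map_image_subset_topspace[OF g] by (simp add: image_subset_iff)
  with empty have False by simp
  then show "\<exists>a' g'. cmap (std_cube k) X a' \<and> cmap ({0..1} \<times> std_cube k) Y g' \<and>
     (\<forall>x\<in>std_boundary k. a' x = a x) \<and>
     (\<forall>p\<in>{1} \<times> std_cube k \<union> {0..1} \<times> std_boundary k. g' p = g p) \<and>
     (\<forall>x\<in>std_cube k. g' (0, x) = f (a' x))"
    ..
qed

text \<open>The overlap of \<open>U m\<close> with the other sets is covered by the sets
  \<open>U i \<inter> U m\<close>. Their intersection over \<open>S\<close> involves
  \<open>card S + 1\<close> of the original sets, which turns \<open>N\<close> into
  \<open>N - 1\<close>; hence the induction varies both \<open>N\<close> and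
  \<open>U\<close>.\<close>

lemma lifts_upto_cover:
  assumes "finite F" "\<And>i. i \<in> F \<Longrightarrow> openin Y (U i)"
    and "\<And>S. S \<subseteq> F \<Longrightarrow> S \<noteq> {} \<Longrightarrow>
      lifts_upto X (subtopology Y (\<Inter>i\<in>S. U i)) f (N + 1 - int (card S))"
  shows "lifts_upto X (subtopology Y (\<Union>i\<in>F. U i)) f N"
  using assms
proof (induction F arbitrary: N U rule: finite_induct)
  case empty
  then show ?case by (intro lifts_upto_empty) simp
next
  case (insert m F)
  have "lifts_upto X (subtopology Y ((\<Union>i\<in>F. U i) \<union> U m)) f N"
  proof (rule lifts_upto_Un)
    show "openin Y (\<Union>i\<in>F. U i)" "openin Y (U m)" using insert.prems by auto
    show "lifts_upto X (subtopology Y (\<Union>i\<in>F. U i)) f N"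
      by (rule insert.IH) (use insert.prems in auto)
    show "lifts_upto X (subtopology Y (U m)) f N" using insert.prems(2)[of "{m}"] by simp
    have "lifts_upto X (subtopology Y (\<Union>i\<in>F. U i \<inter> U m)) f (N - 1)"
    proof (rule insert.IH)
      show "openin Y (U i \<inter> U m)" if "i \<in> F" for i using insert.prems that by auto
      fix S assume S: "S \<subseteq> F" "S \<noteq> {}"
      have "finite S" "m \<notin> S" using S insert.hyps finite_subset by auto
      then have "card (insert m S) = card S + 1" by simp
      moreover have "(\<Inter>i\<in>insert m S. U i) = (\<Inter>i\<in>S. U i \<inter> U m)" using S by auto
      moreover have "lifts_upto X (subtopology Y (\<Inter>i\<in>insert m S. U i)) f (N + 1 - int (card (insert m S)))"
        by (rule insert.prems(2)) (use S in auto)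
      ultimately show "lifts_upto X (subtopology Y (\<Inter>i\<in>S. U i \<inter> U m)) f (N - 1 + 1 - int (card S))"
        by simp
    qed
    moreover have "(\<Union>i\<in>F. U i \<inter> U m) = (\<Union>i\<in>F. U i) \<inter> U m" by auto
    ultimately show "lifts_upto X (subtopology Y ((\<Union>i\<in>F. U i) \<inter> U m)) f (N - 1)" by simp
  qed
  then show ?case by (simp add: Un_commute)
qed

section \<open>Geometric realizations\<close>

abbreviation supp :: "('a \<Rightarrow> real) \<Rightarrow> 'a set" where
  "supp x \<equiv> {p. x p \<noteq> 0}"

lemma Chains_subset: "C \<in> Chains r \<Longrightarrow> D \<subseteq> C \<Longrightarrow> D \<in> Chains r"
  by (auto simp: Chains_def)

lemma sum_supp: "finite \<sigma> \<Longrightarrow> supp x \<subseteq> \<sigma> \<Longrightarrow> sum x \<sigma> = sum x (supp x)"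
  by (rule sum.mono_neutral_right) auto

lemma realization_iff:
  "x \<in> topspace (realization A r) \<longleftrightarrow> (\<forall>p. 0 \<le> x p) \<and> finite (supp x) \<and> supp x \<subseteq> A \<and>
     supp x \<in> Chains r \<and> sum x (supp x) = 1"
proof
  assume "x \<in> topspace (realization A r)"
  then obtain \<sigma> where \<sigma>: "\<sigma> \<in> order_complex A r" "x \<in> closed_simplex \<sigma>"
    by (auto simp: topspace_realization)
  then have sub: "supp x \<subseteq> \<sigma>" and fin: "finite \<sigma>" by (auto simp: closed_simplex_def order_complex_def)
  have "sum x (supp x) = 1" using \<sigma> sum_supp[OF fin sub] by (simp add: closed_simplex_def)
  then show "(\<forall>p. 0 \<le> x p) \<and> finite (supp x) \<and> supp x \<subseteq> A \<and> supp x \<in> Chains r \<and> sum x (supp x) = 1"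
    using \<sigma> sub fin Chains_subset[OF _ sub] finite_subset[OF sub fin]
    by (auto simp: closed_simplex_def order_complex_def)
next
  assume x: "(\<forall>p. 0 \<le> x p) \<and> finite (supp x) \<and> supp x \<subseteq> A \<and> supp x \<in> Chains r \<and> sum x (supp x) = 1"
  then have "supp x \<noteq> {}" by (metis sum.empty zero_neq_one)
  with x have "supp x \<in> order_complex A r" "x \<in> closed_simplex (supp x)"
    by (auto simp: order_complex_def closed_simplex_def)
  then show "x \<in> topspace (realization A r)" by (auto simp: topspace_realization)
qed

lemma supp_nonempty: "x \<in> topspace (realization A r) \<Longrightarrow> supp x \<noteq> {}"
  unfolding realization_iff by (metis sum.empty zero_neq_one)

lemma closed_closed_simplex: "closed (closed_simplex \<sigma>)"
proof -
  have "closed_simplex \<sigma> = (\<Inter>p. {x. 0 \<le> x p}) \<inter> (\<Inter>p\<in>-\<sigma>. {x. x p = 0}) \<inter> {x. sum x \<sigma> = 1}"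
    by (auto simp: closed_simplex_def)
  also have "closed \<dots>"
    by (intro closed_Int closed_INT ballI closed_Collect_le closed_Collect_eq continuous_intros)
  finally show ?thesis .
qed

lemma openin_simplex_Int:
  assumes "open U"
  shows "openin (top_of_set (closed_simplex \<sigma>)) (closed_simplex \<sigma> \<inter> U)"
  using assms by (rule openin_open_Int)

text \<open>The weak topology is finer than that of the function space, since an open set of the
  latter meets every closed simplex in a relatively open set.\<close>

lemma continuous_on_realization:
  fixes a :: "'k::topological_space \<Rightarrow> 'a \<Rightarrow> real"
  assumes "cmap K (realization A r) a"
  shows "continuous_on K a"
proof -
  have "continuous_map (realization A r) euclidean (\<lambda>x. x)"
    unfolding continuous_map_def
  proof (intro conjI allI impI)
    fix U :: "('a \<Rightarrow> real) set" assume "openin euclidean U"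
    then have "open U" by simp
    have "{x \<in> topspace (realization A r). x \<in> U} \<inter> closed_simplex \<sigma> = closed_simplex \<sigma> \<inter> U"
      if "\<sigma> \<in> order_complex A r" for \<sigma>
      using that by (auto simp: topspace_realization)
    then show "openin (realization A r) {x \<in> topspace (realization A r). x \<in> U}"
      unfolding openin_realization using openin_simplex_Int[OF \<open>open U\<close>]
      by (auto simp: topspace_realization)
  qed auto
  from continuous_map_compose[OF assms this] show ?thesis by (simp add: o_def)
qed

lemma closed_realization_Int:
  assumes "closedin (realization A r) C" "\<sigma> \<in> order_complex A r"
  shows "closed (C \<inter> closed_simplex \<sigma>)"
proof -
  have "openin (realization A r) (topspace (realization A r) - C)" using assms(1) by blast
  then have o: "openin (top_of_set (closed_simplex \<sigma>)) ((topspace (realization A r) - C) \<inter> closed_simplex \<sigma>)"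
    using assms(2) by (simp add: openin_realization)
  have "C \<inter> closed_simplex \<sigma> = closed_simplex \<sigma> - (topspace (realization A r) - C) \<inter> closed_simplex \<sigma>"
    using assms(2) by (auto simp: topspace_realization)
  then have "closedin (top_of_set (closed_simplex \<sigma>)) (C \<inter> closed_simplex \<sigma>)"
    using closedin_diff[OF closedin_topspace o] by simp
  then show ?thesis using closed_closed_simplex closedin_closed_trans by blast
qed

text \<open>With all supports in the finite set \<open>F\<close>, only finitely many closed
  simplices matter. A closed set of the realization meets each of them in a closed set of functions,
  so its preimage is a finite union of closed sets.\<close>

lemma cmap_realizationI:
  assumes h: "continuous_on K h" and F: "finite F"
    and hF: "\<And>z. z \<in> K \<Longrightarrow> h z \<in> topspace (realization A r)" "\<And>z. z \<in> K \<Longrightarrow> supp (h z) \<subseteq> F"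
  shows "cmap K (realization A r) h"
  unfolding continuous_map_closedin
proof (intro conjI allI ballI impI)
  show "h \<in> topspace (top_of_set K) \<rightarrow> topspace (realization A r)" using hF by auto
  fix C assume C: "closedin (realization A r) C"
  define \<Sigma> where "\<Sigma> = {\<sigma> \<in> order_complex A r. \<sigma> \<subseteq> F}"
  have fin: "finite \<Sigma>" by (rule finite_subset[of _ "Pow F"]) (use F in \<open>auto simp: \<Sigma>_def\<close>)
  have "\<exists>\<sigma>\<in>\<Sigma>. h z \<in> closed_simplex \<sigma>" if "z \<in> K" for z
  proof -
    have "supp (h z) \<in> order_complex A r" "h z \<in> closed_simplex (supp (h z))"
      using hF(1)[OF that] supp_nonempty[OF hF(1)[OF that]] unfolding realization_iff
      by (auto simp: order_complex_def closed_simplex_def)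
    then show ?thesis using hF(2)[OF that] by (auto simp: \<Sigma>_def)
  qed
  then have eq: "{z \<in> topspace (top_of_set K). h z \<in> C} = \<Union>((\<lambda>\<sigma>. K \<inter> h -` (C \<inter> closed_simplex \<sigma>)) ` \<Sigma>)" by auto
  have cl: "closedin (top_of_set K) (K \<inter> h -` (C \<inter> closed_simplex \<sigma>))" if "\<sigma> \<in> \<Sigma>" for \<sigma>
    using that C by (intro continuous_closedin_preimage[OF h] closed_realization_Int) (auto simp: \<Sigma>_def)
  show "closedin (top_of_set K) {z \<in> topspace (top_of_set K). h z \<in> C}"
    unfolding eq
  proof (rule closedin_Union)
    show "finite ((\<lambda>\<sigma>. K \<inter> h -` (C \<inter> closed_simplex \<sigma>)) ` \<Sigma>)" using fin by (rule finite_imageI)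
    fix T assume "T \<in> (\<lambda>\<sigma>. K \<inter> h -` (C \<inter> closed_simplex \<sigma>)) ` \<Sigma>"
    then obtain \<sigma> where "\<sigma> \<in> \<Sigma>" "T = K \<inter> h -` (C \<inter> closed_simplex \<sigma>)" by (rule imageE)
    then show "closedin (top_of_set K) T" using cl by (simp only:)
  qed
qed

lemma finite_imp_closed_fun:
  fixes D :: "('a \<Rightarrow> real) set"
  assumes "finite D"
  shows "closed D"
proof -
  have "closed {x}" for x :: "'a \<Rightarrow> real"
  proof -
    have "{x} = (\<Inter>p. {y. y p = x p})" by auto
    also have "closed \<dots>" by (intro closed_INT ballI closed_Collect_eq continuous_intros)
    finally show ?thesis .
  qed
  then have "closed (\<Union>x\<in>D. {x})" using assms by (intro closed_UN) auto
  then show ?thesis by simp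
qed

lemma closedin_realization_if_finite:
  assumes "D \<subseteq> topspace (realization A r)"
    and "\<And>\<sigma>. \<sigma> \<in> order_complex A r \<Longrightarrow> finite (D \<inter> closed_simplex \<sigma>)"
  shows "closedin (realization A r) D"
  unfolding closedin_def openin_realization
proof (intro conjI ballI assms(1))
  fix \<sigma> assume \<sigma>: "\<sigma> \<in> order_complex A r"
  have "closed (D \<inter> closed_simplex \<sigma>)" using assms(2)[OF \<sigma>] by (rule finite_imp_closed_fun)
  then have "openin (top_of_set (closed_simplex \<sigma>)) (closed_simplex \<sigma> \<inter> - (D \<inter> closed_simplex \<sigma>))"
    by (intro openin_simplex_Int open_Compl)
  moreover have "closed_simplex \<sigma> \<inter> - (D \<inter> closed_simplex \<sigma>) = (topspace (realization A r) - D) \<inter> closed_simplex \<sigma>"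
    using \<sigma> by (auto simp: topspace_realization)
  ultimately show "openin (top_of_set (closed_simplex \<sigma>)) ((topspace (realization A r) - D) \<inter> closed_simplex \<sigma>)"
    by simp
qed (auto simp: topspace_realization)

text \<open>A compact set meets only finitely many open simplices, because points chosen in distinct
  open simplices form a closed discrete set.\<close>

lemma compactin_realization_supp:
  assumes C: "compactin (realization A r) C"
  obtains F where "finite F" "\<And>x. x \<in> C \<Longrightarrow> supp x \<subseteq> F"
proof -
  have CX: "C \<subseteq> topspace (realization A r)" using C by (rule compactin_subset_topspace)
  define \<rho> where "\<rho> = inv_into C supp"
  define D where "D = \<rho> ` supp ` C"
  have \<rho>: "\<rho> S \<in> C \<and> supp (\<rho> S) = S" if "S \<in> supp ` C" for S
    using that f_inv_into_f[where f = supp, OF that] unfolding \<rho>_def by (auto intro: inv_into_into)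
  have DC: "D \<subseteq> C" using \<rho> by (auto simp: D_def)
  have inj: "inj_on supp D" unfolding D_def by (rule inj_onI) (use \<rho> in auto)
  \<comment> \<open>The points of a simplex have only finitely many supports, and distinct points of
    \<open>D\<close> have distinct supports; so every subset of \<open>D\<close> meets each simplex
    in a finite set.\<close>
  have cl: "closedin (realization A r) E" if E: "E \<subseteq> D" for E
  proof (rule closedin_realization_if_finite)
    fix \<sigma> assume "\<sigma> \<in> order_complex A r"
    then have "finite (Pow \<sigma>)" by (auto simp: order_complex_def)
    moreover have "supp ` (E \<inter> closed_simplex \<sigma>) \<subseteq> Pow \<sigma>" by (auto simp: closed_simplex_def)
    ultimately have "finite (supp ` (E \<inter> closed_simplex \<sigma>))" by (rule finite_subset[rotated])
    then show "finite (E \<inter> closed_simplex \<sigma>)"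
      by (rule finite_imageD) (rule inj_on_subset[OF inj], use E in auto)
  qed (use E DC CX in auto)
  have cD: "compactin (realization A r) D" using closed_compactin[OF C DC cl[OF subset_refl]] .
  \<comment> \<open>Each member of this cover contains exactly one point of
    \<open>D\<close>.\<close>
  define \<U> where "\<U> = (\<lambda>x. topspace (realization A r) - (D - {x})) ` D"
  have "\<And>U. U \<in> \<U> \<Longrightarrow> openin (realization A r) U"
    using cl unfolding \<U>_def by (auto intro!: openin_diff)
  moreover have "D \<subseteq> \<Union>\<U>" using DC CX by (auto simp: \<U>_def)
  ultimately obtain \<F> where \<F>: "finite \<F>" "\<F> \<subseteq> \<U>" "D \<subseteq> \<Union>\<F>"
    using compactinD[OF cD, of \<U>] by blast
  obtain E where E: "E \<subseteq> D" "finite E" "\<F> = (\<lambda>x. topspace (realization A r) - (D - {x})) ` E"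
    using finite_subset_image[OF \<F>(1) \<F>(2)[unfolded \<U>_def]] by auto
  have "D \<subseteq> E"
  proof
    fix x assume "x \<in> D"
    with \<F>(3) obtain U where "U \<in> \<F>" "x \<in> U" by blast
    with E(3) obtain y where "y \<in> E" "x \<notin> D - {y}" by auto
    with \<open>x \<in> D\<close> show "x \<in> E" by auto
  qed
  then have "finite D" using E(2) by (rule finite_subset)
  moreover have "finite (supp x)" if "x \<in> D" for x
  proof -
    from that DC CX have "x \<in> topspace (realization A r)" by blast
    then show ?thesis by (simp add: realization_iff)
  qed
  ultimately have "finite (\<Union>(supp ` D))" by (rule finite_UN_I)
  moreover have "supp x \<subseteq> \<Union>(supp ` D)" if "x \<in> C" for x
  proof -
    have "\<rho> (supp x) \<in> D" "supp (\<rho> (supp x)) = supp x" using \<rho>[OF imageI[OF that, of supp]] that by (simp_all add: D_def)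
    then show ?thesis by blast
  qed
  ultimately show ?thesis by (rule that)
qed

lemma cmap_realization_supp:
  assumes "compact K" "cmap K (realization A r) a"
  obtains F where "finite F" "\<And>z. z \<in> K \<Longrightarrow> supp (a z) \<subseteq> F"
proof -
  have "compactin (realization A r) (a ` K)"
    using image_compactin[OF _ assms(2), of K] assms(1) by (simp add: compactin_subtopology)
  then obtain F where "finite F" "\<And>x. x \<in> a ` K \<Longrightarrow> supp x \<subseteq> F"
    using compactin_realization_supp by blast
  then show ?thesis using that by blast
qed

section \<open>Straight-line homotopies\<close>

definition seg :: "('k \<Rightarrow> 'a \<Rightarrow> real) \<Rightarrow> ('k \<Rightarrow> 'a \<Rightarrow> real) \<Rightarrow> real \<times> 'k \<Rightarrow> 'a \<Rightarrow> real" where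
  "seg a b = (\<lambda>(t, z) p. (1 - t) * a z p + t * b z p)"

lemma supp_seg: "supp (seg a b (t, z)) \<subseteq> supp (a z) \<union> supp (b z)"
  by (auto simp: seg_def)

lemma seg_realization:
  assumes a: "a z \<in> topspace (realization A r)" and b: "b z \<in> topspace (realization A r)"
    and ch: "supp (a z) \<union> supp (b z) \<in> Chains r" and t: "t \<in> {0..1}"
  shows "seg a b (t, z) \<in> topspace (realization A r)"
proof -
  let ?S = "supp (a z) \<union> supp (b z)"
  have fin: "finite ?S" using a b by (simp add: realization_iff)
  have "sum (a z) ?S = 1" "sum (b z) ?S = 1"
    using a b sum_supp[OF fin, of "a z"] sum_supp[OF fin, of "b z"] by (auto simp: realization_iff)
  then have "sum (seg a b (t, z)) ?S = 1"
    by (simp add: seg_def sum.distrib flip: sum_distrib_left)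
  then have "sum (seg a b (t, z)) (supp (seg a b (t, z))) = 1"
    using sum_supp[OF fin supp_seg[of a b t z]] by simp
  moreover have "0 \<le> seg a b (t, z) p" for p
    using a b t by (auto simp: seg_def realization_iff)
  ultimately show ?thesis
    using a b supp_seg[of a b t z] fin Chains_subset[OF ch supp_seg[of a b t z]] finite_subset[OF supp_seg[of a b t z] fin]
    unfolding realization_iff by (auto simp: subset_iff)
qed

lemma continuous_on_seg:
  fixes a b :: "'k::topological_space \<Rightarrow> 'a \<Rightarrow> real"
  assumes "continuous_on K a" "continuous_on K b"
  shows "continuous_on ({0..1} \<times> K) (seg a b)"
proof (rule continuous_on_coordinatewise_then_product)
  fix p
  have "continuous_on ({0..1::real} \<times> K) (\<lambda>q. c (snd q) p)" if "continuous_on K c" for c :: "'k \<Rightarrow> 'a \<Rightarrow> real"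
    by (rule continuous_on_coord, rule continuous_on_compose2[OF that continuous_on_snd[OF continuous_on_id]]) auto
  note this[OF assms(1)] this[OF assms(2)]
  then show "continuous_on ({0..1} \<times> K) (\<lambda>q. seg a b q p)"
    unfolding seg_def case_prod_unfold by (intro continuous_intros)
qed

text \<open>The chain condition keeps each segment in one simplex. Compactness of \<open>K\<close>
  bounds all supports by a finite set, which reduces continuity in the weak topology to continuity
  of coordinates.\<close>

lemma cmap_seg:
  fixes a b :: "'k::topological_space \<Rightarrow> 'a \<Rightarrow> real"
  assumes "compact K" and a: "cmap K (realization A r) a" and b: "cmap K (realization A r) b"
    and ch: "\<And>z. z \<in> K \<Longrightarrow> supp (a z) \<union> supp (b z) \<in> Chains r"
  shows "cmap ({0..1} \<times> K) (realization A r) (seg a b)"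
proof -
  obtain F G where F: "finite F" "\<And>z. z \<in> K \<Longrightarrow> supp (a z) \<subseteq> F"
    and G: "finite G" "\<And>z. z \<in> K \<Longrightarrow> supp (b z) \<subseteq> G"
    using cmap_realization_supp[OF assms(1) a] cmap_realization_supp[OF assms(1) b] by metis
  show ?thesis
  proof (rule cmap_realizationI[of _ _ "F \<union> G"])
    show "continuous_on ({0..1} \<times> K) (seg a b)"
      by (intro continuous_on_seg continuous_on_realization[OF a] continuous_on_realization[OF b])
    fix q :: "real \<times> 'k" assume q: "q \<in> {0..1} \<times> K"
    then obtain t z where tz: "q = (t, z)" "t \<in> {0..1}" "z \<in> K" by auto
    have "a z \<in> topspace (realization A r)" "b z \<in> topspace (realization A r)"
      using tz continuous_map_image_subset_topspace[OF a] continuous_map_image_subset_topspace[OF b] by auto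
    then show "seg a b q \<in> topspace (realization A r)"
      unfolding tz(1) using ch[OF tz(3)] tz(2) by (rule seg_realization)
    show "supp (seg a b q) \<subseteq> F \<union> G"
      unfolding tz(1) using supp_seg[of a b t z] F(2)[OF tz(3)] G(2)[OF tz(3)] by blast
  qed (use F G in auto)
qed

lemma cmap_realization_mono:
  assumes "compact K" "cmap K (realization W r) a" "W \<subseteq> A"
  shows "cmap K (realization A r) a"
proof -
  obtain F where F: "finite F" "\<And>z. z \<in> K \<Longrightarrow> supp (a z) \<subseteq> F"
    using cmap_realization_supp[OF assms(1,2)] by metis
  show ?thesis
  proof (rule cmap_realizationI[OF continuous_on_realization[OF assms(2)] F(1)])
    fix z assume "z \<in> K"
    then have "a z \<in> topspace (realization W r)"
      using continuous_map_image_subset_topspace[OF assms(2)] by auto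
    then show "a z \<in> topspace (realization A r)" using assms(3) by (auto simp: realization_iff)
  qed (use F in auto)
qed

section \<open>Open stars and fillings in them\<close>

definition star :: "'a set \<Rightarrow> 'a rel \<Rightarrow> 'a set \<Rightarrow> ('a \<Rightarrow> real) set" where
  "star A r W = {x \<in> topspace (realization A r). \<exists>p\<in>W. x p \<noteq> 0}"

text \<open>Within each closed simplex the star is a union of open conditions
  \<open>x p \<noteq> 0\<close>; it is the complement of the realization of
  \<open>A - W\<close>.\<close>

lemma openin_star: "openin (realization A r) (star A r W)"
  unfolding openin_realization
proof (intro conjI ballI)
  show "star A r W \<subseteq> \<Union> (closed_simplex ` order_complex A r)"
    by (auto simp: star_def topspace_realization)
  fix \<sigma> assume "\<sigma> \<in> order_complex A r"
  then have "star A r W \<inter> closed_simplex \<sigma> = closed_simplex \<sigma> \<inter> (\<Union>p\<in>W. {x. x p \<noteq> 0})"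
    by (auto simp: star_def topspace_realization)
  moreover have "open (\<Union>p\<in>W. {x :: 'a \<Rightarrow> real. x p \<noteq> 0})"
    by (intro open_UN ballI open_Collect_neq continuous_intros)
  ultimately show "openin (top_of_set (closed_simplex \<sigma>)) (star A r W \<inter> closed_simplex \<sigma>)"
    by (simp add: openin_simplex_Int)
qed

text \<open>Drops the coordinates outside \<open>W\<close> and rescales the others, whose sum is
  positive on the star. The finite \<open>F\<close> makes this a fixed finite sum, so continuity is
  evident. The bound on supports prepares straight-line homotopies between \<open>a\<close> and
  \<open>b\<close>.\<close>

lemma star_retract:
  assumes K: "compact K" and a: "cmap K (realization A r) a" and aW: "\<And>z. z \<in> K \<Longrightarrow> a z \<in> star A r W"
  obtains b where "cmap K (realization W r) b" "\<And>z. z \<in> K \<Longrightarrow> supp (b z) \<subseteq> supp (a z)"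
proof -
  obtain F where F: "finite F" "\<And>z. z \<in> K \<Longrightarrow> supp (a z) \<subseteq> F"
    using cmap_realization_supp[OF K a] by metis
  define m where "m = (\<lambda>z. \<Sum>p\<in>F \<inter> W. a z p)"
  define b where "b = (\<lambda>z p. if p \<in> F \<inter> W then a z p / m z else 0)"
  have az: "a z \<in> topspace (realization A r)" if "z \<in> K" for z using aW[OF that] by (simp add: star_def)
  have pos: "m z > 0" if z: "z \<in> K" for z
  proof -
    obtain p where "p \<in> W" "a z p \<noteq> 0" using aW[OF z] by (auto simp: star_def)
    then have "p \<in> F \<inter> W" "a z p > 0" using F(2)[OF z] az[OF z] by (auto simp: realization_iff order_less_le)
    then show ?thesis unfolding m_def
      using F(1) az[OF z] by (intro sum_pos2[of _ p]) (auto simp: realization_iff)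
  qed
  have sub: "supp (b z) \<subseteq> supp (a z)" for z by (auto simp: b_def)
  have "cmap K (realization W r) b"
  proof (rule cmap_realizationI[OF _ F(1)])
    have c: "continuous_on K (\<lambda>z. a z p)" for p
      by (rule continuous_on_coord[OF continuous_on_realization[OF a]])
    then have "continuous_on K m" unfolding m_def by (intro continuous_intros)
    show "continuous_on K b"
    proof (rule continuous_on_coordinatewise_then_product)
      fix p show "continuous_on K (\<lambda>z. b z p)"
        unfolding b_def using c[of p] \<open>continuous_on K m\<close> pos
        by (cases "p \<in> F \<inter> W") (auto intro!: continuous_intros simp: less_imp_neq[symmetric])
    qed
    show "supp (b z) \<subseteq> F" for z by (auto simp: b_def)
    fix z assume z: "z \<in> K"
    have fb: "finite (F \<inter> W)" "supp (b z) \<subseteq> F \<inter> W" using F by (auto simp: b_def)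
    have "sum (b z) (supp (b z)) = sum (b z) (F \<inter> W)" using sum_supp[OF fb] by simp
    also have "\<dots> = m z / m z" unfolding m_def sum_divide_distrib by (rule sum.cong) (auto simp: b_def m_def)
    also have "\<dots> = 1" using pos[OF z] by simp
    finally show "b z \<in> topspace (realization W r)"
      using az[OF z] pos[OF z] fb Chains_subset[OF _ sub[of z]]
      unfolding realization_iff by (auto simp: b_def intro: finite_subset)
  qed
  then show ?thesis using sub that by blast
qed

lemma cmap_star: "cmap K (subtopology (realization A r) (star A r W)) a \<longleftrightarrow>
    cmap K (realization A r) a \<and> (\<forall>z\<in>K. a z \<in> star A r W)"
  by (auto simp: continuous_map_in_subtopology)

lemma realization_subset_star:
  assumes "W \<subseteq> A" "x \<in> topspace (realization W r)"
  shows "x \<in> star A r W"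
proof -
  have "supp x \<noteq> {}" by (rule supp_nonempty[OF assms(2)])
  with assms show ?thesis by (auto simp: star_def realization_iff subset_iff)
qed

text \<open>The retracted map \<open>b\<close> is joined to \<open>a\<close> by straight segments,
  which stay in the simplices of \<open>a\<close>.\<close>

lemma fills_star:
  assumes "fills (realization W r) k" "W \<subseteq> A"
  shows "fills (subtopology (realization A r) (star A r W)) k"
proof (rule fills_retract[OF assms(1)])
  fix a assume "cmap (std_boundary k) (subtopology (realization A r) (star A r W)) a"
  then have a: "cmap (std_boundary k) (realization A r) a"
    and aW: "\<And>z. z \<in> std_boundary k \<Longrightarrow> a z \<in> star A r W" by (auto simp: cmap_star)
  obtain b where b: "cmap (std_boundary k) (realization W r) b"
    and sub: "\<And>z. z \<in> std_boundary k \<Longrightarrow> supp (b z) \<subseteq> supp (a z)"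
    using star_retract[OF compact_std_boundary a aW] by blast
  have bA: "cmap (std_boundary k) (realization A r) b"
    by (rule cmap_realization_mono[OF _ b assms(2)]) simp
  have bz: "b z \<in> topspace (realization W r)" if "z \<in> std_boundary k" for z
    using that continuous_map_image_subset_topspace[OF b] by auto
  have seg: "cmap ({0..1} \<times> std_boundary k) (realization A r) (seg a b)"
  proof (rule cmap_seg[OF _ a bA])
    fix z assume z: "z \<in> std_boundary k"
    have "supp (a z) \<in> Chains r" using aW[OF z] by (simp add: star_def realization_iff)
    then show "supp (a z) \<union> supp (b z) \<in> Chains r" using sub[OF z] by (simp add: Un_absorb2)
  qed simp
  \<comment> \<open>A vertex of \<open>W\<close> with positive weight in \<open>b z\<close> has
    positive weight in \<open>a z\<close> as well, hence along the whole segment.\<close>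
  have seg_star: "seg a b (t, z) \<in> star A r W" if t: "t \<in> {0..1}" and z: "z \<in> std_boundary k" for t z
  proof -
    obtain p where p: "p \<in> W" "b z p \<noteq> 0" using supp_nonempty[OF bz[OF z]] bz[OF z] by (auto simp: realization_iff)
    then have "b z p > 0" "a z p > 0"
      using bz[OF z] aW[OF z] sub[OF z] by (auto simp: realization_iff star_def order_less_le)
    then have "(1 - t) * a z p + t * b z p > 0" using t
      by (cases "t = 0") (auto intro: add_nonneg_pos)
    then have "seg a b (t, z) p \<noteq> 0" by (simp add: seg_def)
    moreover have "seg a b (t, z) \<in> topspace (realization A r)"
      using continuous_map_image_subset_topspace[OF seg] t z by auto
    ultimately show ?thesis using p by (auto simp: star_def)
  qed
  have "cmap ({0..1} \<times> std_boundary k) (subtopology (realization A r) (star A r W)) (seg a b)"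
    unfolding cmap_star using seg seg_star by (metis mem_Sigma_iff prod.collapse)
  then show "\<exists>b H. cmap (std_boundary k) (realization W r) b \<and>
      cmap ({0..1::real} \<times> std_boundary k) (subtopology (realization A r) (star A r W)) H \<and>
      (\<forall>x\<in>std_boundary k. H (0, x) = a x \<and> H (1, x) = b x)"
    using b by (intro exI[of _ b] exI[of _ "seg a b"]) (auto simp: seg_def)
next
  fix F assume F: "cmap (std_cube k) (realization W r) F"
  have "F z \<in> star A r W" if "z \<in> std_cube k" for z
    using that continuous_map_image_subset_topspace[OF F] assms(2) by (intro realization_subset_star) auto
  then show "cmap (std_cube k) (subtopology (realization A r) (star A r W)) F"
    unfolding cmap_star using cmap_realization_mono[OF compact_std_cube F assms(2)] by blast
qed

text \<open>The realization is a cone: \<open>q\<close> can be added to any chain in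
  \<open>W\<close>, so straight segments contract every map to the vertex \<open>q\<close>.\<close>

lemma fills_minimum:
  assumes "q \<in> W" "\<And>p. p \<in> W \<Longrightarrow> (q, p) \<in> r"
  shows "fills (realization W r) k"
  unfolding fills_def
proof (intro allI impI)
  fix a assume a: "cmap (std_boundary k) (realization W r) a"
  define \<delta> where "\<delta> = (\<lambda>p. if p = q then 1 else (0::real))"
  have sd: "supp \<delta> = {q}" by (auto simp: \<delta>_def)
  have \<delta>: "\<delta> \<in> topspace (realization W r)"
    unfolding realization_iff sd using assms by (auto simp: \<delta>_def Chains_def)
  have "cmap ({0..1} \<times> std_boundary k) (realization W r) (seg a (\<lambda>_. \<delta>))"
  proof (rule cmap_seg[OF _ a])
    show "cmap (std_boundary k) (realization W r) (\<lambda>_. \<delta>)" using \<delta> by simp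
    fix z assume "z \<in> std_boundary k"
    then have "a z \<in> topspace (realization W r)" using continuous_map_image_subset_topspace[OF a] by auto
    then show "supp (a z) \<union> supp \<delta> \<in> Chains r"
      unfolding sd using assms by (auto simp: realization_iff Chains_def)
  qed simp
  moreover have "cmap (std_cube k) (realization W r) (\<lambda>_. \<delta>)" using \<delta> by simp
  ultimately have "\<exists>G. cmap (std_cube k) (realization W r) G \<and>
      (\<forall>x\<in>std_boundary k. G x = seg a (\<lambda>_. \<delta>) (0, x))"
    by (rule fill_homotopic) (simp add: seg_def)
  then show "\<exists>F. cmap (std_cube k) (realization W r) F \<and> (\<forall>x\<in>std_boundary k. F x = a x)"
    by (simp add: seg_def)
qed

section \<open>Maps between realizations\<close>

lemma continuous_map_from_realization:
  assumes "\<And>\<sigma>. \<sigma> \<in> order_complex A r \<Longrightarrow> cmap (closed_simplex \<sigma>) Y g"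
  shows "continuous_map (realization A r) Y g"
  unfolding continuous_map_def
proof (intro conjI allI impI)
  show "g \<in> topspace (realization A r) \<rightarrow> topspace Y"
    using assms continuous_map_image_subset_topspace by (fastforce simp: topspace_realization)
  fix V assume V: "openin Y V"
  show "openin (realization A r) {x \<in> topspace (realization A r). g x \<in> V}"
    unfolding openin_realization
  proof (intro conjI ballI)
    fix \<sigma> assume \<sigma>: "\<sigma> \<in> order_complex A r"
    then have "{x \<in> topspace (realization A r). g x \<in> V} \<inter> closed_simplex \<sigma> =
        {x \<in> topspace (top_of_set (closed_simplex \<sigma>)). g x \<in> V}"
      by (auto simp: topspace_realization)
    then show "openin (top_of_set (closed_simplex \<sigma>)) ({x \<in> topspace (realization A r). g x \<in> V} \<inter> closed_simplex \<sigma>)"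
      using openin_continuous_map_preimage[OF assms[OF \<sigma>] V] by simp
  qed (auto simp: topspace_realization)
qed

lemma realization_map_eq_sum:
  assumes "finite \<sigma>" "supp x \<subseteq> \<sigma>"
  shows "realization_map f x q = (\<Sum>p | p \<in> \<sigma> \<and> f p = q. x p)"
  unfolding realization_map_def using assms by (intro sum.mono_neutral_left) auto

text \<open>The coordinates are nonnegative, so nothing cancels in the sums that define the
  image.\<close>

lemma supp_realization_map:
  assumes "\<forall>p. 0 \<le> x p" "finite (supp x)"
  shows "supp (realization_map f x) = f ` supp x"
proof -
  have "realization_map f x q \<noteq> 0 \<longleftrightarrow> (\<exists>p. x p \<noteq> 0 \<and> f p = q)" for q
  proof -
    have "finite {p. x p \<noteq> 0 \<and> f p = q}" using assms(2) by (rule finite_subset[rotated]) auto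
    then show ?thesis
      unfolding realization_map_def using assms(1) by (subst sum_nonneg_eq_0_iff) auto
  qed
  then show ?thesis by auto
qed

lemma realization_map_in:
  assumes x: "x \<in> topspace (realization P r)" and f: "f \<in> P \<rightarrow> Q"
    and mono: "monotone_on P (\<lambda>x y. (x, y) \<in> r) (\<lambda>x y. (x, y) \<in> s) f"
  shows "realization_map f x \<in> topspace (realization Q s)"
proof -
  have x': "\<forall>p. 0 \<le> x p" "finite (supp x)" "supp x \<subseteq> P" "supp x \<in> Chains r" "sum x (supp x) = 1"
    using x by (auto simp: realization_iff)
  note sp = supp_realization_map[OF x'(1,2), of f]
  have "f ` supp x \<in> Chains s"
    unfolding Chains_def
  proof (intro CollectI ballI)
    fix u v assume "u \<in> f ` supp x" "v \<in> f ` supp x"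
    then obtain p p' where "p \<in> supp x" "p' \<in> supp x" "u = f p" "v = f p'" by blast
    moreover from this have "(p, p') \<in> r \<or> (p', p) \<in> r" using x'(4) unfolding Chains_def by blast
    ultimately show "(u, v) \<in> s \<or> (v, u) \<in> s"
      using monotone_onD[OF mono] x'(3) by blast
  qed
  moreover have "sum (realization_map f x) (f ` supp x) = 1"
  proof -
    have "sum (realization_map f x) (f ` supp x) = (\<Sum>q\<in>f ` supp x. \<Sum>p | p \<in> supp x \<and> f p = q. x p)"
      by (rule sum.cong) (simp_all add: realization_map_def)
    also have "\<dots> = sum x (supp x)" using x'(2) by (rule sum.image_gen[symmetric])
    finally show ?thesis using x'(5) by simp
  qed
  moreover have "0 \<le> realization_map f x q" for q
    unfolding realization_map_def using x'(1) by (intro sum_nonneg) auto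
  ultimately show ?thesis
    unfolding realization_iff sp using x' f by auto
qed

lemma continuous_map_realization_map:
  assumes f: "f \<in> P \<rightarrow> Q" and mono: "monotone_on P (\<lambda>x y. (x, y) \<in> r) (\<lambda>x y. (x, y) \<in> s) f"
  shows "continuous_map (realization P r) (realization Q s) (realization_map f)"
proof (rule continuous_map_from_realization)
  fix \<sigma> assume \<sigma>: "\<sigma> \<in> order_complex P r"
  then have fin: "finite \<sigma>" by (simp add: order_complex_def)
  have sub: "supp x \<subseteq> \<sigma>" if "x \<in> closed_simplex \<sigma>" for x using that by (auto simp: closed_simplex_def)
  show "cmap (closed_simplex \<sigma>) (realization Q s) (realization_map f)"
  proof (rule cmap_realizationI[of _ _ "f ` \<sigma>"])
    show "continuous_on (closed_simplex \<sigma>) (realization_map f)"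
    proof (rule continuous_on_coordinatewise_then_product)
      fix q
      have "continuous_on (closed_simplex \<sigma>) (\<lambda>x. \<Sum>p | p \<in> \<sigma> \<and> f p = q. x p)"
        by (intro continuous_intros)
      then show "continuous_on (closed_simplex \<sigma>) (\<lambda>x. realization_map f x q)"
        by (rule continuous_on_eq) (simp add: realization_map_eq_sum[OF fin sub])
    qed
    fix x assume x: "x \<in> closed_simplex \<sigma>"
    then have xr: "x \<in> topspace (realization P r)" using \<sigma> by (auto simp: topspace_realization)
    then show "realization_map f x \<in> topspace (realization Q s)" by (rule realization_map_in[OF _ f mono])
    have "supp (realization_map f x) = f ` supp x"
      using xr by (intro supp_realization_map) (auto simp: realization_iff)
    then show "supp (realization_map f x) \<subseteq> f ` \<sigma>" using sub[OF x] by auto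
  qed (use fin in simp)
qed


section \<open>Homotopy groups and the theorem\<close>

text \<open>The homotopies are concatenated at each time; where the halves meet, both take the value
  \<open>z\<close>. This makes the product of classes well defined and, applied to constant
  homotopies, puts concatenations in \<open>cube_maps\<close>.\<close>

lemma cube_homotopic_concat:
  assumes k: "0 < k" and "cube_homotopic k Z z a a'" "cube_homotopic k Z z b b'"
  shows "cube_homotopic k Z z (cube_concat a b) (cube_concat a' b')"
proof -
  from assms(2,3) obtain H G where
    H: "cmap ({0..1} \<times> std_cube k) Z H"
      "\<And>x. x \<in> std_cube k \<Longrightarrow> H (0::real, x) = a (res k x) \<and> H (1, x) = a' (res k x)"
      "\<And>t x. t \<in> {0..1} \<Longrightarrow> x \<in> std_boundary k \<Longrightarrow> H (t, x) = z" and
    G: "cmap ({0..1} \<times> std_cube k) Z G"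
      "\<And>x. x \<in> std_cube k \<Longrightarrow> G (0::real, x) = b (res k x) \<and> G (1, x) = b' (res k x)"
      "\<And>t x. t \<in> {0..1} \<Longrightarrow> x \<in> std_boundary k \<Longrightarrow> G (t, x) = z"
    unfolding cube_homotopic_iff by blast
  define l u where "l = (\<lambda>x::nat \<Rightarrow> real. x(0 := 2 * x 0))" and "u = (\<lambda>x::nat \<Rightarrow> real. x(0 := 2 * x 0 - 1))"
  define E where "E = (\<lambda>p. if snd p 0 \<le> 1/2 then H (fst p, l (snd p)) else G (fst p, u (snd p)))"
  have l: "l x \<in> std_cube k" if "x \<in> std_cube k" "x 0 \<le> 1/2" for x
    using that k by (auto simp: l_def std_cube_def)
  have u: "u x \<in> std_cube k" if "x \<in> std_cube k" "1/2 \<le> x 0" for x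
    using that k by (auto simp: u_def std_cube_def)
  have lB: "l x \<in> std_boundary k" if "x \<in> std_cube k" "x 0 \<le> 1/2" "x \<in> std_boundary k \<or> x 0 = 1/2" for x
  proof -
    have "\<exists>i<k. l x i = 0 \<or> l x i = 1"
    proof (cases "x 0 = 1/2")
      case True then show ?thesis using k by (intro exI[of _ 0]) (simp add: l_def)
    next
      case False
      with that(3) have "x \<in> std_boundary k" by blast
      then obtain i where "i < k" "x i = 0 \<or> x i = 1" by (auto simp: std_boundary_def)
      then show ?thesis using that by (intro exI[of _ i]) (auto simp: l_def)
    qed
    then show ?thesis using l[OF that(1,2)] by (simp add: std_boundary_def)
  qed
  have uB: "u x \<in> std_boundary k" if "x \<in> std_cube k" "1/2 \<le> x 0" "x \<in> std_boundary k \<or> x 0 = 1/2" for x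
  proof -
    have "\<exists>i<k. u x i = 0 \<or> u x i = 1"
    proof (cases "x 0 = 1/2")
      case True then show ?thesis using k by (intro exI[of _ 0]) (simp add: u_def)
    next
      case False
      with that(3) have "x \<in> std_boundary k" by blast
      then obtain i where "i < k" "x i = 0 \<or> x i = 1" by (auto simp: std_boundary_def)
      then show ?thesis using that by (intro exI[of _ i]) (auto simp: u_def)
    qed
    then show ?thesis using u[OF that(1,2)] by (simp add: std_boundary_def)
  qed
  have "cmap ({0..1} \<times> std_cube k) Z E"
    unfolding E_def
  proof (rule cmap_If_le)
    show "cmap {x \<in> {0..1} \<times> std_cube k. snd x 0 \<le> 1 / 2} Z (\<lambda>p. H (fst p, l (snd p)))"
      by (rule cmap_comp[OF H(1)]) (use l in \<open>auto simp: l_def intro!: continuous_intros\<close>)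
    show "cmap {x \<in> {0..1} \<times> std_cube k. 1 / 2 \<le> snd x 0} Z (\<lambda>p. G (fst p, u (snd p)))"
      by (rule cmap_comp[OF G(1)]) (use u in \<open>auto simp: u_def intro!: continuous_intros\<close>)
    show "H (fst p, l (snd p)) = G (fst p, u (snd p))"
      if "p \<in> {0..1} \<times> std_cube k" "snd p 0 = 1 / 2" for p
      using that H(3)[of "fst p", OF _ lB] G(3)[of "fst p", OF _ uB] by auto
  qed (auto intro!: continuous_intros)
  moreover have r: "res k x 0 = x 0" "(res k x)(0 := c) = res k (x(0 := c))" for x c
    using k by (auto simp: res_def)
  have "E (0, x) = cube_concat a b (res k x)" "E (1, x) = cube_concat a' b' (res k x)"
    if x: "x \<in> std_cube k" for x
    using H(2)[OF l[OF x]] G(2)[OF u[OF x]] by (auto simp: cube_concat_def E_def r l_def u_def)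
  moreover have "E (t, x) = z" if "t \<in> {0..1}" "x \<in> std_boundary k" for t x
    using that H(3)[OF that(1) lB] G(3)[OF that(1) uB] std_boundary_subset[of k]
    by (auto simp: E_def)
  ultimately show "cube_homotopic k Z z (cube_concat a b) (cube_concat a' b')"
    unfolding cube_homotopic_iff by blast
qed

lemma cube_homotopic_compose:
  assumes "cube_homotopic k Z z a b" "continuous_map Z W g"
  shows "cube_homotopic k W (g z) (g \<circ> a) (g \<circ> b)"
proof -
  obtain H where H: "cmap ({0..1} \<times> std_cube k) Z H"
      "\<And>x. x \<in> std_cube k \<Longrightarrow> H (0::real, x) = a (res k x) \<and> H (1, x) = b (res k x)"
      "\<And>t x. t \<in> {0..1} \<Longrightarrow> x \<in> std_boundary k \<Longrightarrow> H (t, x) = z"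
    using assms(1) unfolding cube_homotopic_iff by blast
  have "cmap ({0..1} \<times> std_cube k) W (\<lambda>p. g (H p))"
    using continuous_map_compose[OF H(1) assms(2)] by (simp add: o_def)
  then show ?thesis
    unfolding cube_homotopic_iff using H(2,3) by (intro exI[of _ "\<lambda>p. g (H p)"]) simp
qed

text \<open>The union in the definition runs over equal classes and so collapses to one of them; it
  is nonempty because \<open>a\<close> represents its own class.\<close>

lemma homotopy_group_map_class:
  assumes "a \<in> cube_maps k Z z" "continuous_map Z W g"
  shows "homotopy_group_map k W g z (cube_class k Z z a) = cube_class k W (g z) (g \<circ> a)"
proof -
  have "cube_class k W (g z) (g \<circ> b) = cube_class k W (g z) (g \<circ> a)" if "b \<in> cube_class k Z z a" for b
  proof -
    have h: "cube_homotopic k W (g z) (g \<circ> a) (g \<circ> b)"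
      using that assms by (auto simp: cube_class_def intro: cube_homotopic_compose)
    then show ?thesis using cube_class_eq_iff cube_homotopic_maps by metis
  qed
  moreover have "a \<in> cube_class k Z z a"
    using assms by (simp add: cube_class_def cube_homotopic_refl)
  ultimately show ?thesis unfolding homotopy_group_map_def by blast
qed

lemma homotopy_group_mult_class:
  assumes "0 < k" "a \<in> cube_maps k Z z" "b \<in> cube_maps k Z z"
  shows "mult (homotopy_group k Z z) (cube_class k Z z a) (cube_class k Z z b) =
    cube_class k Z z (cube_concat a b)"
proof -
  have *: "cube_class k Z z (cube_concat a' b') = cube_class k Z z (cube_concat a b)"
    if "a' \<in> cube_class k Z z a" "b' \<in> cube_class k Z z b" for a' b'
  proof -
    have h: "cube_homotopic k Z z (cube_concat a b) (cube_concat a' b')"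
      using that by (intro cube_homotopic_concat[OF assms(1)]) (auto simp: cube_class_def)
    then show ?thesis using cube_class_eq_iff cube_homotopic_maps by metis
  qed
  have "a \<in> cube_class k Z z a" "b \<in> cube_class k Z z b"
    using assms by (auto simp: cube_class_def cube_homotopic_refl)
  then have "(\<Union>a'\<in>cube_class k Z z a. \<Union>b'\<in>cube_class k Z z b. cube_class k Z z (cube_concat a' b')) =
      cube_class k Z z (cube_concat a b)"
    by (intro UN_constant_eq ballI *)
  then show ?thesis by (simp add: homotopy_group_def)
qed

lemma cube_maps_compose: "a \<in> cube_maps k Z z \<Longrightarrow> continuous_map Z W g \<Longrightarrow> g \<circ> a \<in> cube_maps k W (g z)"
  by (auto simp: cube_maps_def intro: continuous_map_compose)

lemma homotopy_group_map_hom: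
  assumes k: "0 < k" and g: "continuous_map Z W g"
  shows "homotopy_group_map k W g z \<in> hom (homotopy_group k Z z) (homotopy_group k W (g z))"
proof (rule homI)
  fix x assume "x \<in> carrier (homotopy_group k Z z)"
  then show "homotopy_group_map k W g z x \<in> carrier (homotopy_group k W (g z))"
    using homotopy_group_map_class[OF _ g] cube_maps_compose[OF _ g] by (auto simp: homotopy_group_def)
next
  fix x y assume "x \<in> carrier (homotopy_group k Z z)" "y \<in> carrier (homotopy_group k Z z)"
  then obtain a b where ab: "a \<in> cube_maps k Z z" "b \<in> cube_maps k Z z"
    "x = cube_class k Z z a" "y = cube_class k Z z b" by (auto simp: homotopy_group_def)
  have c: "cube_concat a b \<in> cube_maps k Z z"
    using cube_homotopic_maps[OF cube_homotopic_concat[OF k cube_homotopic_refl[OF ab(1)] cube_homotopic_refl[OF ab(2)]]]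
    by simp
  have "g \<circ> cube_concat a b = cube_concat (g \<circ> a) (g \<circ> b)" by (auto simp: cube_concat_def)
  then show "homotopy_group_map k W g z (x \<otimes>\<^bsub>homotopy_group k Z z\<^esub> y) =
      homotopy_group_map k W g z x \<otimes>\<^bsub>homotopy_group k W (g z)\<^esub> homotopy_group_map k W g z y"
    using ab c k g by (simp add: homotopy_group_mult_class homotopy_group_map_class cube_maps_compose)
qed

text \<open>A representative \<open>b\<close> on the cube, with the constant map to \<open>z\<close>
  prescribed on the boundary, is a lifting problem. The homotopy obtained is constant on the
  boundary, so it identifies classes in \<open>\<pi>\<^sub>k\<close>.\<close>

lemma lifts_surj:
  assumes "lifts Z W g (std_cube k) (std_boundary k)" and z: "z \<in> topspace Z" and g: "continuous_map Z W g"
  shows "homotopy_group_map k W g z ` carrier (homotopy_group k Z z) = carrier (homotopy_group k W (g z))"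
proof (intro equalityI subsetI)
  fix x assume "x \<in> homotopy_group_map k W g z ` carrier (homotopy_group k Z z)"
  then show "x \<in> carrier (homotopy_group k W (g z))"
    using homotopy_group_map_class[OF _ g] cube_maps_compose[OF _ g] by (auto simp: homotopy_group_def)
next
  fix x assume "x \<in> carrier (homotopy_group k W (g z))"
  then obtain b where b: "b \<in> cube_maps k W (g z)" "x = cube_class k W (g z) b"
    by (auto simp: homotopy_group_def)
  have sl: "strictly_lifts Z W g (std_cube k) (std_boundary k)"
    by (rule lifts_imp_strictly_lifts[OF assms(1) std_boundary_subset])
  have "cmap (std_boundary k) Z (\<lambda>_. z)" using z by simp
  moreover have "cmap (std_cube k) W (\<lambda>x. b (res k x))" "\<forall>x\<in>std_boundary k. b (res k x) = g z"
    using b(1) by (auto simp: cube_maps_iff)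
  ultimately obtain a h where a: "cmap (std_cube k) Z a" "cmap ({0..1::real} \<times> std_cube k) W h"
    "\<And>x. x \<in> std_boundary k \<Longrightarrow> a x = z"
    "\<And>x. x \<in> std_cube k \<Longrightarrow> h (0, x) = g (a x)" "\<And>x. x \<in> std_cube k \<Longrightarrow> h (1, x) = b (res k x)"
    "\<And>t x. t \<in> {0..1} \<Longrightarrow> x \<in> std_boundary k \<Longrightarrow> h (t, x) = b (res k x)"
    by (rule strictly_liftsE[OF sl]) (rule that)
  define a' where "a' = (\<lambda>y. a (ext k y))"
  have a'r: "a' (res k x) = a x" if "x \<in> std_cube k" for x using that by (simp add: a'_def)
  have a': "a' \<in> cube_maps k Z z"
    unfolding cube_maps_iff using a(3) std_boundary_subset[of k] cmap_cong[OF a(1), of "\<lambda>x. a' (res k x)"]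
    by (auto simp: a'r subset_iff)
  have "cube_homotopic k W (g z) (g \<circ> a') b"
    unfolding cube_homotopic_iff using a b by (intro exI[of _ h]) (auto simp: a'r cube_maps_iff)
  then have "homotopy_group_map k W g z (cube_class k Z z a') = x"
    using homotopy_group_map_class[OF a' g] cube_class_eq_iff[OF cube_maps_compose[OF a' g]] b(2) by simp
  then show "x \<in> homotopy_group_map k W g z ` carrier (homotopy_group k Z z)"
    using a' by (auto simp: homotopy_group_def)
qed

text \<open>A homotopy between \<open>g \<circ> a\<close> and \<open>g \<circ> b\<close> is a map on
  the \<open>(k + 1)\<close>-cube that lifts on the boundary: \<open>a\<close> at the bottom,
  \<open>b\<close> at the top, \<open>z\<close> on the sides. Extending this lift over the cube
  gives a homotopy from \<open>a\<close> to \<open>b\<close>.\<close>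

lemma lifts_inj:
  assumes "lifts Z W g (std_cube (Suc k)) (std_boundary (Suc k))"
    and z: "z \<in> topspace Z" and g: "continuous_map Z W g"
  shows "inj_on (homotopy_group_map k W g z) (carrier (homotopy_group k Z z))"
proof (rule inj_onI)
  fix x y assume xy: "x \<in> carrier (homotopy_group k Z z)" "y \<in> carrier (homotopy_group k Z z)"
    and eq: "homotopy_group_map k W g z x = homotopy_group_map k W g z y"
  then obtain a b where ab: "a \<in> cube_maps k Z z" "b \<in> cube_maps k Z z"
    "x = cube_class k Z z a" "y = cube_class k Z z b" by (auto simp: homotopy_group_def)
  have "cube_class k W (g z) (g \<circ> a) = cube_class k W (g z) (g \<circ> b)"
    using eq ab homotopy_group_map_class[OF _ g] by simp
  then have "cube_homotopic k W (g z) (g \<circ> a) (g \<circ> b)"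
    using cube_class_eq_iff[OF cube_maps_compose[OF ab(1) g]] by simp
  then obtain H where H: "cmap ({0..1} \<times> std_cube k) W H"
    "\<And>x. x \<in> std_cube k \<Longrightarrow> H (0::real, x) = g (a (res k x)) \<and> H (1, x) = g (b (res k x))"
    "\<And>t x. t \<in> {0..1} \<Longrightarrow> x \<in> std_boundary k \<Longrightarrow> H (t, x) = g z"
    unfolding cube_homotopic_iff by auto
  let ?B = "std_boundary (Suc k)" and ?C = "std_cube (Suc k)"
  define c where "c = (\<lambda>y. if y k = 0 then a (res k (y(k := 0))) else if y k = 1 then b (res k (y(k := 0))) else z)"
  have drop: "y(k := 0) \<in> std_cube k" if "y \<in> ?C" for y using that by (auto simp: std_cube_def)
  have cn: "cube_norm k (y(k := s)) = cube_norm k y" for y s by (rule cube_norm_cong) simp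
  have side: "y(k := 0) \<in> std_boundary k" if "y \<in> ?B" "cube_norm k y = 1" for y
    using that drop[of y] std_boundary_subset[of "Suc k"] by (auto simp: std_boundary_iff cn)
  let ?S0 = "{y \<in> ?B. y k = 0}" and ?S1 = "{y \<in> ?B. y k = 1}" and ?S2 = "{y \<in> ?B. cube_norm k y = 1}"
  have az: "a (res k x) = z" "b (res k x) = z" if "x \<in> std_boundary k" for x
    using ab that by (auto simp: cube_maps_iff)
  have cS: "cmap {y \<in> ?B. P y} Z (\<lambda>y. e (res k (y(k := 0))))" if "e \<in> cube_maps k Z z" for e P
  proof (rule cmap_comp[where T = "std_cube k" and g = "\<lambda>x. e (res k x)"])
    show "cmap (std_cube k) Z (\<lambda>x. e (res k x))" using that by (simp add: cube_maps_iff)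
    show "y(k := 0) \<in> std_cube k" if "y \<in> {y \<in> ?B. P y}" for y
      using that drop std_boundary_subset by blast
  qed (intro continuous_intros)
  have "cmap (?S0 \<union> (?S1 \<union> ?S2)) Z c"
  proof (intro cmap_Un closed_Un)
    have "closed ({y. y k = 0} \<inter> ?B)" "closed ({y. y k = 1} \<inter> ?B)" "closed ({y. cube_norm k y = 1} \<inter> ?B)"
      by (intro closed_Int closed_Collect_eq continuous_intros closed_std_boundary)+
    then show "closed ?S0" "closed ?S1" "closed ?S2" "closed ?S1" "closed ?S2"
      by (simp_all add: Int_def conj_commute)
    show "cmap ?S0 Z c" by (rule cmap_cong[OF cS[OF ab(1)]]) (simp add: c_def)
    show "cmap ?S1 Z c" by (rule cmap_cong[OF cS[OF ab(2)]]) (simp add: c_def)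
    have "cmap ?S2 Z (\<lambda>_. z)" using z by simp
    then show "cmap ?S2 Z c" by (rule cmap_cong) (use side az in \<open>auto simp: c_def\<close>)
  qed
  moreover have "?B \<subseteq> ?S0 \<union> (?S1 \<union> ?S2)"
  proof
    fix y assume y: "y \<in> ?B"
    then have "cube_norm k y = 1 \<or> \<bar>2 * y k - 1\<bar> = 1" by (auto simp: std_boundary_iff max_def split: if_splits)
    with y show "y \<in> ?S0 \<union> (?S1 \<union> ?S2)" by (auto simp: abs_if split: if_splits)
  qed
  ultimately have c: "cmap ?B Z c" by (rule cmap_subset)
  have d: "cmap ?C W (\<lambda>y. H (y k, y(k := 0)))"
    by (rule cmap_comp[OF H(1)]) (use drop in \<open>auto intro!: continuous_intros simp: std_cube_def\<close>)
  have cd: "\<forall>y\<in>?B. H (y k, y(k := 0)) = g (c y)"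
  proof
    fix y assume y: "y \<in> ?B"
    then have yC: "y(k := 0) \<in> std_cube k" using drop std_boundary_subset by blast
    show "H (y k, y(k := 0)) = g (c y)"
    proof (cases "y k = 0 \<or> y k = 1")
      case True
      then show ?thesis using H(2)[OF yC] by (auto simp: c_def)
    next
      case False
      then have "y(k := 0) \<in> std_boundary k" using y \<open>?B \<subseteq> ?S0 \<union> (?S1 \<union> ?S2)\<close> side by blast
      moreover have "y k \<in> {0..1}" using y by (auto simp: std_boundary_def std_cube_def)
      ultimately show ?thesis using H(3) False by (simp add: c_def)
    qed
  qed
  have sl: "strictly_lifts Z W g ?C ?B"
    by (rule lifts_imp_strictly_lifts[OF assms(1) std_boundary_subset])
  obtain G where G: "cmap ?C Z G" "\<And>y. y \<in> ?B \<Longrightarrow> G y = c y"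
    by (rule strictly_liftsE[OF sl c d cd]) (rule that)
  have up: "x(k := t) \<in> ?C" if "x \<in> std_cube k" "t \<in> {0..1}" for x t
    using that by (auto simp: std_cube_def less_Suc_eq)
  have xk: "x k = 0" if "x \<in> std_cube k" for x using that by (simp add: std_cube_def)
  have idem: "x(k := 0) = x" if "x \<in> std_cube k" for x using that by (auto simp: std_cube_def)
  have end0: "G (x(k := 0)) = a (res k x)" and end1: "G (x(k := 1)) = b (res k x)" if x: "x \<in> std_cube k" for x
  proof -
    have "x(k := 0) \<in> ?B" "x(k := 1) \<in> ?B"
      using up[OF x, of 0] up[OF x, of 1] by (auto simp: std_boundary_def)
    then show "G (x(k := 0)) = a (res k x)" "G (x(k := 1)) = b (res k x)"
      using G(2) idem[OF x] xk[OF x] by (simp_all add: c_def)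
  qed
  have sides: "G (x(k := t)) = z" if x: "x \<in> std_boundary k" and t: "t \<in> {0..1}" for x t
  proof -
    have xC: "x \<in> std_cube k" using x std_boundary_subset by blast
    then have "x(k := t) \<in> ?B" using up[OF xC t] x by (auto simp: std_boundary_iff std_cube_iff cn)
    then show ?thesis using G(2) az[OF x] idem[OF xC] by (simp add: c_def)
  qed
  have "cmap ({0..1} \<times> std_cube k) Z (\<lambda>p. G ((snd p)(k := fst p)))"
    by (rule cmap_comp[OF G(1)]) (auto intro!: continuous_intros up[simplified])
  then have "cube_homotopic k Z z a b"
    unfolding cube_homotopic_iff using end0 end1 sides
    by (intro exI[of _ "\<lambda>p. G ((snd p)(k := fst p))"]) auto
  then show "x = y" using ab(3,4) cube_class_eq_iff[OF ab(1)] by simp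
qed

lemma lifts_upto_connected_map_upto:
  assumes l: "lifts_upto Z W g m" and g: "continuous_map Z W g"
  shows "connected_map_upto m Z W g"
proof (cases "m \<le> -1 \<or> (topspace Z = {} \<and> topspace W = {})")
  case False
  then have m: "0 \<le> m" and ne: "topspace Z \<noteq> {} \<or> topspace W \<noteq> {}" by auto
  have "topspace W \<noteq> {}" using ne continuous_map_image_subset_topspace[OF g] by auto
  then obtain w where w: "w \<in> topspace W" by blast
  have sl: "strictly_lifts Z W g (std_cube 0) (std_boundary 0)"
    using l m unfolding lifts_upto_def by (intro lifts_imp_strictly_lifts std_boundary_subset) auto
  have B0: "std_boundary 0 = {}" by (simp add: std_boundary_def)
  \<comment> \<open>The boundary of the 0-cube is empty, so any function serves as boundary data;
    lifting the constant map to \<open>w\<close> shows that \<open>Z\<close> is nonempty.\<close>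
  have "cmap (std_boundary 0) Z undefined" unfolding B0 by (simp add: continuous_map_on_empty)
  moreover have "cmap (std_cube 0) W (\<lambda>_. w)" using w by simp
  moreover have "\<forall>x\<in>std_boundary 0. w = g (undefined x)" unfolding B0 by simp
  ultimately obtain a where "cmap (std_cube 0) Z a"
    by (rule strictly_liftsE[OF sl]) (rule that)
  then have "a (\<lambda>_. 0) \<in> topspace Z"
    using continuous_map_image_subset_topspace std_cube_nonempty[of 0] by fastforce
  then have neZ: "topspace Z \<noteq> {}" by blast
  have ll: "lifts Z W g (std_cube k) (std_boundary k)" if "int k \<le> m" for k
    using l that by (simp add: lifts_upto_def)
  \<comment> \<open>Bijectivity in degree \<open>k\<close> uses lifting in dimensions
    \<open>k\<close> and \<open>k + 1\<close>, so it stops at \<open>m - 1\<close>; degree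
    \<open>m\<close> is left with surjectivity.\<close>
  have bij: "bij_betw (homotopy_group_map k W g z) (carrier (homotopy_group k Z z)) (carrier (homotopy_group k W (g z)))"
    if "z \<in> topspace Z" "int k \<le> m - 1" for z k
    using that lifts_inj[OF ll that(1) g, of k] lifts_surj[OF ll that(1) g, of k]
    by (simp add: bij_betw_def)
  show ?thesis
    unfolding connected_map_upto_def iso_def
    using g neZ \<open>topspace W \<noteq> {}\<close> bij lifts_surj[OF ll _ g] homotopy_group_map_hom[OF _ g]
    by auto
next
  case True
  then show ?thesis using g by (auto simp: connected_map_upto_def)
qed

section \<open>Intersections of stars of upper sets\<close>

lemma finite_chain_greatest:
  assumes s: "partial_order_on Q s" and "finite C" "C \<noteq> {}" "C \<subseteq> Q" "C \<in> Chains s"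
  shows "\<exists>q\<in>C. \<forall>p\<in>C. (p, q) \<in> s"
  using assms(2-)
proof (induction C rule: finite_ne_induct)
  case (singleton x)
  then show ?case by (auto simp: Chains_def)
next
  case (insert x C)
  then obtain q where q: "q \<in> C" "\<And>p. p \<in> C \<Longrightarrow> (p, q) \<in> s"
    using Chains_subset[OF insert.prems(2)] by blast
  have tr: "trans s" using s by (simp add: partial_order_on_def preorder_on_def)
  have xx: "(x, x) \<in> s" using insert.prems by (auto simp: Chains_def)
  have "(x, q) \<in> s \<or> (q, x) \<in> s" using insert.prems(2) q(1) unfolding Chains_def by blast
  then show ?case
  proof
    assume "(x, q) \<in> s" then show ?thesis using q by blast
  next
    assume "(q, x) \<in> s"
    then have "(p, x) \<in> s" if "p \<in> insert x C" for p using that q(2) xx transD[OF tr] by blast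
    then show ?thesis by blast
  qed
qed

lemma Inter_star_up_set:
  assumes s: "partial_order_on Q s" and "finite S" "S \<noteq> {}"
  shows "bounded_above Q s S \<or> (\<Inter>m\<in>S. star Q s (up_set Q s m)) = {}"
    and "is_join Q s S j \<Longrightarrow> (\<Inter>m\<in>S. star Q s (up_set Q s m)) = star Q s (up_set Q s j)"
proof -
  have tr: "trans s" using s by (simp add: partial_order_on_def preorder_on_def)
  \<comment> \<open>For each \<open>m\<close> some vertex of \<open>y\<close> lies above it,
    possibly a different one each time; the greatest vertex of \<open>y\<close> lies above every
    \<open>m\<close> at once.\<close>
  have top: "\<exists>q \<in> supp y. q \<in> upper_bounds Q s S" if y: "y \<in> (\<Inter>m\<in>S. star Q s (up_set Q s m))" for y
  proof -
    have yt: "y \<in> topspace (realization Q s)" using y assms(3) by (auto simp: star_def)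
    then obtain q where q: "q \<in> supp y" "\<And>p. p \<in> supp y \<Longrightarrow> (p, q) \<in> s"
      using finite_chain_greatest[OF s, of "supp y"] supp_nonempty[OF yt] by (auto simp: realization_iff)
    have "(m, q) \<in> s" if m: "m \<in> S" for m
    proof -
      obtain p where "p \<in> supp y" "(m, p) \<in> s" using y m by (auto simp: star_def up_set_def)
      then show ?thesis using q(2) transD[OF tr] by blast
    qed
    then show ?thesis using q(1) yt by (auto simp: upper_bounds_def realization_iff)
  qed
  then show "bounded_above Q s S \<or> (\<Inter>m\<in>S. star Q s (up_set Q s m)) = {}"
    unfolding bounded_above_def by blast
  assume j: "is_join Q s S j"
  show "(\<Inter>m\<in>S. star Q s (up_set Q s m)) = star Q s (up_set Q s j)"
  proof (intro equalityI subsetI)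
    fix y assume y: "y \<in> (\<Inter>m\<in>S. star Q s (up_set Q s m))"
    then have yt: "y \<in> topspace (realization Q s)" using assms(3) by (auto simp: star_def)
    obtain q where "q \<in> supp y" "q \<in> upper_bounds Q s S" using top[OF y] by blast
    then show "y \<in> star Q s (up_set Q s j)"
      using j yt by (auto simp: star_def up_set_def is_join_def upper_bounds_def)
  next
    fix y assume "y \<in> star Q s (up_set Q s j)"
    then obtain q where q: "q \<in> Q" "(j, q) \<in> s" "y q \<noteq> 0" and yt: "y \<in> topspace (realization Q s)"
      by (auto simp: star_def up_set_def)
    have "(m, q) \<in> s" if "m \<in> S" for m
      using j that q(2) transD[OF tr] by (auto simp: is_join_def upper_bounds_def)
    then show "y \<in> (\<Inter>m\<in>S. star Q s (up_set Q s m))" using q yt by (auto simp: star_def up_set_def)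
  qed
qed

theorem proposition9p5:
  fixes n :: int
    and P :: "'a set" and r :: "'a rel"
    and Q :: "'b set" and s :: "'b rel"
    and f :: "'a \<Rightarrow> 'b"
  assumes "partial_order_on P r"
    and "partial_order_on Q s"
    and "f \<in> P \<rightarrow> Q"
    and "monotone_on P (\<lambda>x y. (x, y) \<in> r) (\<lambda>x y. (x, y) \<in> s) f"
    and "coherent_poset Q s"
    and "\<And>(k::nat) (m::nat \<Rightarrow> 'b) j.
           k \<ge> 1 \<Longrightarrow> m ` {1..k} \<subseteq> minimal_elements Q s \<Longrightarrow> is_join Q s (m ` {1..k}) j \<Longrightarrow>
           connected_space_upto (n - int k + 1) (realization {p \<in> P. f p \<in> up_set Q s j} r)"
  shows "connected_map_upto (n + 1) (realization P r) (realization Q s) (realization_map f)"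
proof -
  let ?X = "realization P r" and ?Y = "realization Q s" and ?f = "realization_map f"
  let ?M = "minimal_elements Q s"
  let ?U = "\<lambda>q. star Q s (up_set Q s q)"
  have cont: "continuous_map ?X ?Y ?f" by (rule continuous_map_realization_map[OF assms(3,4)])
  have refl: "(q, q) \<in> s" if "q \<in> Q" for q
    using assms(2) that by (auto simp: partial_order_on_def preorder_on_def refl_on_def)
  \<comment> \<open>The support of \<open>?f x\<close> is the image of the support of
    \<open>x\<close>, so the preimage of a star is the star of the fibre in
    \<open>P\<close>.\<close>
  have pre: "?f x \<in> ?U q \<longleftrightarrow> x \<in> star P r {p \<in> P. f p \<in> up_set Q s q}"
    if x: "x \<in> topspace ?X" for x q
  proof -
    have sp: "supp (?f x) = f ` supp x" using x by (intro supp_realization_map) (auto simp: realization_iff)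
    have "?f x q' \<noteq> 0 \<longleftrightarrow> q' \<in> f ` supp x" for q' unfolding sp[symmetric] by simp
    then have "(\<exists>q'\<in>up_set Q s q. ?f x q' \<noteq> 0) \<longleftrightarrow> (\<exists>p\<in>supp x. f p \<in> up_set Q s q)" by auto
    moreover have "supp x \<subseteq> P" using x by (simp add: realization_iff)
    ultimately show ?thesis using x realization_map_in[OF x assms(3,4)] by (auto simp: star_def)
  qed
  \<comment> \<open>The bound is the one that the cover argument requires for
    \<open>N = n + 1\<close>. If \<open>S\<close> is unbounded, the intersection is empty and
    lifting is vacuous.\<close>
  have lS: "lifts_upto ?X (subtopology ?Y (\<Inter>m\<in>S. ?U m)) ?f (n + 1 + 1 - int (card S))"
    if S: "finite S" "S \<subseteq> ?M" "S \<noteq> {}" for S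
  proof (cases "bounded_above Q s S")
    case False
    then show ?thesis using Inter_star_up_set(1)[OF assms(2) S(1,3)] by (intro lifts_upto_empty) auto
  next
    case True
    then obtain j where j: "is_join Q s S j" using assms(5) S unfolding coherent_poset_def by blast
    then have jQ: "j \<in> Q" by (simp add: is_join_def upper_bounds_def)
    let ?W = "{p \<in> P. f p \<in> up_set Q s j}"
    \<comment> \<open>Enumerating \<open>S\<close> without repetition makes the number
      \<open>k\<close> in the connectivity hypothesis equal to \<open>card S\<close>.\<close>
    obtain h where h: "bij_betw h {1..card S} S" using ex_bij_betw_nat_finite_1[OF S(1)] by blast
    have im: "h ` {1..card S} = S" using h by (simp add: bij_betw_def)
    have cS: "card S \<ge> 1" using S by (simp add: Suc_leI card_gt_0_iff)
    have conn: "connected_space_upto (n - int (card S) + 1) (realization ?W r)"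
      using assms(6)[OF cS, of h j] im S(2) j by simp
    let ?YU = "subtopology ?Y (?U j)"
    have tY: "topspace ?YU = ?U j" by (auto simp: star_def)
    have sub: "subtopology ?X {x. ?f x \<in> topspace ?YU} = subtopology ?X (star P r ?W)"
    proof -
      have "topspace ?X \<inter> {x. ?f x \<in> ?U j} = topspace ?X \<inter> star P r ?W" using pre by auto
      then show ?thesis
        unfolding tY using subtopology_restrict[of ?X "{x. ?f x \<in> ?U j}"] subtopology_restrict[of ?X "star P r ?W"]
        by simp
    qed
    have "lifts ?X ?YU ?f (std_cube k) (std_boundary k)" if k: "int k \<le> n + 1 + 1 - int (card S)" for k
    proof (rule lifts_fills)
      show "fills (subtopology ?X {x. ?f x \<in> topspace ?YU}) k"
        unfolding sub by (rule fills_star[OF fills_connected_space_upto[OF conn]]) (use k in auto)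
      show "fills ?YU (Suc k)"
        by (rule fills_star, rule fills_minimum[of j]) (use jQ refl in \<open>auto simp: up_set_def\<close>)
      show "continuous_map (subtopology ?X {x. ?f x \<in> topspace ?YU}) ?YU ?f"
        unfolding continuous_map_in_subtopology tY
        using continuous_map_from_subtopology[OF cont] by auto
    qed
    then show ?thesis
      unfolding Inter_star_up_set(2)[OF assms(2) S(1,3) j] lifts_upto_def by blast
  qed
  have cover: "y \<in> (\<Union>m\<in>?M. ?U m)" if y: "y \<in> topspace ?Y" for y
  proof -
    obtain q where q: "q \<in> supp y" using supp_nonempty[OF y] by blast
    then have "q \<in> Q" using y by (auto simp: realization_iff)
    then obtain m where "m \<in> ?M" "(m, q) \<in> s" using assms(5) unfolding coherent_poset_def by blast
    then show ?thesis using q y \<open>q \<in> Q\<close> by (auto simp: star_def up_set_def)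
  qed
  have "lifts_upto ?X ?Y ?f (n + 1)"
    unfolding lifts_upto_def
  proof (intro allI impI)
    fix k assume k: "int k \<le> n + 1"
    show "lifts ?X ?Y ?f (std_cube k) (std_boundary k)"
    proof (rule liftsI)
      let ?D = "{1} \<times> std_cube k \<union> {0..1::real} \<times> std_boundary k"
      fix a and g :: "real \<times> _ \<Rightarrow> _"
      assume a: "cmap (std_boundary k) ?X a" and g: "cmap ?D ?Y g"
        and ag: "\<forall>x\<in>std_boundary k. g (0, x) = ?f (a x)"
      \<comment> \<open>The gluing argument handles finitely many open sets, and finitely many stars
        cover the image of the compact set \<open>?D\<close>. A solution over their union is also
        one over \<open>?Y\<close>.\<close>
      have "compact ?D" by (intro compact_Un compact_Times) simp_all
      then have gc: "compactin ?Y (g ` ?D)"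
        using image_compactin[OF _ g, of ?D] by (simp add: compactin_subtopology)
      have gU: "g ` ?D \<subseteq> \<Union>(?U ` ?M)"
        using continuous_map_image_subset_topspace[OF g] cover by auto
      have "openin ?Y V" if "V \<in> ?U ` ?M" for V using that openin_star by auto
      then obtain \<F> where \<F>: "finite \<F>" "\<F> \<subseteq> ?U ` ?M" "g ` ?D \<subseteq> \<Union>\<F>"
        using compactinD[OF gc _ gU] by auto
      then obtain F where F: "F \<subseteq> ?M" "finite F" "\<F> = ?U ` F"
        using finite_subset_image[OF \<F>(1,2)] by auto
      have "lifts_upto ?X (subtopology ?Y (\<Union>m\<in>F. ?U m)) ?f (n + 1)"
      proof (rule lifts_upto_cover[OF F(2) openin_star])
        show "lifts_upto ?X (subtopology ?Y (\<Inter>m\<in>S. ?U m)) ?f (n + 1 + 1 - int (card S))"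
          if "S \<subseteq> F" "S \<noteq> {}" for S
          by (rule lS) (use that F finite_subset in auto)
      qed
      then have l: "lifts ?X (subtopology ?Y (\<Union>m\<in>F. ?U m)) ?f (std_cube k) (std_boundary k)"
        using k by (simp add: lifts_upto_def)
      have g': "cmap ?D (subtopology ?Y (\<Union>m\<in>F. ?U m)) g"
        using g \<F>(3) F(3) by (simp add: continuous_map_in_subtopology image_subset_iff_funcset)
      have "(\<exists>a' g'. cmap (std_cube k) ?X a' \<and>
          cmap ({0..1} \<times> std_cube k) (subtopology ?Y (\<Union>m\<in>F. ?U m)) g' \<and>
          (\<forall>x\<in>std_boundary k. a' x = a x) \<and> (\<forall>p\<in>?D. g' p = g p) \<and>
          (\<forall>x\<in>std_cube k. g' (0, x) = ?f (a' x)))"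
        using l[unfolded lifts_def, rule_format, of a g] a g' ag by simp
      then obtain a' g'' where "cmap (std_cube k) ?X a'" "cmap ({0..1} \<times> std_cube k) (subtopology ?Y (\<Union>m\<in>F. ?U m)) g''"
        "\<forall>x\<in>std_boundary k. a' x = a x" "\<forall>p\<in>?D. g'' p = g p"
        "\<forall>x\<in>std_cube k. g'' (0, x) = ?f (a' x)" by auto
      then show "\<exists>a' g'. cmap (std_cube k) ?X a' \<and> cmap ({0..1} \<times> std_cube k) ?Y g' \<and>
          (\<forall>x\<in>std_boundary k. a' x = a x) \<and> (\<forall>p\<in>?D. g' p = g p) \<and>
          (\<forall>x\<in>std_cube k. g' (0, x) = ?f (a' x))"
        by (intro exI[of _ a'] exI[of _ g'']) (auto simp: continuous_map_in_subtopology)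
    qed
  qed
  then show ?thesis using cont by (rule lifts_upto_connected_map_upto)
qed

end
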